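(* Let $\mathbf d\in\{\mathbb W_p,\mathbb W_p^{\rm ad}\}$ and $\mu\in\mathcal P_p(\mathbb X)$. Let $\varphi:\mathcal P_p(\mathbb X)\to\mathbb R^k$ satisfy the regularity condition (R) with $\varphi(\mu)=0$, and let $\psi:\mathbb X\to\mathbb R^l$, $\varphi$ and $\mu$ satisfy condition $\mathbf A_{\mathbf d}$. Let $\Theta:\mathbb X\to\mathbb X$ be a compactly supported $C^1$ function belonging to $\mathbb L^p_{\mathbf d}(\mu)$. Then there exists $C>0$ such that $$\limsup_{r\to0}\frac1r\,\mathbf d\big(\mu^{r\Theta},\ \varphi^{-1}(\{0\})\cap\mathcal E_\psi^\perp\big)\ \le\ C\Big(\big|\mathbb E^\mu[(\partial_x^{\mathbf d}\delta_m\varphi)\Theta]\big|+\big\|\mathbb E^\mu_1[(\partial_x^{\mathbf d}\psi)\Theta]\big\|_{\mathbb L^p(\mu_1)}\Big).$$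
   Context: Basic notation. $p>1$, $p'=p/(p-1)$, $d\ge1$, $S=\mathbb R^d$, $\mathbb X=S\times S$ with Euclidean norms $|\cdot|$; points are $x=(x_1,x_2)$. $\mathcal P_p(\mathbb X)$ is the set of probability measures on $\mathbb X$ with finite $p$-th moment. $X=(X_1,X_2)$ is the canonical variable on $\mathbb X$; on $\mathbb X\times\mathbb X$, $(X,X')$ are the two coordinate projections. $\mu_i=\mu\circ X_i^{-1}$ and $\mathbb E^\mu_i[\cdot]=\mathbb E^\mu[\cdot\,|X_i]$. For $T:\mathbb X\to\mathbb X$, $\mu^T=\mu\circ(X+T(X))^{-1}$. Distances. $\Pi(\mu,\mu')$ is the set of couplings of $\mu,\mu'$ and $\mathbb W_p(\mu,\mu')=\inf_{\pi\in\Pi(\mu,\mu')}\mathbb E^\pi[|X-X'|^p]^{1/p}$. A probability $\pi$ on $\mathbb X\times\mathbb X$ is causal if for all bounded Borel $f:\mathbb X\to\mathbb R$, $g:S\to\mathbb R$, $\mathbb E^\pi[f(X_1,X_2)g(X_1')|X_1]=\mathbb E^\pi[f(X_1,X_2)|X_1]\,\mathbb E^\pi[g(X_1')|X_1]$; $\Pi^{bc}(\mu,\mu')$ is the set of $\pi\in\Pi(\mu,\mu')$ such that $\pi$ and $\pi\circ(X',X)^{-1}$ are causal, and $\mathbb W_p^{\rm ad}(\mu,\mu')=\inf_{\pi\in\Pi^{bc}(\mu,\mu')}\mathbb E^\pi[|X-X'|^p]^{1/p}$. For a set $U$ of measures, $\mathbf d(\mu,U)=\inf_{u\in U}\mathbf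 d(\mu,u)$. A map $\Theta=(\Theta_1,\Theta_2):\mathbb X\to\mathbb X$ is adapted if $\Theta_1$ depends on $x_1$ only. $\mathbb L^p_{\mathbf d}(\mu)=\mathbb L^p(\mu)$ if $\mathbf d=\mathbb W_p$, and it is the set of adapted elements of $\mathbb L^p(\mu)$ if $\mathbf d=\mathbb W_p^{\rm ad}$. Derivatives. A function $g$ on $\mathcal P_p(\mathbb X)$ has linear functional derivative $\delta_mg:\mathcal P_p(\mathbb X)\times\mathbb X\to\mathbb R$ if $\delta_mg$ is continuous (for $\mathbb W_p$ on measures), has $p$-polynomial growth in $x$ (bounded by $C(1+|x|^p)$) locally uniformly in $m$, and for all $\mu,\mu'$, $\lambda^{-1}(g(\mu+\lambda(\mu'-\mu))-g(\mu))\to\int\delta_mg(\mu,x)(\mu'-\mu)(dx)$ as $\lambda\searrow0$ (componentwise for vector-valued maps). Condition (R): the map has a linear functional derivative which is $C^1$ in $x$, and $\partial_x\delta_m g$ is jointly continuous with $(p-1)$-polynomial growth in $x$, locally in $m$. All $\delta_m$-derivatives are evaluated at $(\mu,X)$; derivatives of $\mathbb R^k$-valued functions are matrices with $k$ rows. $\partial_x^{\mathbf d}u=\partial_xu$ if $\mathbf d=\mathbb W_p$, and $\partial_x^{\mathbf d}u=\partial_x^{\rm ad}u=(\mathbb E_1^\mu[\partial_{x_1}u],\partial_{x_2}u)$ if $\mathbf d=\mathbb W_p^{\rm ad}$. Constraint set. $\mathcal E_\psi=\{x\mapsto h(x_1)\cdot\psi(x):h\in C^1_b(S,\mathbb R^l)\}$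 and $\mathcal E_\psi^\perp=\{\mu'\in\mathcal P_p(\mathbb X):\int f\,d\mu'=0\ \forall f\in\mathcal E_\psi\}$, i.e. the measures with $\mathbb E^{\mu'}[\psi(X)|X_1]=0$. For a vector or matrix $A$ with Euclidean (Frobenius) norm $|A|$, $\mathbf N(A)=A/|A|^{2-p'}$ ($\mathbf N(0)=0$); for $A=(A_1,A_2)$ split according to $x_1,x_2$, $\mathbf N_{\rm ad}(A)=(\mathbf N(A_1),\mathbf N(A_2))$. For symmetric matrices, $A\ge B$ means $\lambda_{\min}(A-B)\ge0$. Condition $\mathbf A_{\mathbb W_p}$: $\psi=0$ and, for some $c>0$, $\mathbb E^\mu\big[(\partial_x\delta_m\varphi)(\partial_x\delta_m\varphi)^\intercal/|\partial_x\delta_m\varphi|^{2-p'}\big]\ge c\,{\rm Id}$. Condition $\mathbf A_{\mathbb W_p^{\rm ad}}$: (i) $\mathbb E^\mu_1[|X_2|]$ is $\mu_1$-essentially bounded on every compact subset of $S$; (ii) $\psi$ is $C^2$ with bounded first and second derivatives and $\mathbb E_1^\mu[\psi]=0$; (iii) for some $c>0$, $\mathbb E_1^\mu[(\partial_{x_2}\psi)(\partial_{x_2}\psi)^\intercal]\ge c\,{\rm Id}$ $\mu_1$-a.s.; (iv) there is $c>0$ such that for all $\lambda\in\mathbb R^k$, $h\in\mathbb L^{p'}(\mu_1)$ ($\mathbb R^l$-valued), $\|\partial_x^{\rm ad}\delta_m(\lambda\cdot\varphi)+(\partial_x^{\rm ad}\psi)^\intercal h\|_{\mathbb L^{p'}(\mu)}\ge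 c(|\lambda|+\|h\|_{\mathbb L^{p'}(\mu)})$; (v) with $\Lambda=\partial_x^{\rm ad}\delta_m\varphi$, the $k\times k$ matrix $\mathbb E^\mu\big[\Lambda\mathbf N_{\rm ad}(\Lambda)^\intercal-(\partial_{x_2}\delta_m\varphi)(\partial_{x_2}\psi)^\intercal\,\mathbb E_1^\mu[(\partial_{x_2}\psi)(\partial_{x_2}\psi)^\intercal]^{-1}\,\mathbb E_1^\mu[\partial_x\psi\,\mathbf N_{\rm ad}(\Lambda)^\intercal]\big]$ is invertible. *)

theory Defs
  imports "HOL-Probability.Probability"
begin

section \<open>Laws, conditional expectations, and transport distances\<close>

text \<open>
  The state space is \<open>S = real ^ 'd\<close> and the path space is \<open>S \<times> S\<close>; the product norm of the
  library is the Euclidean norm of \<open>S \<times> S\<close>.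
\<close>

type_synonym 'd path = "(real ^ 'd) \<times> (real ^ 'd)"

definition conj_exp :: "real \<Rightarrow> real" where
  "conj_exp p = p / (p - 1)"

definition prob_moment :: "real \<Rightarrow> ('a::euclidean_space) measure set" where
  "prob_moment p = {m. prob_space m \<and> sets m = sets borel \<and> integrable m (\<lambda>x. norm x powr p)}"

definition Lp :: "real \<Rightarrow> 'a measure \<Rightarrow> ('a \<Rightarrow> 'b::euclidean_space) set" where
  "Lp q m = {f \<in> borel_measurable m. integrable m (\<lambda>x. norm (f x) powr q)}"

definition Lp_norm :: "real \<Rightarrow> 'a measure \<Rightarrow> ('a \<Rightarrow> 'b::euclidean_space) \<Rightarrow> real" where
  "Lp_norm q m f = (\<integral>x. norm (f x) powr q \<partial>m) powr (1 / q)"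

text \<open>
  \<open>cond_ex m Y f\<close> is the conditional expectation \<open>E[f | Y]\<close> of a vector- or matrix-valued \<open>f\<close>,
  taken coordinatewise. It is a \<open>\<sigma>(Y)\<close>-measurable function on the space of \<open>m\<close>, not a function of
  the value of \<open>Y\<close>; hence ``almost surely'' and \<open>L\<^sup>p\<close> norms with respect to the law of \<open>Y\<close> become
  the same notions with respect to \<open>m\<close>.
\<close>

definition cond_ex ::
  "'a measure \<Rightarrow> ('a \<Rightarrow> 'c::topological_space) \<Rightarrow> ('a \<Rightarrow> 'b::euclidean_space) \<Rightarrow> 'a \<Rightarrow> 'b" where
  "cond_ex m Y f = (\<lambda>x. \<Sum>b\<in>Basis.
     real_cond_exp m (vimage_algebra (space m) Y borel) (\<lambda>y. f y \<bullet> b) x *\<^sub>R b)"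

definition couplings ::
  "('a::euclidean_space) measure \<Rightarrow> 'a measure \<Rightarrow> ('a \<times> 'a) measure set" where
  "couplings m m' = {\<pi>. sets \<pi> = sets borel \<and> distr \<pi> borel fst = m \<and> distr \<pi> borel snd = m'}"

definition causal :: "(('d::finite) path \<times> 'd path) measure \<Rightarrow> bool" where
  "causal \<pi> \<longleftrightarrow>
    (\<forall>(f :: 'd path \<Rightarrow> real) (g :: real ^ 'd \<Rightarrow> real).
       f \<in> borel_measurable borel \<longrightarrow> bounded (range f) \<longrightarrow>
       g \<in> borel_measurable borel \<longrightarrow> bounded (range g) \<longrightarrow>
       (AE z in \<pi>. cond_ex \<pi> (\<lambda>z. fst (fst z)) (\<lambda>z. f (fst z) * g (fst (snd z))) z =
          cond_ex \<pi> (\<lambda>z. fst (fst z)) (\<lambda>z. f (fst z)) z *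
          cond_ex \<pi> (\<lambda>z. fst (fst z)) (\<lambda>z. g (fst (snd z))) z))"

definition bicausal_couplings ::
  "('d::finite) path measure \<Rightarrow> 'd path measure \<Rightarrow> ('d path \<times> 'd path) measure set" where
  "bicausal_couplings m m' =
     {\<pi> \<in> couplings m m'. causal \<pi> \<and> causal (distr \<pi> borel (\<lambda>z. (snd z, fst z)))}"

text \<open>
  The two distances are used on \<open>prob_moment p\<close> only. There the product coupling is admissible in both
  cases and every coupling has finite cost, so the real-valued integral and infimum below are the
  genuine ones.
\<close>

definition transport_cost :: "real \<Rightarrow> ('a::euclidean_space \<times> 'a) measure \<Rightarrow> real" where
  "transport_cost p \<pi> = (\<integral>z. norm (fst z - snd z) powr p \<partial>\<pi>) powr (1 / p)"

definition wasserstein :: "real \<Rightarrow> ('d::finite) path measure \<Rightarrow> 'd path measure \<Rightarrow> real" where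
  "wasserstein p m m' = (INF \<pi>\<in>couplings m m'. transport_cost p \<pi>)"

definition ad_wasserstein :: "real \<Rightarrow> ('d::finite) path measure \<Rightarrow> 'd path measure \<Rightarrow> real" where
  "ad_wasserstein p m m' = (INF \<pi>\<in>bicausal_couplings m m'. transport_cost p \<pi>)"

datatype metric_kind = W | W_ad

primrec tdist :: "metric_kind \<Rightarrow> real \<Rightarrow> ('d::finite) path measure \<Rightarrow> 'd path measure \<Rightarrow> real" where
  "tdist W = wasserstein"
| "tdist W_ad = ad_wasserstein"

text \<open>Extended-real valued, so that the distance to the empty set is infinite.\<close>

definition tdist_set ::
  "metric_kind \<Rightarrow> real \<Rightarrow> ('d::finite) path measure \<Rightarrow> 'd path measure set \<Rightarrow> ereal" where
  "tdist_set d p m U = (INF u\<in>U. ereal (tdist d p m u))"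

definition push :: "('d::finite) path measure \<Rightarrow> ('d path \<Rightarrow> 'd path) \<Rightarrow> 'd path measure" where
  "push m T = distr m borel (\<lambda>x. x + T x)"


section \<open>Smooth functions and Jacobians\<close>

definition C1 :: "('a::euclidean_space \<Rightarrow> 'b::euclidean_space) \<Rightarrow> bool" where
  "C1 f \<longleftrightarrow> (\<exists>f' :: 'a \<Rightarrow> 'a \<Rightarrow>\<^sub>L 'b.
     (\<forall>x. (f has_derivative blinfun_apply (f' x)) (at x)) \<and> continuous_on UNIV f')"

definition C1_bounded :: "('a::euclidean_space \<Rightarrow> 'b::euclidean_space) \<Rightarrow> bool" where
  "C1_bounded f \<longleftrightarrow> bounded (range f) \<and> (\<exists>f' :: 'a \<Rightarrow> 'a \<Rightarrow>\<^sub>L 'b.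
     (\<forall>x. (f has_derivative blinfun_apply (f' x)) (at x)) \<and> continuous_on UNIV f' \<and>
     bounded (range f'))"

text \<open>The function itself is not required to be bounded here.\<close>

definition C2_bounded_derivs :: "('a::euclidean_space \<Rightarrow> 'b::euclidean_space) \<Rightarrow> bool" where
  "C2_bounded_derivs f \<longleftrightarrow> (\<exists>(f' :: 'a \<Rightarrow> 'a \<Rightarrow>\<^sub>L 'b) (f'' :: 'a \<Rightarrow> 'a \<Rightarrow>\<^sub>L ('a \<Rightarrow>\<^sub>L 'b)).
     (\<forall>x. (f has_derivative blinfun_apply (f' x)) (at x)) \<and>
     (\<forall>x. (f' has_derivative blinfun_apply (f'' x)) (at x)) \<and>
     continuous_on UNIV f'' \<and> bounded (range f') \<and> bounded (range f''))"

text \<open>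
  A matrix with \<open>k\<close> rows whose columns are split according to \<open>x\<^sub>1, x\<^sub>2\<close> is a pair of blocks
  \<open>(A\<^sub>1, A\<^sub>2)\<close>; the library norm of such a pair is the Frobenius norm of the whole matrix.
\<close>

type_synonym ('d, 'k) blocks = "(real ^ 'd ^ 'k) \<times> (real ^ 'd ^ 'k)"

definition dx1 :: "(('d::finite) path \<Rightarrow> real ^ ('k::finite)) \<Rightarrow> 'd path \<Rightarrow> real ^ 'd ^ 'k" where
  "dx1 u x = jacobian (\<lambda>y. u (y, snd x)) (at (fst x))"

definition dx2 :: "(('d::finite) path \<Rightarrow> real ^ ('k::finite)) \<Rightarrow> 'd path \<Rightarrow> real ^ 'd ^ 'k" where
  "dx2 u x = jacobian (\<lambda>y. u (fst x, y)) (at (snd x))"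

definition dx :: "(('d::finite) path \<Rightarrow> real ^ ('k::finite)) \<Rightarrow> 'd path \<Rightarrow> ('d, 'k) blocks" where
  "dx u x = (dx1 u x, dx2 u x)"

definition dx_ad ::
  "('d::finite) path measure \<Rightarrow> ('d path \<Rightarrow> real ^ ('k::finite)) \<Rightarrow> 'd path \<Rightarrow> ('d, 'k) blocks" where
  "dx_ad m u x = (cond_ex m fst (dx1 u) x, dx2 u x)"

primrec dx_kind ::
  "metric_kind \<Rightarrow> ('d::finite) path measure \<Rightarrow> ('d path \<Rightarrow> real ^ ('k::finite)) \<Rightarrow> 'd path
     \<Rightarrow> ('d, 'k) blocks" where
  "dx_kind W m u = dx u"
| "dx_kind W_ad m u = dx_ad m u"

text \<open>The products \<open>A v\<close>, \<open>A\<^sup>T w\<close> and \<open>A B\<^sup>T\<close> in block form.\<close>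

definition blk_app :: "('d::finite, 'k::finite) blocks \<Rightarrow> 'd path \<Rightarrow> real ^ 'k" where
  "blk_app A v = fst A *v fst v + snd A *v snd v"

definition blk_tapp :: "('d::finite, 'k::finite) blocks \<Rightarrow> real ^ 'k \<Rightarrow> 'd path" where
  "blk_tapp A w = (transpose (fst A) *v w, transpose (snd A) *v w)"

definition blk_mult_t ::
  "('d::finite, 'l::finite) blocks \<Rightarrow> ('d, 'k::finite) blocks \<Rightarrow> real ^ 'k ^ 'l" where
  "blk_mult_t A B = fst A ** transpose (fst B) + snd A ** transpose (snd B)"

text \<open>\<open>N(A) = A / |A|\<^bsup>2 - p'\<^esup>\<close>; the value at \<open>A = 0\<close> is \<open>0\<close>, whatever the exponent.\<close>

definition Nrm :: "real \<Rightarrow> 'a::real_normed_vector \<Rightarrow> 'a" where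
  "Nrm p A = A /\<^sub>R (norm A powr (2 - conj_exp p))"

definition Nrm_ad :: "real \<Rightarrow> ('d::finite, 'k::finite) blocks \<Rightarrow> ('d, 'k) blocks" where
  "Nrm_ad p A = (Nrm p (fst A), Nrm p (snd A))"

definition eigenvalues :: "real ^ ('n::finite) ^ 'n \<Rightarrow> real set" where
  "eigenvalues M = {e. \<exists>v. v \<noteq> 0 \<and> M *v v = e *\<^sub>R v}"

text \<open>Meaningful for symmetric matrices, where the set of eigenvalues is finite and nonempty.\<close>

definition lambda_min :: "real ^ ('n::finite) ^ 'n \<Rightarrow> real" where
  "lambda_min M = Inf (eigenvalues M)"

definition mat_ge :: "real ^ ('n::finite) ^ 'n \<Rightarrow> real ^ 'n ^ 'n \<Rightarrow> bool" where
  "mat_ge A B \<longleftrightarrow> lambda_min (A - B) \<ge> 0"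


section \<open>Linear functional derivatives\<close>

text \<open>The measure \<open>m + t (m' - m)\<close>, for \<open>0 \<le> t \<le> 1\<close>.\<close>

definition mix :: "real \<Rightarrow> ('a::topological_space) measure \<Rightarrow> 'a measure \<Rightarrow> 'a measure" where
  "mix t m m' = measure_of UNIV (sets borel)
     (\<lambda>A. ennreal (1 - t) * emeasure m A + ennreal t * emeasure m' A)"

definition jointly_continuous ::
  "real \<Rightarrow> (('d::finite) path measure \<Rightarrow> 'd path \<Rightarrow> 'b::euclidean_space) \<Rightarrow> bool" where
  "jointly_continuous p F \<longleftrightarrow>
     (\<forall>m\<in>prob_moment p. \<forall>x. \<forall>e>0. \<exists>\<delta>>0. \<forall>m'\<in>prob_moment p. \<forall>x'.
        wasserstein p m m' < \<delta> \<longrightarrow> dist x x' < \<delta> \<longrightarrow> dist (F m x) (F m' x') < e)"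

text \<open>Growth of order \<open>q\<close> in \<open>x\<close>, with a constant that is uniform near every measure.\<close>

definition poly_growth ::
  "real \<Rightarrow> real \<Rightarrow> (('d::finite) path measure \<Rightarrow> 'd path \<Rightarrow> 'b::euclidean_space) \<Rightarrow> bool" where
  "poly_growth p q F \<longleftrightarrow>
     (\<forall>m0\<in>prob_moment p. \<exists>\<delta>>0. \<exists>C. \<forall>m\<in>prob_moment p. wasserstein p m0 m < \<delta> \<longrightarrow>
        (\<forall>x. norm (F m x) \<le> C * (1 + norm x powr q)))"

text \<open>
  A linear functional derivative is determined up to an additive constant depending on the measure
  only; its \<open>x\<close>-derivatives, which are all that is used below, do not depend on the choice.
\<close>

definition has_lin_fun_deriv ::
  "real \<Rightarrow> (('d::finite) path measure \<Rightarrow> real ^ ('k::finite)) \<Rightarrow>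
     ('d path measure \<Rightarrow> 'd path \<Rightarrow> real ^ 'k) \<Rightarrow> bool" where
  "has_lin_fun_deriv p g D \<longleftrightarrow>
     jointly_continuous p D \<and> poly_growth p p D \<and>
     (\<forall>m\<in>prob_moment p. \<forall>m'\<in>prob_moment p.
        ((\<lambda>t. (g (mix t m m') - g m) /\<^sub>R t) \<longlongrightarrow> (\<integral>x. D m x \<partial>m') - (\<integral>x. D m x \<partial>m)) (at_right 0))"

definition condition_R ::
  "real \<Rightarrow> (('d::finite) path measure \<Rightarrow> real ^ ('k::finite)) \<Rightarrow>
     ('d path measure \<Rightarrow> 'd path \<Rightarrow> real ^ 'k) \<Rightarrow> bool" where
  "condition_R p g D \<longleftrightarrow>
     has_lin_fun_deriv p g D \<and> (\<forall>m\<in>prob_moment p. C1 (D m)) \<and>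
     jointly_continuous p (\<lambda>m. dx (D m)) \<and> poly_growth p (p - 1) (\<lambda>m. dx (D m))"


section \<open>Constraint sets, test maps and nondegeneracy conditions\<close>

definition test_funs :: "(('d::finite) path \<Rightarrow> real ^ ('l::finite)) \<Rightarrow> ('d path \<Rightarrow> real) set" where
  "test_funs \<psi> = {(\<lambda>x. h (fst x) \<bullet> \<psi> x) | h. C1_bounded h}"

definition test_perp ::
  "real \<Rightarrow> (('d::finite) path \<Rightarrow> real ^ ('l::finite)) \<Rightarrow> 'd path measure set" where
  "test_perp p \<psi> = {m \<in> prob_moment p. \<forall>f\<in>test_funs \<psi>. (\<integral>x. f x \<partial>m) = 0}"

definition zero_set ::
  "real \<Rightarrow> (('d::finite) path measure \<Rightarrow> real ^ ('k::finite)) \<Rightarrow> 'd path measure set" where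
  "zero_set p \<phi> = {m \<in> prob_moment p. \<phi> m = 0}"

definition adapted :: "(('d::finite) path \<Rightarrow> 'd path) \<Rightarrow> bool" where
  "adapted T \<longleftrightarrow> (\<exists>t. \<forall>x. fst (T x) = t (fst x))"

primrec Lp_kind ::
  "metric_kind \<Rightarrow> real \<Rightarrow> ('d::finite) path measure \<Rightarrow> ('d path \<Rightarrow> 'd path) set" where
  "Lp_kind W p m = Lp p m"
| "Lp_kind W_ad p m = {T \<in> Lp p m. adapted T}"

text \<open>
  For an adapted map the first component is a function on \<open>S\<close>, and compactness of its support is
  understood there: the image under \<open>fst\<close> below is the set where that function is nonzero. This
  includes all adapted maps with compact support in \<open>S \<times> S\<close>, but those have vanishing first
  component.
\<close>

primrec compact_supp :: "metric_kind \<Rightarrow> (('d::finite) path \<Rightarrow> 'd path) \<Rightarrow> bool" where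
  "compact_supp W T \<longleftrightarrow> compact (closure {x. T x \<noteq> 0})"
| "compact_supp W_ad T \<longleftrightarrow>
     compact (closure (fst ` {x. fst (T x) \<noteq> 0})) \<and> compact (closure {x. snd (T x) \<noteq> 0})"

text \<open>In the next two definitions \<open>D\<close> stands for the function \<open>\<delta>\<^sub>m\<phi>(\<mu>, \<cdot>)\<close>.\<close>

definition cond_A_W ::
  "real \<Rightarrow> ('d::finite) path measure \<Rightarrow> ('d path \<Rightarrow> real ^ ('k::finite)) \<Rightarrow>
     ('d path \<Rightarrow> real ^ ('l::finite)) \<Rightarrow> bool" where
  "cond_A_W p \<mu> D \<psi> \<longleftrightarrow>
     (\<forall>x. \<psi> x = 0) \<and>
     (\<exists>c>0. mat_ge
        (\<integral>x. blk_mult_t (dx D x) (dx D x) /\<^sub>R (norm (dx D x) powr (2 - conj_exp p)) \<partial>\<mu>)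
        (mat c))"

text \<open>
  In the fourth condition the row \<open>\<partial>\<^sub>x\<^sup>a\<^sup>d \<delta>\<^sub>m(\<lambda> \<cdot> \<phi>)\<close> is written as the column
  \<open>(\<partial>\<^sub>x\<^sup>a\<^sup>d \<delta>\<^sub>m\<phi>)\<^sup>T \<lambda>\<close>, so that it can be added to \<open>(\<partial>\<^sub>x\<^sup>a\<^sup>d \<psi>)\<^sup>T h\<close>.
\<close>

definition cond_A_W_ad ::
  "real \<Rightarrow> ('d::finite) path measure \<Rightarrow> ('d path \<Rightarrow> real ^ ('k::finite)) \<Rightarrow>
     ('d path \<Rightarrow> real ^ ('l::finite)) \<Rightarrow> bool" where
  "cond_A_W_ad p \<mu> D \<psi> \<longleftrightarrow>
     (\<forall>K. compact K \<longrightarrow>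
        (\<exists>B. AE x in \<mu>. fst x \<in> K \<longrightarrow> \<bar>cond_ex \<mu> fst (\<lambda>y. norm (snd y)) x\<bar> \<le> B)) \<and>
     C2_bounded_derivs \<psi> \<and> (AE x in \<mu>. cond_ex \<mu> fst \<psi> x = 0) \<and>
     (\<exists>c>0. AE x in \<mu>.
        mat_ge (cond_ex \<mu> fst (\<lambda>y. dx2 \<psi> y ** transpose (dx2 \<psi> y)) x) (mat c)) \<and>
     (\<exists>c>0. \<forall>lam. \<forall>h\<in>Lp (conj_exp p) (distr \<mu> borel fst).
        Lp_norm (conj_exp p) \<mu>
          (\<lambda>x. blk_tapp (dx_ad \<mu> D x) lam + blk_tapp (dx_ad \<mu> \<psi> x) (h (fst x)))
        \<ge> c * (norm lam + Lp_norm (conj_exp p) \<mu> (\<lambda>x. h (fst x)))) \<and>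
     invertible (\<integral>x.
        blk_mult_t (dx_ad \<mu> D x) (Nrm_ad p (dx_ad \<mu> D x))
        - (dx2 D x ** transpose (dx2 \<psi> x))
          ** matrix_inv (cond_ex \<mu> fst (\<lambda>y. dx2 \<psi> y ** transpose (dx2 \<psi> y)) x)
          ** cond_ex \<mu> fst (\<lambda>y. blk_mult_t (dx \<psi> y) (Nrm_ad p (dx_ad \<mu> D y))) x \<partial>\<mu>)"

primrec cond_A ::
  "metric_kind \<Rightarrow> real \<Rightarrow> ('d::finite) path measure \<Rightarrow> ('d path \<Rightarrow> real ^ ('k::finite)) \<Rightarrow>
     ('d path \<Rightarrow> real ^ ('l::finite)) \<Rightarrow> bool" where
  "cond_A W = cond_A_W"
| "cond_A W_ad = cond_A_W_ad"

end

theory Submission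
  imports Defs
begin

text \<open>
  The law of \<open>X + r\<Theta>(X)\<close> is corrected to the law of \<open>X + T(X)\<close>, \<open>T = r\<Theta> + \<Sum>\<^sub>i a\<^sub>i \<eta>\<^sub>i\<close>, where the bounded fields
  \<open>\<eta>\<^sub>i\<close> are chosen so that \<open>a \<mapsto> \<Sum>\<^sub>i a\<^sub>i E[(\<partial>\<^sub>x\<delta>\<^sub>m\<phi>) \<eta>\<^sub>i]\<close> is the identity. A mean value argument along
  \<open>\<mu> + t(\<mu>' - \<mu>)\<close> gives \<open>\<phi>(law(X + T)) = E[(\<partial>\<^sub>x\<delta>\<^sub>m\<phi>) T] + o(\<parallel>T\<parallel>\<^sub>\<infinity>)\<close>, so Brouwer's theorem produces a
  zero \<open>a\<close> of size at most \<open>r\<close> times the right-hand side, up to \<open>o(r)\<close>.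

  In the adapted case \<open>T\<close> also contains \<open>(0, (\<partial>\<^sub>2\<psi>)\<^sup>T h(X\<^sub>1))\<close>, with \<open>h\<close> solving \<open>E[\<psi>(X + T) | X\<^sub>1] = 0\<close> by a
  contraction that is uniform in \<open>X\<^sub>1\<close>: \<open>\<psi>\<close> has bounded second derivatives and the Gram matrix
  \<open>E[\<partial>\<^sub>2\<psi> (\<partial>\<^sub>2\<psi>)\<^sup>T | X\<^sub>1]\<close> is coercive. The \<open>\<eta>\<^sub>i\<close> exist because condition (iv) says, dually, that no
  covector annihilates all first-order responses. The first components of \<open>r\<Theta>\<close> and \<open>T\<close> are Lipschitz
  with small constants, so \<open>X\<^sub>1\<close> can be recovered from either transported first coordinate and the
  obvious coupling is bicausal.
\<close>

section \<open>Mixtures of laws and transport costs\<close>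

text \<open>A sup bound on the displacement does double duty: it keeps the intermediate mixtures
  near \<mu> and makes the remainder of the expansion dominated, uniformly over all fields of that
  size. Corrections are therefore built from bounded fields. As a function of a, the value of \<phi>
  is only shown to be continuous and close to affine, hence a topological fixed point instead of an
  implicit function theorem. In the adapted case the constraint is infinite dimensional and must
  hold exactly, so it is eliminated for each (r, a) before Brouwer's theorem is applied to the
  finitely many coordinates of a. The unknown h is merely measurable in X_1; placed in the second
  component, it leaves the first component of T an explicit Lipschitz function of x_1. Restoring the
  constraint also changes \<phi> to first order: the relevant linear map is
  E[(\<partial>\<delta>\<phi>) U] minus the effect of h, and v is its value at \<Theta>. The
  conditional term on the right-hand side of the theorem pays for this effect and for the mass moved
  by h.\<close>

lemma space_UNIV_of_sets_borel: "sets m = sets borel \<Longrightarrow> space m = UNIV"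
  using sets_eq_imp_space_eq[of m borel] by simp

lemma sets_mix [simp, measurable_cong]:
  fixes m :: "'a::topological_space measure"
  shows "sets (mix t m m') = sets borel"
  unfolding mix_def using sets.sigma_sets_eq[of "borel :: 'a measure"]
  by (subst sets_measure_of) auto

text \<open>\<open>measure_of\<close> falls back to the zero measure unless the set function is
  countably additive, so additivity has to be checked before \<open>mix\<close> can be evaluated on
  a set.\<close>

lemma emeasure_mix:
  assumes m: "sets m = sets borel" and m': "sets m' = sets borel" and A: "A \<in> sets borel"
  shows "emeasure (mix t m m') A = ennreal (1 - t) * emeasure m A + ennreal t * emeasure m' A"
proof -
  have sb: "sigma_algebra UNIV (sets borel)"
    using sets.sigma_algebra_axioms[of borel] by simp
  have "countably_additive (sets borel)
      (\<lambda>A. ennreal (1 - t) * emeasure m A + ennreal t * emeasure m' A)"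
    unfolding countably_additive_def
  proof (intro allI impI)
    fix A :: "nat \<Rightarrow> 'a set"
    assume A: "range A \<subseteq> sets borel" "disjoint_family A"
    have "(\<Sum>i. ennreal (1 - t) * emeasure m (A i) + ennreal t * emeasure m' (A i))
        = (\<Sum>i. ennreal (1 - t) * emeasure m (A i)) + (\<Sum>i. ennreal t * emeasure m' (A i))"
      by (rule suminf_add[symmetric]) auto
    also have "\<dots> = ennreal (1 - t) * (\<Sum>i. emeasure m (A i)) + ennreal t * (\<Sum>i. emeasure m' (A i))"
      by simp
    also have "\<dots> = ennreal (1 - t) * emeasure m (\<Union>(range A)) + ennreal t * emeasure m' (\<Union>(range A))"
      using A m m' by (simp add: suminf_emeasure)
    finally show "(\<Sum>i. ennreal (1 - t) * emeasure m (A i) + ennreal t * emeasure m' (A i))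
        = ennreal (1 - t) * emeasure m (\<Union>(range A)) + ennreal t * emeasure m' (\<Union>(range A))" .
  qed
  then show ?thesis
    unfolding mix_def
    by (intro emeasure_measure_of_sigma sb A) (auto simp: positive_def)
qed

lemma mix_commute: "mix t m m' = mix (1 - t) m' m"
  unfolding mix_def by (simp add: add.commute)

lemma mix_0: "sets m = sets borel \<Longrightarrow> sets m' = sets borel \<Longrightarrow> mix 0 m m' = m"
  by (intro measure_eqI) (auto simp: emeasure_mix)

lemma mix_1: "sets m = sets borel \<Longrightarrow> sets m' = sets borel \<Longrightarrow> mix 1 m m' = m'"
  by (intro measure_eqI) (auto simp: emeasure_mix)

text \<open>The defining limit of a functional derivative starts at a measure and moves toward
  another one. Started inside a segment and aimed at an endpoint, it stays on the segment; this and
  the mirror image below yield both one-sided derivatives along the segment.\<close>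

lemma mix_mix_right:
  assumes "sets m = sets borel" "sets m' = sets borel" "0 \<le> s" "s \<le> 1" "0 \<le> t" "t \<le> 1"
  shows "mix s (mix t m m') m' = mix (t + s * (1 - t)) m m'"
proof (rule measure_eqI)
  fix A assume "A \<in> sets (mix s (mix t m m') m')"
  then have A: "A \<in> sets borel" by simp
  have e1: "ennreal (1 - (t + s * (1 - t))) = ennreal (1 - s) * ennreal (1 - t)"
    using assms by (simp add: ennreal_mult[symmetric] algebra_simps)
  have "t + s * (1 - t) = (1 - s) * t + s" by (simp add: algebra_simps)
  then have e2: "ennreal (t + s * (1 - t)) = ennreal (1 - s) * ennreal t + ennreal s"
    using assms by (simp add: ennreal_mult[symmetric] ennreal_plus[symmetric] del: ennreal_plus)
  show "emeasure (mix s (mix t m m') m') A = emeasure (mix (t + s * (1 - t)) m m') A"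
    using assms(1,2) A
    by (simp only: emeasure_mix sets_mix e1 e2 distrib_left distrib_right ac_simps)
qed simp

lemma mix_mix_left:
  assumes "sets m = sets borel" "sets m' = sets borel" "0 \<le> s" "s \<le> 1" "0 \<le> t" "t \<le> 1"
  shows "mix s (mix t m m') m = mix (t - s * t) m m'"
proof -
  have "mix s (mix t m m') m = mix s (mix (1 - t) m' m) m"
    by (simp add: mix_commute[of t m m'])
  also have "\<dots> = mix ((1 - t) + s * (1 - (1 - t))) m' m"
    using assms by (intro mix_mix_right) auto
  also have "\<dots> = mix (t - s * t) m m'"
    by (subst mix_commute) simp
  finally show ?thesis .
qed

lemma nn_integral_mix:
  assumes m: "sets m = sets borel" and m': "sets m' = sets borel"
    and f: "f \<in> borel_measurable borel"
  shows "(\<integral>\<^sup>+x. f x \<partial>mix t m m') = ennreal (1 - t) * (\<integral>\<^sup>+x. f x \<partial>m) + ennreal t * (\<integral>\<^sup>+x. f x \<partial>m')"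
  using f
proof (induct f rule: borel_measurable_induct)
  case (cong f g)
  then show ?case
    using space_UNIV_of_sets_borel[OF m] space_UNIV_of_sets_borel[OF m'] by (simp cong: nn_integral_cong_simp)
next
  case (set A)
  then show ?case by (simp add: m m' emeasure_mix)
next
  case (mult u c)
  have u: "u \<in> borel_measurable m" "u \<in> borel_measurable m'" "u \<in> borel_measurable (mix t m m')"
    using mult m m' by (simp_all cong: measurable_cong_sets)
  show ?case using mult u by (simp add: nn_integral_cmult algebra_simps)
next
  case (add u v)
  have u: "u \<in> borel_measurable m" "u \<in> borel_measurable m'" "u \<in> borel_measurable (mix t m m')"
    "v \<in> borel_measurable m" "v \<in> borel_measurable m'" "v \<in> borel_measurable (mix t m m')"
    using add m m' by (simp_all cong: measurable_cong_sets)
  show ?case using add u by (simp add: nn_integral_add algebra_simps)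
next
  case (seq U)
  have u: "U i \<in> borel_measurable m" "U i \<in> borel_measurable m'" "U i \<in> borel_measurable (mix t m m')" for i
    using seq m m' by (simp_all cong: measurable_cong_sets)
  have inc: "incseq (\<lambda>i. \<integral>\<^sup>+x. U i x \<partial>M)" for M
    using \<open>incseq U\<close> by (auto simp: incseq_def le_fun_def intro!: nn_integral_mono)
  have S: "(\<integral>\<^sup>+x. (SUP i. U i) x \<partial>M) = (SUP i. \<integral>\<^sup>+x. U i x \<partial>M)"
    if "\<And>i. U i \<in> borel_measurable M" for M
    using nn_integral_monotone_convergence_SUP[OF \<open>incseq U\<close>, of M] that by (simp add: image_comp)
  have "(SUP i. ennreal (1 - t) * (\<integral>\<^sup>+x. U i x \<partial>m) + ennreal t * (\<integral>\<^sup>+x. U i x \<partial>m'))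
      = (SUP i. ennreal (1 - t) * (\<integral>\<^sup>+x. U i x \<partial>m)) + (SUP i. ennreal t * (\<integral>\<^sup>+x. U i x \<partial>m'))"
    using inc[of m] inc[of m'] by (intro ennreal_SUP_add) (auto simp: incseq_def intro!: mult_left_mono)
  then show ?case
    unfolding S[OF u(1)] S[OF u(2)] S[OF u(3)] by (simp add: seq SUP_mult_left_ennreal)
qed

lemma integrable_mix:
  fixes f :: "'a::topological_space \<Rightarrow> 'b::euclidean_space"
  assumes m: "sets m = sets borel" and m': "sets m' = sets borel"
    and f: "integrable m f" "integrable m' f"
  shows "integrable (mix t m m') f"
proof (rule integrableI_bounded)
  have fb: "f \<in> borel_measurable borel"
    using borel_measurable_integrable[OF f(1)] m by (simp cong: measurable_cong_sets)
  then show "f \<in> borel_measurable (mix t m m')" by (simp cong: measurable_cong_sets)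
  have "(\<integral>\<^sup>+x. ennreal (norm (f x)) \<partial>m) < \<infinity>" "(\<integral>\<^sup>+x. ennreal (norm (f x)) \<partial>m') < \<infinity>"
    using f by (auto simp: integrable_iff_bounded)
  then show "(\<integral>\<^sup>+x. ennreal (norm (f x)) \<partial>mix t m m') < \<infinity>"
    using fb by (subst nn_integral_mix[OF m m']) (auto simp: ennreal_mult_less_top)
qed

lemma integral_mix_real:
  fixes f :: "'a::topological_space \<Rightarrow> real"
  assumes m: "sets m = sets borel" and m': "sets m' = sets borel"
    and f: "integrable m f" "integrable m' f" and t: "0 \<le> t" "t \<le> 1"
  shows "(\<integral>x. f x \<partial>mix t m m') = (1 - t) * (\<integral>x. f x \<partial>m) + t * (\<integral>x. f x \<partial>m')"
proof -
  have fb: "f \<in> borel_measurable borel"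
    using borel_measurable_integrable[OF f(1)] m by (simp cong: measurable_cong_sets)
  have fin: "(\<integral>\<^sup>+x. ennreal (g x) \<partial>M) < \<infinity>"
    if "integrable M f" "\<And>x. g x \<le> norm (f x)" for g and M :: "'a measure"
  proof -
    have "(\<integral>\<^sup>+x. ennreal (g x) \<partial>M) \<le> (\<integral>\<^sup>+x. ennreal (norm (f x)) \<partial>M)"
      using that by (intro nn_integral_mono ennreal_leI) auto
    then show ?thesis using that by (auto simp: integrable_iff_bounded less_le_trans le_less_trans)
  qed
  have e: "enn2real (ennreal (1 - t) * a + ennreal t * b) = (1 - t) * enn2real a + t * enn2real b"
    if "a < \<infinity>" "b < \<infinity>" for a b
    using that t by (subst enn2real_plus) (auto simp: ennreal_mult_less_top enn2real_mult)
  have fs: "(\<integral>\<^sup>+x. ennreal (f x) \<partial>m) < \<infinity>" "(\<integral>\<^sup>+x. ennreal (f x) \<partial>m') < \<infinity>"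
     "(\<integral>\<^sup>+x. ennreal (- f x) \<partial>m) < \<infinity>" "(\<integral>\<^sup>+x. ennreal (- f x) \<partial>m') < \<infinity>"
    by (rule fin; use f in force)+
  show ?thesis
    using fb f integrable_mix[OF m m' f, of t] fs
    by (simp add: real_lebesgue_integral_def nn_integral_mix[OF m m'] e)
      (simp add: algebra_simps)
qed

lemma integral_mix:
  fixes f :: "'a::topological_space \<Rightarrow> 'b::euclidean_space"
  assumes m: "sets m = sets borel" and m': "sets m' = sets borel"
    and f: "integrable m f" "integrable m' f" and t: "0 \<le> t" "t \<le> 1"
  shows "(\<integral>x. f x \<partial>mix t m m') = (1 - t) *\<^sub>R (\<integral>x. f x \<partial>m) + t *\<^sub>R (\<integral>x. f x \<partial>m')"
proof (rule euclidean_eqI)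
  fix b :: 'b assume "b \<in> Basis"
  have "(\<integral>x. f x \<partial>mix t m m') \<bullet> b = (\<integral>x. f x \<bullet> b \<partial>mix t m m')"
    using integrable_mix[OF m m' f, of t] by simp
  also have "\<dots> = (1 - t) * (\<integral>x. f x \<bullet> b \<partial>m) + t * (\<integral>x. f x \<bullet> b \<partial>m')"
    using f by (intro integral_mix_real m m' t) auto
  also have "\<dots> = ((1 - t) *\<^sub>R (\<integral>x. f x \<partial>m) + t *\<^sub>R (\<integral>x. f x \<partial>m')) \<bullet> b"
    using f by (simp add: inner_add_left)
  finally show "(\<integral>x. f x \<partial>mix t m m') \<bullet> b = ((1 - t) *\<^sub>R (\<integral>x. f x \<partial>m) + t *\<^sub>R (\<integral>x. f x \<partial>m')) \<bullet> b" .
qed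

lemma prob_space_mix:
  assumes "prob_space m" "prob_space m'" "sets m = sets borel" "sets m' = sets borel"
    "0 \<le> t" "t \<le> 1"
  shows "prob_space (mix t m m')"
proof
  have "emeasure m UNIV = 1" "emeasure m' UNIV = 1"
    using assms prob_space.emeasure_space_1[of m] prob_space.emeasure_space_1[of m']
    by (auto simp: space_UNIV_of_sets_borel)
  then show "emeasure (mix t m m') (space (mix t m m')) = 1"
    using assms by (simp add: space_UNIV_of_sets_borel emeasure_mix ennreal_plus[symmetric] del: ennreal_plus)
qed

lemma mix_in_prob_moment:
  assumes "m \<in> prob_moment p" "m' \<in> prob_moment p" "0 \<le> t" "t \<le> 1"
  shows "mix t m m' \<in> prob_moment p"
  using assms by (auto simp: prob_moment_def intro!: prob_space_mix integrable_mix)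

lemma distr_mix:
  fixes f :: "'a::topological_space \<Rightarrow> 'b::topological_space"
  assumes m: "sets m = sets borel" and m': "sets m' = sets borel" and f: "f \<in> borel_measurable borel"
  shows "distr (mix t m m') borel f = mix t (distr m borel f) (distr m' borel f)"
proof (rule measure_eqI)
  fix A assume "A \<in> sets (distr (mix t m m') borel f)"
  then have A: "A \<in> sets borel" by simp
  then have "f -` A \<in> sets borel" using f by (metis measurable_sets_borel)
  moreover have "f \<in> borel_measurable m" "f \<in> borel_measurable m'" "f \<in> borel_measurable (mix t m m')"
    using f m m' by (simp_all cong: measurable_cong_sets)
  ultimately show "emeasure (distr (mix t m m') borel f) A
      = emeasure (mix t (distr m borel f) (distr m' borel f)) A"
    using A m m' by (simp add: emeasure_distr emeasure_mix space_UNIV_of_sets_borel)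
qed simp

section \<open>Explicit couplings and their costs\<close>

lemma transport_cost_nonneg: "0 \<le> transport_cost p \<pi>"
  by (simp add: transport_cost_def)

lemma wasserstein_le: "\<pi> \<in> couplings m m' \<Longrightarrow> wasserstein p m m' \<le> transport_cost p \<pi>"
  unfolding wasserstein_def
  by (rule cINF_lower) (auto intro!: bdd_belowI[of _ 0] transport_cost_nonneg)

lemma ad_wasserstein_le:
  "\<pi> \<in> bicausal_couplings m m' \<Longrightarrow> ad_wasserstein p m m' \<le> transport_cost p \<pi>"
  unfolding ad_wasserstein_def
  by (rule cINF_lower) (auto intro!: bdd_belowI[of _ 0] transport_cost_nonneg)

text \<open>Compare the sum with twice the maximum. The crude factor covers every exponent q \<ge>
  0; below it is used at p and also at 1/p < 1, where convexity would not help.\<close>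

lemma powr_add_le:
  fixes a b q :: real
  assumes "0 \<le> a" "0 \<le> b" "0 \<le> q"
  shows "(a + b) powr q \<le> 2 powr q * (a powr q + b powr q)"
proof -
  have "(a + b) powr q \<le> (2 * max a b) powr q"
    using assms by (intro powr_mono2) auto
  also have "\<dots> = 2 powr q * max a b powr q"
    using assms by (simp add: powr_mult)
  also have "\<dots> \<le> 2 powr q * (a powr q + b powr q)"
    by (intro mult_left_mono) (auto simp: max_def)
  finally show ?thesis .
qed

lemma integrable_powr_add:
  fixes U Y :: "'a \<Rightarrow> 'b::euclidean_space"
  assumes [measurable]: "U \<in> borel_measurable P" "Y \<in> borel_measurable P"
    and "integrable P (\<lambda>\<omega>. norm (U \<omega>) powr q)" "integrable P (\<lambda>\<omega>. norm (Y \<omega>) powr q)" "0 \<le> q"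
  shows "integrable P (\<lambda>\<omega>. norm (U \<omega> + Y \<omega>) powr q)"
proof (rule Bochner_Integration.integrable_bound)
  show "integrable P (\<lambda>\<omega>. 2 powr q * (norm (U \<omega>) powr q + norm (Y \<omega>) powr q))"
    using assms by auto
  have "norm (U \<omega> + Y \<omega>) powr q \<le> 2 powr q * (norm (U \<omega>) powr q + norm (Y \<omega>) powr q)" for \<omega>
    using powr_mono2[OF \<open>0 \<le> q\<close> norm_ge_zero norm_triangle_ineq, of "U \<omega>" "Y \<omega>"]
      powr_add_le[of "norm (U \<omega>)" "norm (Y \<omega>)" q] \<open>0 \<le> q\<close> by simp
  then show "AE \<omega> in P. norm (norm (U \<omega> + Y \<omega>) powr q)
      \<le> norm (2 powr q * (norm (U \<omega>) powr q + norm (Y \<omega>) powr q))"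
    by auto
qed auto

lemma (in finite_measure) integrable_powr_of_AE_bound:
  fixes Y :: "'a \<Rightarrow> 'b::euclidean_space"
  assumes [measurable]: "Y \<in> borel_measurable M" and "AE \<omega> in M. norm (Y \<omega>) \<le> b" "0 \<le> q"
  shows "integrable M (\<lambda>\<omega>. norm (Y \<omega>) powr q)"
  by (rule integrable_const_bound[of _ "b powr q"])
    (use assms(2) \<open>0 \<le> q\<close> in \<open>auto intro!: powr_mono2 elim: eventually_mono\<close>)

lemma distr_in_prob_moment:
  fixes U :: "'a \<Rightarrow> 'b::euclidean_space"
  assumes "prob_space P" and [measurable]: "U \<in> borel_measurable P"
    and "integrable P (\<lambda>\<omega>. norm (U \<omega>) powr p)"
  shows "distr P borel U \<in> prob_moment p"
  using assms by (auto simp: prob_moment_def integrable_distr_eq intro!: prob_space.prob_space_distr)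

lemma measurable_fst_borel [measurable]:
  "fst \<in> borel_measurable (borel :: ('a::second_countable_topology \<times> 'b::second_countable_topology) measure)"
  by (intro borel_measurable_continuous_onI continuous_intros)

lemma measurable_snd_borel [measurable]:
  "snd \<in> borel_measurable (borel :: ('a::second_countable_topology \<times> 'b::second_countable_topology) measure)"
  by (intro borel_measurable_continuous_onI continuous_intros)

lemma transport_cost_distr_le:
  fixes U V :: "'a \<Rightarrow> 'b::euclidean_space"
  assumes "prob_space P" and [measurable]: "U \<in> borel_measurable P" "V \<in> borel_measurable P"
    and b: "AE \<omega> in P. norm (U \<omega> - V \<omega>) \<le> b" "0 \<le> b" "p > 0"
  shows "transport_cost p (distr P borel (\<lambda>\<omega>. (U \<omega>, V \<omega>))) \<le> b"
proof -
  interpret prob_space P by fact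
  have "(\<integral>z. norm (fst z - snd z) powr p \<partial>distr P borel (\<lambda>\<omega>. (U \<omega>, V \<omega>)))
      = (\<integral>\<omega>. norm (U \<omega> - V \<omega>) powr p \<partial>P)"
    by (subst integral_distr) auto
  also have "\<dots> \<le> (\<integral>\<omega>. b powr p \<partial>P)"
    using b by (intro integral_mono_AE integrable_powr_of_AE_bound[where b=b])
      (auto intro!: powr_mono2 elim: eventually_mono)
  also have "\<dots> = b powr p" by (simp add: prob_space)
  finally have "transport_cost p (distr P borel (\<lambda>\<omega>. (U \<omega>, V \<omega>))) \<le> (b powr p) powr (1 / p)"
    unfolding transport_cost_def using \<open>p > 0\<close> by (intro powr_mono2) auto
  then show ?thesis using b by (simp add: powr_powr)
qed

lemma coupling_distr:
  fixes U V :: "'a \<Rightarrow> 'b::euclidean_space"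
  assumes [measurable]: "U \<in> borel_measurable P" "V \<in> borel_measurable P"
  shows "distr P borel (\<lambda>\<omega>. (U \<omega>, V \<omega>)) \<in> couplings (distr P borel U) (distr P borel V)"
  by (auto simp: couplings_def distr_distr comp_def)

text \<open>Leave a fraction 1 - t of the mass in place and displace the rest by Y: the mixture of
  the diagonal coupling with the displacement coupling. This keeps all intermediate measures of the
  mean value argument close to the law of U, where the local continuity and growth bounds
  apply.\<close>

lemma wasserstein_mix_le:
  fixes U Y :: "'a \<Rightarrow> 'd::finite path"
  assumes "prob_space P" and [measurable]: "U \<in> borel_measurable P" "Y \<in> borel_measurable P"
    and b: "AE \<omega> in P. norm (Y \<omega>) \<le> b" "0 \<le> b" and p: "p > 0" and t: "0 \<le> t" "t \<le> 1"
  shows "wasserstein p (distr P borel U)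
    (mix t (distr P borel U) (distr P borel (\<lambda>\<omega>. U \<omega> + Y \<omega>))) \<le> b"
proof -
  interpret prob_space P by fact
  define \<pi>0 where "\<pi>0 = distr P borel (\<lambda>\<omega>. (U \<omega>, U \<omega>))"
  define \<pi>1 where "\<pi>1 = distr P borel (\<lambda>\<omega>. (U \<omega>, U \<omega> + Y \<omega>))"
  define \<pi> where "\<pi> = mix t \<pi>0 \<pi>1"
  have s: "sets \<pi>0 = sets borel" "sets \<pi>1 = sets borel" by (simp_all add: \<pi>0_def \<pi>1_def)
  have c: "fst \<in> borel_measurable (borel :: ('d path \<times> 'd path) measure)"
      "snd \<in> borel_measurable (borel :: ('d path \<times> 'd path) measure)"
    by measurable
  \<comment> \<open>The first marginal of the mixed coupling comes out as a mixture of the law of U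
    with itself.\<close>
  have mm: "mix t m m = m" if "sets m = sets borel" for m :: "'d path measure"
  proof (rule measure_eqI)
    fix A assume "A \<in> sets (mix t m m)"
    then have "emeasure (mix t m m) A = (ennreal (1 - t) + ennreal t) * emeasure m A"
      using that by (simp add: emeasure_mix algebra_simps)
    also have "ennreal (1 - t) + ennreal t = 1"
      using t by (simp add: ennreal_plus[symmetric] del: ennreal_plus)
    finally show "emeasure (mix t m m) A = emeasure m A" by simp
  qed (simp add: that)
  have "\<pi>0 \<in> couplings (distr P borel U) (distr P borel U)"
    unfolding \<pi>0_def by (rule coupling_distr) auto
  moreover have "\<pi>1 \<in> couplings (distr P borel U) (distr P borel (\<lambda>\<omega>. U \<omega> + Y \<omega>))"
    unfolding \<pi>1_def by (rule coupling_distr) auto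
  ultimately have "\<pi> \<in> couplings (distr P borel U) (mix t (distr P borel U) (distr P borel (\<lambda>\<omega>. U \<omega> + Y \<omega>)))"
    unfolding couplings_def \<pi>_def by (auto simp: distr_mix[OF s c(1)] distr_mix[OF s c(2)] mm)
  moreover have "transport_cost p \<pi> \<le> b"
  proof -
    have i0: "integrable \<pi>0 (\<lambda>z. norm (fst z - snd z) powr p)"
      unfolding \<pi>0_def by (subst integrable_distr_eq) auto
    have i1: "integrable \<pi>1 (\<lambda>z. norm (fst z - snd z) powr p)"
      unfolding \<pi>1_def using b p
      by (subst integrable_distr_eq)
        (auto intro!: integrable_powr_of_AE_bound[where b=b])
    have z0: "(\<integral>z. norm (fst z - snd z) powr p \<partial>\<pi>0) = 0"
      unfolding \<pi>0_def by (subst integral_distr) auto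
    have "(\<integral>z. norm (fst z - snd z) powr p \<partial>\<pi>) = t * (\<integral>z. norm (fst z - snd z) powr p \<partial>\<pi>1)"
      unfolding \<pi>_def using z0 by (subst integral_mix_real[OF s i0 i1 t]) simp
    also have "\<dots> \<le> 1 * (\<integral>z. norm (fst z - snd z) powr p \<partial>\<pi>1)"
      using t by (intro mult_right_mono) auto
    finally have "transport_cost p \<pi> \<le> transport_cost p \<pi>1"
      unfolding transport_cost_def \<pi>_def using p by (intro powr_mono2) auto
    also have "\<dots> \<le> b"
      unfolding \<pi>1_def using b p \<open>prob_space P\<close> by (intro transport_cost_distr_le) auto
    finally show ?thesis .
  qed
  ultimately show ?thesis using wasserstein_le order_trans by blast
qed

text \<open>The case Y = 0. Neighbourhoods in \<open>jointly_continuous\<close> and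
  \<open>poly_growth\<close> are described by the distance, so their bounds reach the centre itself
  only once its self-distance is known to be small.\<close>

lemma wasserstein_self:
  assumes "prob_space m" "sets m = sets borel" "p > 0"
  shows "wasserstein p m m \<le> 0"
proof -
  have id: "(\<lambda>x. x) \<in> borel_measurable m" using assms(2) by (simp cong: measurable_cong_sets)
  have "wasserstein p (distr m borel (\<lambda>x. x)) (mix 0 (distr m borel (\<lambda>x. x)) (distr m borel (\<lambda>x. x + 0))) \<le> 0"
    by (rule wasserstein_mix_le) (use assms id in auto)
  moreover have "distr m borel (\<lambda>x. x) = m" using assms by (intro measure_eqI) (auto simp: emeasure_distr id space_UNIV_of_sets_borel)
  ultimately show ?thesis using assms by (simp add: mix_0)
qed

section \<open>First-order expansion along transported laws\<close>

lemma bounded_bilinear_blk_app: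
  "bounded_bilinear (blk_app :: ('d::finite, 'k::finite) blocks \<Rightarrow> 'd path \<Rightarrow> real ^ 'k)"
proof -
  have "bilinear (blk_app :: ('d, 'k) blocks \<Rightarrow> 'd path \<Rightarrow> real ^ 'k)"
    unfolding bilinear_def
  proof (intro conjI allI linearI)
    fix A B :: "('d, 'k) blocks" and v w :: "'d path" and c :: real
    show "blk_app A (v + w) = blk_app A v + blk_app A w" "blk_app (A + B) v = blk_app A v + blk_app B v"
      by (simp_all add: blk_app_def matrix_vector_mult_add_rdistrib matrix_vector_right_distrib)
    show "blk_app A (c *\<^sub>R v) = c *\<^sub>R blk_app A v"
      by (simp add: blk_app_def matrix_vector_mult_scaleR scaleR_add_right)
    show "blk_app (c *\<^sub>R A) v = c *\<^sub>R blk_app A v"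
      by (simp add: blk_app_def scaleR_matrix_vector_assoc[symmetric] scaleR_add_right)
  qed
  then show ?thesis by (simp add: bilinear_conv_bounded_bilinear)
qed

interpretation blk_app: bounded_bilinear blk_app
  by (rule bounded_bilinear_blk_app)

text \<open>A total derivative is given, so splitting a direction as (v_1, 0) + (0, v_2) identifies
  it with the two partial Jacobians.\<close>

lemma has_derivative_blk_app:
  fixes u :: "'d::finite path \<Rightarrow> real ^ 'k::finite"
  assumes "(u has_derivative u') (at x)"
  shows "u' v = blk_app (dx u x) v"
proof -
  interpret u': bounded_linear u' using assms by (rule has_derivative_bounded_linear)
  have "((\<lambda>y. (y, snd x)) has_derivative (\<lambda>h. (h, 0))) (at (fst x))"
    "((\<lambda>y. (fst x, y)) has_derivative (\<lambda>h. (0, h))) (at (snd x))"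
    by (intro has_derivative_Pair has_derivative_ident has_derivative_const)+
  then have 1: "((\<lambda>y. u (y, snd x)) has_derivative (\<lambda>h. u' (h, 0))) (at (fst x))"
    and 2: "((\<lambda>y. u (fst x, y)) has_derivative (\<lambda>h. u' (0, h))) (at (snd x))"
    using assms by (auto dest: has_derivative_compose[where g=u and g'=u'])
  have l: "linear (\<lambda>h. u' (h, 0))" "linear (\<lambda>h. u' (0, h))"
    using 1 2 by (auto dest: has_derivative_linear)
  have "dx1 u x *v fst v = u' (fst v, 0)" "dx2 u x *v snd v = u' (0, snd v)"
    unfolding dx1_def dx2_def jacobian_def frechet_derivative_at[OF 1, symmetric]
      frechet_derivative_at[OF 2, symmetric] using l by (simp_all add: matrix_works)
  moreover have "u' v = u' (fst v, 0) + u' (0, snd v)"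
    by (simp add: u'.add[symmetric])
  ultimately show ?thesis by (simp add: blk_app_def dx_def)
qed

lemma C1_has_derivative:
  fixes u :: "'d::finite path \<Rightarrow> real ^ 'k::finite"
  assumes "C1 u"
  shows "(u has_derivative blk_app (dx u x)) (at x)"
proof -
  obtain u' :: "'d path \<Rightarrow> 'd path \<Rightarrow>\<^sub>L (real ^ 'k)" where "(u has_derivative blinfun_apply (u' x)) (at x)"
    using assms unfolding C1_def by blast
  moreover from has_derivative_blk_app[OF this] have "blinfun_apply (u' x) = blk_app (dx u x)" by auto
  ultimately show ?thesis by simp
qed

text \<open>Mean value inequality along the segment from x to x + y after subtracting s A y. The
  block A is arbitrary because it will be the derivative taken at a different measure and a
  different point.\<close>

lemma C1_mvt:
  fixes u :: "'d::finite path \<Rightarrow> real ^ 'k::finite"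
  assumes "C1 u"
  shows "\<exists>s\<in>{0..1}. norm (u (x + y) - u x - blk_app A y) \<le> norm (blk_app (dx u (x + s *\<^sub>R y) - A) y)"
proof -
  define f where "f = (\<lambda>s. u (x + s *\<^sub>R y) - s *\<^sub>R blk_app A y)"
  have d: "(f has_derivative (\<lambda>h. h *\<^sub>R blk_app (dx u (x + s *\<^sub>R y) - A) y)) (at s)" for s
  proof -
    have "((\<lambda>s. u (x + s *\<^sub>R y)) has_derivative (\<lambda>h. blk_app (dx u (x + s *\<^sub>R y)) (h *\<^sub>R y))) (at s)"
      by (rule has_derivative_compose[of "\<lambda>s. x + s *\<^sub>R y" "\<lambda>h. h *\<^sub>R y" s UNIV u])
        (auto intro!: derivative_eq_intros C1_has_derivative assms)
    then show ?thesis unfolding f_def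
      by (auto intro!: derivative_eq_intros simp: blk_app.scaleR_right blk_app.diff_left scaleR_diff_right)
  qed
  have "\<exists>s\<in>{0<..<1}. norm (f 1 - f 0) \<le> norm ((1 - 0) *\<^sub>R blk_app (dx u (x + s *\<^sub>R y) - A) y)"
    by (rule mvt_general) (auto intro!: d continuous_at_imp_continuous_on has_derivative_continuous[OF d])
  then show ?thesis by (auto simp: f_def algebra_simps intro!: bexI)
qed

text \<open>Mixing weights only tend to zero from above, so each direction along a segment of laws
  contributes one one-sided quotient; matching limits make them an ordinary derivative.\<close>

lemma has_derivative_of_one_sided:
  fixes F :: "real \<Rightarrow> 'b::real_normed_vector"
  assumes r: "((\<lambda>s. (F (t + s) - F t) /\<^sub>R s) \<longlongrightarrow> G) (at_right 0)"
    and l: "((\<lambda>s. (F (t - s) - F t) /\<^sub>R s) \<longlongrightarrow> - G) (at_right 0)"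
  shows "(F has_derivative (\<lambda>h. h *\<^sub>R G)) (at t)"
proof -
  have "((\<lambda>s. (F (t + s) - F t) /\<^sub>R s - G) \<longlongrightarrow> 0) (at_right 0)"
    using tendsto_diff[OF r tendsto_const[of G]] by simp
  then have "((\<lambda>s. (1 / norm s) *\<^sub>R (F (s + t) - (F t + s *\<^sub>R G))) \<longlongrightarrow> 0) (at_right 0)"
    by (rule Lim_transform_eventually)
      (auto simp: eventually_at_right_field intro!: exI[of _ 1] simp: divide_inverse algebra_simps)
  then have R: "((\<lambda>y. (1 / norm (y - t)) *\<^sub>R (F y - (F t + (y - t) *\<^sub>R G))) \<longlongrightarrow> 0) (at_right t)"
    by (subst filterlim_at_right_to_0) simp
  have "((\<lambda>s. (F (t - s) - F t) /\<^sub>R s + G) \<longlongrightarrow> 0) (at_right 0)"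
    using tendsto_add[OF l tendsto_const[of G]] by simp
  then have "((\<lambda>s. (1 / norm s) *\<^sub>R (F (t - s) - (F t - s *\<^sub>R G))) \<longlongrightarrow> 0) (at_right 0)"
    by (rule Lim_transform_eventually)
      (auto simp: eventually_at_right_field intro!: exI[of _ 1] simp: divide_inverse algebra_simps)
  then have L: "((\<lambda>y. (1 / norm (y - t)) *\<^sub>R (F y - (F t + (y - t) *\<^sub>R G))) \<longlongrightarrow> 0) (at_left t)"
    by (subst filterlim_at_left_to_right, subst filterlim_at_right_to_0) (simp add: algebra_simps)
  from R L show ?thesis
    unfolding has_derivative_within by (simp add: filterlim_at_split bounded_linear_scaleR_left)
qed

text \<open>Multiply the quotient by s. This supplies continuity at the two ends of a segment, where
  only one of the one-sided quotients exists.\<close>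

lemma tendsto_of_difference_quotient:
  fixes F :: "real \<Rightarrow> 'b::real_normed_vector"
  assumes "((\<lambda>s. (F s - c) /\<^sub>R s) \<longlongrightarrow> G) (at_right 0)"
  shows "(F \<longlongrightarrow> c) (at_right 0)"
proof -
  have "((\<lambda>s. s *\<^sub>R ((F s - c) /\<^sub>R s)) \<longlongrightarrow> 0 *\<^sub>R G) (at_right 0)"
    by (intro tendsto_intros assms)
  then have "((\<lambda>s. s *\<^sub>R ((F s - c) /\<^sub>R s)) \<longlongrightarrow> 0) (at_right 0)"
    by (simp only: scaleR_zero_left)
  then have "((\<lambda>s. F s - c) \<longlongrightarrow> 0) (at_right 0)"
    by (rule Lim_transform_eventually)
      (auto simp: eventually_at_right_field intro!: exI[of _ 1])
  then show ?thesis by (simp add: LIM_zero_iff)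
qed

section \<open>Continuity, growth and mean values in the measure argument\<close>

lemma poly_growth_integrable:
  fixes f :: "'a::euclidean_space \<Rightarrow> 'b::euclidean_space"
  assumes "m \<in> prob_moment p" "f \<in> borel_measurable borel" "\<And>x. norm (f x) \<le> C * (1 + norm x powr p)"
  shows "integrable m f"
proof (rule Bochner_Integration.integrable_bound)
  interpret prob_space m using assms by (simp add: prob_moment_def)
  show "integrable m (\<lambda>x. C * (1 + norm x powr p))"
    using assms by (auto simp: prob_moment_def)
  show "f \<in> borel_measurable m"
    using assms by (simp add: prob_moment_def cong: measurable_cong_sets)
  show "AE x in m. norm (f x) \<le> norm (C * (1 + norm x powr p))"
    using assms(3) by (intro AE_I2 order_trans[OF assms(3)]) simp
qed

lemma jointly_continuous_imp_continuous:
  assumes "jointly_continuous p F" "m \<in> prob_moment p" "p > 0"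
  shows "continuous_on UNIV (F m)"
  unfolding continuous_on_iff
proof (intro ballI allI impI)
  fix x :: "'a path" and e :: real
  assume "e > 0"
  then obtain \<delta> where "\<delta> > 0" and \<delta>: "\<forall>m'\<in>prob_moment p. \<forall>x'.
        wasserstein p m m' < \<delta> \<longrightarrow> dist x x' < \<delta> \<longrightarrow> dist (F m x) (F m' x') < e"
    using assms(1,2) unfolding jointly_continuous_def by blast
  have "wasserstein p m m \<le> 0" using assms by (intro wasserstein_self) (auto simp: prob_moment_def)
  then have "\<forall>x'. dist x' x < \<delta> \<longrightarrow> dist (F m x') (F m x) < e"
    using \<delta> assms(2) \<open>\<delta> > 0\<close> by (auto simp: dist_commute)
  then show "\<exists>d>0. \<forall>x'\<in>UNIV. dist x' x < d \<longrightarrow> dist (F m x') (F m x) < e"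
    using \<open>\<delta> > 0\<close> by auto
qed

lemma poly_growth_at:
  assumes "poly_growth p q F" "m \<in> prob_moment p" "p > 0"
  shows "\<exists>C. \<forall>x. norm (F m x) \<le> C * (1 + norm x powr q)"
proof -
  obtain \<delta> C where "\<delta> > 0" "\<forall>m'\<in>prob_moment p. wasserstein p m m' < \<delta> \<longrightarrow>
        (\<forall>x. norm (F m' x) \<le> C * (1 + norm x powr q))"
    using assms(1,2) unfolding poly_growth_def by blast
  moreover have "wasserstein p m m \<le> 0" using assms by (intro wasserstein_self) (auto simp: prob_moment_def)
  ultimately show ?thesis using assms(2) by (meson le_less_trans)
qed

lemma has_lin_fun_deriv_integrable:
  assumes "has_lin_fun_deriv p g D" "m \<in> prob_moment p" "m' \<in> prob_moment p" "p > 0"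
  shows "integrable m' (D m)"
proof -
  obtain C where "\<forall>x. norm (D m x) \<le> C * (1 + norm x powr p)"
    using poly_growth_at[of p p D m] assms by (auto simp: has_lin_fun_deriv_def)
  moreover have "D m \<in> borel_measurable borel"
    using jointly_continuous_imp_continuous[of p D m] assms
    by (auto simp: has_lin_fun_deriv_def intro!: borel_measurable_continuous_onI)
  ultimately show ?thesis using assms poly_growth_integrable by blast
qed

text \<open>The function t \<mapsto> g(m + t (n - m)) has as derivative the integral of D, taken at
  the mixed measure, against n - m; the mean value inequality is applied to it after subtracting t
  V. The free vector V will be the candidate for the first-order term.\<close>

lemma lin_fun_deriv_mvt:
  fixes g :: "'d::finite path measure \<Rightarrow> real ^ 'k::finite"
  assumes g: "has_lin_fun_deriv p g D" and m: "m \<in> prob_moment p" and n: "n \<in> prob_moment p"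
    and p: "p > 0"
  shows "\<exists>t\<in>{0..1}. norm (g n - g m - V)
    \<le> norm ((\<integral>x. D (mix t m n) x \<partial>n) - (\<integral>x. D (mix t m n) x \<partial>m) - V)"
proof -
  define F where "F = (\<lambda>t. g (mix t m n))"
  define G where "G = (\<lambda>t. (\<integral>x. D (mix t m n) x \<partial>n) - (\<integral>x. D (mix t m n) x \<partial>m))"
  have s: "sets m = sets borel" "sets n = sets borel" using m n by (auto simp: prob_moment_def)
  have mt: "mix t m n \<in> prob_moment p" if "0 \<le> t" "t \<le> 1" for t
    using that m n by (intro mix_in_prob_moment)
  have I: "(\<integral>x. D (mix t m n) x \<partial>mix t m n)
      = (1 - t) *\<^sub>R (\<integral>x. D (mix t m n) x \<partial>m) + t *\<^sub>R (\<integral>x. D (mix t m n) x \<partial>n)"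
    if "0 \<le> t" "t \<le> 1" for t
    using that mt[OF that] m n p by (intro integral_mix s has_lin_fun_deriv_integrable[OF g])
  \<comment> \<open>A weight s toward an endpoint covers the fraction s of the remaining distance, 1
    - t on the right and t on the left. The same factor appears in the limit by linearity of the
    integral in the mixture; rescaling s removes it.\<close>
  have scale: "((\<lambda>s. f (s / c)) \<longlongrightarrow> a) (at_right 0)" if "(f \<longlongrightarrow> a) (at_right 0)" "c > 0"
    for f :: "real \<Rightarrow> real ^ 'k" and a c
  proof (rule filterlim_compose[OF that(1)])
    have "((\<lambda>s. s / c) \<longlongrightarrow> 0 / c) (at_right 0)" using that by (intro tendsto_intros) auto
    then show "filterlim (\<lambda>s. s / c) (at_right 0) (at_right 0)"
      using that by (auto simp: filterlim_at eventually_at_right_field intro!: exI[of _ 1])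
  qed
  have R: "((\<lambda>s. (F (t + s) - F t) /\<^sub>R s) \<longlongrightarrow> G t) (at_right 0)" if t: "0 \<le> t" "t < 1" for t
  proof -
    have "((\<lambda>s. (g (mix s (mix t m n) n) - g (mix t m n)) /\<^sub>R s)
        \<longlongrightarrow> (\<integral>x. D (mix t m n) x \<partial>n) - (\<integral>x. D (mix t m n) x \<partial>mix t m n)) (at_right 0)"
      using g t mt[of t] n by (auto simp: has_lin_fun_deriv_def)
    also have "(\<integral>x. D (mix t m n) x \<partial>n) - (\<integral>x. D (mix t m n) x \<partial>mix t m n) = (1 - t) *\<^sub>R G t"
      using t by (simp add: I G_def algebra_simps)
    finally have "((\<lambda>s. (g (mix (s / (1 - t)) (mix t m n) n) - g (mix t m n)) /\<^sub>R (s / (1 - t)))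
        \<longlongrightarrow> (1 - t) *\<^sub>R G t) (at_right 0)"
      using t by (intro scale) auto
    from tendsto_scaleR[OF tendsto_const[of "1 / (1 - t)"] this]
    have "((\<lambda>s. (1 / (1 - t)) *\<^sub>R ((g (mix (s / (1 - t)) (mix t m n) n) - g (mix t m n)) /\<^sub>R (s / (1 - t))))
        \<longlongrightarrow> G t) (at_right 0)" using t by simp
    then show ?thesis
    proof (rule Lim_transform_eventually)
      show "\<forall>\<^sub>F s in at_right 0. (1 / (1 - t)) *\<^sub>R ((g (mix (s / (1 - t)) (mix t m n) n) - g (mix t m n)) /\<^sub>R (s / (1 - t)))
          = (F (t + s) - F t) /\<^sub>R s"
        unfolding eventually_at_right_field
      proof (intro exI[of _ "1 - t"] conjI allI impI)
        fix s assume s': "0 < s" "s < 1 - t"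
        then have "mix (s / (1 - t)) (mix t m n) n = mix (t + s) m n"
          using t by (subst mix_mix_right[OF s]) auto
        then show "(1 / (1 - t)) *\<^sub>R ((g (mix (s / (1 - t)) (mix t m n) n) - g (mix t m n)) /\<^sub>R (s / (1 - t)))
          = (F (t + s) - F t) /\<^sub>R s" using t by (simp add: F_def divide_inverse)
      qed (use t in auto)
    qed
  qed
  have L: "((\<lambda>s. (F (t - s) - F t) /\<^sub>R s) \<longlongrightarrow> - G t) (at_right 0)" if t: "0 < t" "t \<le> 1" for t
  proof -
    have "((\<lambda>s. (g (mix s (mix t m n) m) - g (mix t m n)) /\<^sub>R s)
        \<longlongrightarrow> (\<integral>x. D (mix t m n) x \<partial>m) - (\<integral>x. D (mix t m n) x \<partial>mix t m n)) (at_right 0)"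
      using g t mt[of t] m by (auto simp: has_lin_fun_deriv_def)
    also have "(\<integral>x. D (mix t m n) x \<partial>m) - (\<integral>x. D (mix t m n) x \<partial>mix t m n) = t *\<^sub>R (- G t)"
      using t by (simp add: I G_def algebra_simps)
    finally have "((\<lambda>s. (g (mix (s / t) (mix t m n) m) - g (mix t m n)) /\<^sub>R (s / t))
        \<longlongrightarrow> t *\<^sub>R (- G t)) (at_right 0)"
      using t by (intro scale) auto
    from tendsto_scaleR[OF tendsto_const[of "1 / t"] this]
    have "((\<lambda>s. (1 / t) *\<^sub>R ((g (mix (s / t) (mix t m n) m) - g (mix t m n)) /\<^sub>R (s / t)))
        \<longlongrightarrow> - G t) (at_right 0)" using t by simp
    then show ?thesis
    proof (rule Lim_transform_eventually)
      show "\<forall>\<^sub>F s in at_right 0. (1 / t) *\<^sub>R ((g (mix (s / t) (mix t m n) m) - g (mix t m n)) /\<^sub>R (s / t))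
          = (F (t - s) - F t) /\<^sub>R s"
        unfolding eventually_at_right_field
      proof (intro exI[of _ t] conjI allI impI)
        fix s assume s': "0 < s" "s < t"
        then have "mix (s / t) (mix t m n) m = mix (t - s) m n"
          using t by (subst mix_mix_left[OF s]) auto
        then show "(1 / t) *\<^sub>R ((g (mix (s / t) (mix t m n) m) - g (mix t m n)) /\<^sub>R (s / t))
          = (F (t - s) - F t) /\<^sub>R s" using t by (simp add: F_def divide_inverse)
      qed (use t in auto)
    qed
  qed
  have d: "(F has_derivative (\<lambda>h. h *\<^sub>R G t)) (at t)" if "0 < t" "t < 1" for t
    using that by (intro has_derivative_of_one_sided R L) auto
  have c: "continuous_on {0..1} F"
    unfolding continuous_on_def
  proof
    fix t :: real assume t: "t \<in> {0..1}"
    consider "t = 0" | "t = 1" | "0 < t" "t < 1" using t by fastforce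
    then show "(F \<longlongrightarrow> F t) (at t within {0..1})"
    proof cases
      case 1
      have "(F \<longlongrightarrow> F 0) (at_right 0)"
        by (rule tendsto_of_difference_quotient[where G="G 0"]) (use R[of 0] in simp)
      then show ?thesis using 1 by (simp add: at_within_Icc_at_right)
    next
      case 2
      have "((\<lambda>s. F (1 - s)) \<longlongrightarrow> F 1) (at_right 0)"
        by (rule tendsto_of_difference_quotient[where G="- G 1"]) (use L[of 1] in simp)
      then have "(F \<longlongrightarrow> F 1) (at_left 1)"
        by (subst filterlim_at_left_to_right, subst filterlim_at_right_to_0) (simp add: algebra_simps)
      then show ?thesis using 2 by (simp add: at_within_Icc_at_left)
    next
      case 3
      then have "isCont F t" using d has_derivative_continuous by blast
      then show ?thesis by (simp add: continuous_at_imp_continuous_at_within continuous_within[symmetric])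
    qed
  qed
  have d': "((\<lambda>t. F t - t *\<^sub>R V) has_derivative (\<lambda>h. h *\<^sub>R G t - h *\<^sub>R V)) (at t)"
    if "0 < t" "t < 1" for t
    using d[OF that] by (auto intro!: derivative_eq_intros)
  have "continuous_on {0..1} (\<lambda>t. F t - t *\<^sub>R V)" by (intro continuous_intros c)
  from mvt_general[OF _ this d'] have "\<exists>t\<in>{0<..<1}. norm ((F 1 - 1 *\<^sub>R V) - (F 0 - 0 *\<^sub>R V)) \<le> norm ((1 - 0) *\<^sub>R G t - (1 - 0) *\<^sub>R V)"
    by simp
  then obtain t where "t \<in> {0<..<1}" "norm ((F 1 - 1 *\<^sub>R V) - (F 0 - 0 *\<^sub>R V)) \<le> norm (G t - V)"
    by auto
  then show ?thesis
    using s by (intro bexI[of _ t]) (auto simp: F_def G_def mix_0 mix_1 algebra_simps)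
qed

text \<open>The mean value inequality in the measure, followed by the one in x, bounds the error by
  the integral of |q n|. Divided by b n, the integrand is at most K times the increment of
  \<open>dx D\<close> between (m, U) and an argument at distance at most b n. Joint continuity sends
  it to zero, growth of order p - 1 dominates it. The sequential form is what dominated convergence
  asks for.\<close>

lemma condition_R_expansion_seq:
  fixes g :: "'d::finite path measure \<Rightarrow> real ^ 'k::finite" and U :: "'a \<Rightarrow> 'd path"
  assumes R: "condition_R p g D" and p: "p > 1" and P: "prob_space P"
    and [measurable]: "U \<in> borel_measurable P" "\<And>n. Y n \<in> borel_measurable P"
    and U: "integrable P (\<lambda>\<omega>. norm (U \<omega>) powr p)"
    and b: "\<And>n. AE \<omega> in P. norm (Y n \<omega>) \<le> b n" "\<And>n. 0 < b n" "b \<longlonglongrightarrow> 0"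
  defines "m \<equiv> distr P borel U"
  shows "(\<lambda>n. norm (g (distr P borel (\<lambda>\<omega>. U \<omega> + Y n \<omega>)) - g m
    - (\<integral>\<omega>. blk_app (dx (D m) (U \<omega>)) (Y n \<omega>) \<partial>P)) / b n) \<longlonglongrightarrow> 0"
proof -
  interpret prob_space P by fact
  have lin: "has_lin_fun_deriv p g D" and C1: "\<And>m. m \<in> prob_moment p \<Longrightarrow> C1 (D m)"
    and jc: "jointly_continuous p (\<lambda>m. dx (D m))" and pg: "poly_growth p (p - 1) (\<lambda>m. dx (D m))"
    using R by (auto simp: condition_R_def)
  define N where "N = (\<lambda>n. distr P borel (\<lambda>\<omega>. U \<omega> + Y n \<omega>))"
  have m: "m \<in> prob_moment p"
    unfolding m_def using P U by (intro distr_in_prob_moment) auto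
  have bp: "0 \<le> b n" for n using b(2)[of n] by simp
  have N: "N n \<in> prob_moment p" for n
    unfolding N_def using p
    by (intro distr_in_prob_moment integrable_powr_add integrable_powr_of_AE_bound[OF _ b(1)] P U) auto
  define V where "V = (\<lambda>n. \<integral>\<omega>. blk_app (dx (D m) (U \<omega>)) (Y n \<omega>) \<partial>P)"
  have "\<exists>t\<in>{0..1}. norm (g (N n) - g m - V n)
    \<le> norm ((\<integral>x. D (mix t m (N n)) x \<partial>N n) - (\<integral>x. D (mix t m (N n)) x \<partial>m) - V n)" for n
    using p by (intro lin_fun_deriv_mvt[OF lin m N]) auto
  then obtain t where t: "\<And>n. 0 \<le> t n" "\<And>n. t n \<le> 1"
    and le: "\<And>n. norm (g (N n) - g m - V n)
    \<le> norm ((\<integral>x. D (mix (t n) m (N n)) x \<partial>N n) - (\<integral>x. D (mix (t n) m (N n)) x \<partial>m) - V n)"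
    by (metis atLeastAtMost_iff)
  define M where "M = (\<lambda>n. mix (t n) m (N n))"
  have M: "M n \<in> prob_moment p" for n
    unfolding M_def using t m N by (intro mix_in_prob_moment)
  have W: "wasserstein p m (M n) \<le> b n" for n
    unfolding M_def N_def m_def using b(1)[of n] bp t p P by (intro wasserstein_mix_le) auto
  define q where "q = (\<lambda>n \<omega>. D (M n) (U \<omega> + Y n \<omega>) - D (M n) (U \<omega>) - blk_app (dx (D m) (U \<omega>)) (Y n \<omega>))"
  have cD: "continuous_on UNIV (D n)" if "n \<in> prob_moment p" for n
    using lin that p jointly_continuous_imp_continuous[of p D n] by (auto simp: has_lin_fun_deriv_def)
  have [measurable]: "D (M n) \<in> borel_measurable borel" for n
    using cD[OF M] by (rule borel_measurable_continuous_onI)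
  have [measurable]: "dx (D m) \<in> borel_measurable borel"
    using jointly_continuous_imp_continuous[OF jc m] p by (intro borel_measurable_continuous_onI) auto
  have [measurable]: "(\<lambda>\<omega>. blk_app (dx (D m) (U \<omega>)) (Y n \<omega>)) \<in> borel_measurable P" for n
    by (rule borel_measurable_continuous_Pair) (auto intro!: continuous_intros blk_app.continuous_on)
  have [measurable]: "q n \<in> borel_measurable P" for n unfolding q_def by measurable
  obtain K where K: "K \<ge> 0" "\<And>A v. norm (blk_app (A :: ('d, 'k) blocks) v) \<le> norm A * norm v * K"
    using blk_app.nonneg_bounded by blast
  have qle: "\<exists>\<xi>. dist (U \<omega>) \<xi> \<le> norm (Y n \<omega>) \<and>
      norm (q n \<omega>) \<le> K * norm (dx (D (M n)) \<xi> - dx (D m) (U \<omega>)) * norm (Y n \<omega>)" for n \<omega>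
  proof -
    obtain s where s: "s \<in> {0..1}" "norm (q n \<omega>)
        \<le> norm (blk_app (dx (D (M n)) (U \<omega> + s *\<^sub>R Y n \<omega>) - dx (D m) (U \<omega>)) (Y n \<omega>))"
      using C1_mvt[OF C1[OF M]] unfolding q_def by blast
    note s(2)
    also have "\<dots> \<le> norm (dx (D (M n)) (U \<omega> + s *\<^sub>R Y n \<omega>) - dx (D m) (U \<omega>)) * norm (Y n \<omega>) * K"
      by (rule K)
    finally show ?thesis using s(1)
      by (intro exI[of _ "U \<omega> + s *\<^sub>R Y n \<omega>"]) (auto simp: dist_norm mult_ac intro!: mult_left_le_one_le)
  qed
  \<comment> \<open>The choice is made pointwise and may fail to be measurable in \<omega>;
    \<open>\<xi>\<close> enters pointwise bounds only and is never integrated.\<close>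
  define \<xi> where "\<xi> = (\<lambda>n \<omega>. SOME \<xi>. dist (U \<omega>) \<xi> \<le> norm (Y n \<omega>) \<and>
      norm (q n \<omega>) \<le> K * norm (dx (D (M n)) \<xi> - dx (D m) (U \<omega>)) * norm (Y n \<omega>))"
  have \<xi>: "dist (U \<omega>) (\<xi> n \<omega>) \<le> norm (Y n \<omega>)"
    "norm (q n \<omega>) \<le> K * norm (dx (D (M n)) (\<xi> n \<omega>) - dx (D m) (U \<omega>)) * norm (Y n \<omega>)" for n \<omega>
    using someI_ex[OF qle[of \<omega> n]] unfolding \<xi>_def by auto
  have AEb: "AE \<omega> in P. \<forall>n. norm (Y n \<omega>) \<le> b n"
    using b(1) by (simp add: AE_all_countable)
  have qb: "norm (q n \<omega>) / b n \<le> K * norm (dx (D (M n)) (\<xi> n \<omega>) - dx (D m) (U \<omega>))"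
    if "\<forall>n. norm (Y n \<omega>) \<le> b n" for n \<omega>
  proof -
    have "norm (q n \<omega>) \<le> K * norm (dx (D (M n)) (\<xi> n \<omega>) - dx (D m) (U \<omega>)) * b n"
      using that K(1) by (intro order_trans[OF \<xi>(2)] mult_left_mono) auto
    then show ?thesis using b(2)[of n] by (simp add: divide_le_eq)
  qed
  have lim: "AE \<omega> in P. (\<lambda>n. norm (q n \<omega>) / b n) \<longlonglongrightarrow> 0"
    using AEb
  proof eventually_elim
    case (elim \<omega>)
    have "(\<lambda>n. dx (D (M n)) (\<xi> n \<omega>) - dx (D m) (U \<omega>)) \<longlonglongrightarrow> 0"
      unfolding LIM_zero_iff
    proof (rule tendstoI)
      fix e :: real assume "e > 0"
      then obtain \<delta> where \<delta>: "\<delta> > 0" "\<And>m' x'. m' \<in> prob_moment p \<Longrightarrow> wasserstein p m m' < \<delta> \<Longrightarrow>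
          dist (U \<omega>) x' < \<delta> \<Longrightarrow> dist (dx (D m) (U \<omega>)) (dx (D m') x') < e"
        using jc m unfolding jointly_continuous_def by metis
      have "eventually (\<lambda>n. b n < \<delta>) sequentially"
        using b(3) \<delta>(1) by (rule order_tendstoD)
      then show "eventually (\<lambda>n. dist (dx (D (M n)) (\<xi> n \<omega>)) (dx (D m) (U \<omega>)) < e) sequentially"
      proof eventually_elim
        case (elim n)
        have "dist (U \<omega>) (\<xi> n \<omega>) < \<delta>" "wasserstein p m (M n) < \<delta>"
          using \<xi>(1)[of \<omega> n] \<open>\<forall>n. norm (Y n \<omega>) \<le> b n\<close>[rule_format, of n] elim W[of n] by linarith+
        then show ?case using \<delta>(2)[OF M] by (simp add: dist_commute)
      qed
    qed
    then have "(\<lambda>n. K * norm (dx (D (M n)) (\<xi> n \<omega>) - dx (D m) (U \<omega>))) \<longlonglongrightarrow> 0"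
      by (intro tendsto_mult_right_zero tendsto_norm_zero)
    then show ?case
      by (rule Lim_null_comparison[rotated]) (use qb[OF elim] bp in \<open>auto intro!: always_eventually\<close>)
  qed
  obtain \<delta> C where \<delta>: "\<delta> > 0" and C: "\<And>m' x. m' \<in> prob_moment p \<Longrightarrow> wasserstein p m m' < \<delta> \<Longrightarrow>
        norm (dx (D m') x) \<le> C * (1 + norm x powr (p - 1))"
    using pg m unfolding poly_growth_def by metis
  have C0: "0 \<le> C"
    using order_trans[OF norm_ge_zero C[OF m, of 0]] wasserstein_self[of m p] m p \<delta>
    by (auto simp: prob_moment_def)
  \<comment> \<open>Within distance 1 of U the growth of order p - 1 is traded for order p, which is
    integrable. The bound occurs twice, once for each of the two derivatives being
    subtracted.\<close>
  define w where "w = (\<lambda>\<omega>. K * (C * (2 + (norm (U \<omega>) + 1) powr p) + C * (2 + (norm (U \<omega>) + 1) powr p)))"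
  have pw: "z powr (p - 1) \<le> 1 + y powr p" if "0 \<le> z" "z \<le> y" "1 \<le> y" for z y :: real
  proof -
    have "z powr (p - 1) \<le> y powr (p - 1)" using that p by (intro powr_mono2) auto
    also have "\<dots> \<le> y powr p" using that p by (intro powr_mono) auto
    finally show ?thesis by simp
  qed
  have iw: "integrable P w"
  proof -
    have "integrable P (\<lambda>\<omega>. norm (norm (U \<omega>) + 1) powr p)"
      using U p by (intro integrable_powr_add) auto
    then have "integrable P (\<lambda>\<omega>. (norm (U \<omega>) + 1) powr p)" by simp
    then show ?thesis unfolding w_def by auto
  qed
  \<comment> \<open>Domination needs b n < \<delta>, so that the local growth constant C is valid,
    and b n < 1, so that the intermediate point is within 1 of U. It starts at n0, hence the shifted
    sequence.\<close>
  have "eventually (\<lambda>n. b n < min \<delta> 1) sequentially"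
    using b(3) \<delta> by (intro order_tendstoD) auto
  then obtain n0 where n0: "\<And>n. n \<ge> n0 \<Longrightarrow> b n < min \<delta> 1" by (auto simp: eventually_sequentially)
  have dom: "AE \<omega> in P. norm (norm (q (n + n0) \<omega>) / b (n + n0)) \<le> w \<omega>" for n
    using AEb
  proof eventually_elim
    case (elim \<omega>)
    define i where "i = n + n0"
    have i: "b i < \<delta>" "b i < 1" using n0[of i] by (auto simp: i_def)
    have "norm (\<xi> i \<omega>) \<le> norm (U \<omega>) + dist (U \<omega>) (\<xi> i \<omega>)"
      by (metis add.commute dist_commute dist_norm norm_triangle_sub)
    then have "norm (\<xi> i \<omega>) \<le> norm (U \<omega>) + 1"
      using \<xi>(1)[of \<omega> i] elim[rule_format, of i] i by linarith
    then have pp: "norm (\<xi> i \<omega>) powr (p - 1) \<le> 1 + (norm (U \<omega>) + 1) powr p"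
      "norm (U \<omega>) powr (p - 1) \<le> 1 + (norm (U \<omega>) + 1) powr p"
      by (auto intro!: pw)
    have ww: "wasserstein p m (M i) < \<delta>" "wasserstein p m m < \<delta>"
      using W[of i] i wasserstein_self[of m p] m p \<delta> by (auto simp: prob_moment_def)
    have "norm (dx (D (M i)) (\<xi> i \<omega>)) \<le> C * (1 + norm (\<xi> i \<omega>) powr (p - 1))"
      by (intro C M ww)
    also have "\<dots> \<le> C * (2 + (norm (U \<omega>) + 1) powr p)"
      using pp C0 by (intro mult_left_mono) auto
    finally have 1: "norm (dx (D (M i)) (\<xi> i \<omega>)) \<le> C * (2 + (norm (U \<omega>) + 1) powr p)" .
    have "norm (dx (D m) (U \<omega>)) \<le> C * (1 + norm (U \<omega>) powr (p - 1))"
      by (intro C m ww)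
    also have "\<dots> \<le> C * (2 + (norm (U \<omega>) + 1) powr p)"
      using pp C0 by (intro mult_left_mono) auto
    finally have 2: "norm (dx (D m) (U \<omega>)) \<le> C * (2 + (norm (U \<omega>) + 1) powr p)" .
    have "norm (q i \<omega>) / b i \<le> K * norm (dx (D (M i)) (\<xi> i \<omega>) - dx (D m) (U \<omega>))"
      by (rule qb[OF elim])
    also have "\<dots> \<le> w \<omega>"
      unfolding w_def using 1 2 K(1) norm_triangle_ineq4[of "dx (D (M i)) (\<xi> i \<omega>)" "dx (D m) (U \<omega>)"]
      by (intro mult_left_mono) linarith+
    finally show ?case using bp[of i] by (simp add: i_def)
  qed
  have E: "(\<lambda>n. \<integral>\<omega>. norm (q (n + n0) \<omega>) / b (n + n0) \<partial>P) \<longlonglongrightarrow> (\<integral>\<omega>. 0 \<partial>P)"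
  proof (rule integral_dominated_convergence[where w=w])
    show "AE \<omega> in P. (\<lambda>n. norm (q (n + n0) \<omega>) / b (n + n0)) \<longlonglongrightarrow> 0"
      using lim by eventually_elim (rule LIMSEQ_ignore_initial_segment)
  qed (use iw dom in auto)
  have fin: "norm (g (N n) - g m - V n) / b n \<le> (\<integral>\<omega>. norm (q n \<omega>) / b n \<partial>P)" for n
  proof -
    have iD: "integrable n' (D (M n))" if "n' \<in> prob_moment p" for n'
      using p that M by (intro has_lin_fun_deriv_integrable[OF lin]) auto
    have i1: "integrable P (\<lambda>\<omega>. D (M n) (U \<omega> + Y n \<omega>))" "integrable P (\<lambda>\<omega>. D (M n) (U \<omega>))"
      using iD[OF m] iD[OF N[of n]] by (simp_all add: m_def N_def integrable_distr_eq)
    have "integrable P (\<lambda>\<omega>. blk_app (dx (D m) (U \<omega>)) (Y n \<omega>))"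
    proof (rule Bochner_Integration.integrable_bound)
      show "integrable P (\<lambda>\<omega>. b n * w \<omega>)" using iw by simp
      show "AE \<omega> in P. norm (blk_app (dx (D m) (U \<omega>)) (Y n \<omega>)) \<le> norm (b n * w \<omega>)"
        using b(1)[of n]
      proof eventually_elim
        case (elim \<omega>)
        have ww: "wasserstein p m m < \<delta>"
          using wasserstein_self[of m p] m p \<delta> by (auto simp: prob_moment_def)
        have "norm (dx (D m) (U \<omega>)) \<le> C * (1 + norm (U \<omega>) powr (p - 1))"
          by (intro C m ww)
        also have "\<dots> \<le> C * (2 + (norm (U \<omega>) + 1) powr p)"
          using pw[of "norm (U \<omega>)" "norm (U \<omega>) + 1"] C0 by (intro mult_left_mono) auto
        also have "\<dots> \<le> C * (2 + (norm (U \<omega>) + 1) powr p) + C * (2 + (norm (U \<omega>) + 1) powr p)"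
          using C0 by simp
        finally have "norm (dx (D m) (U \<omega>)) * norm (Y n \<omega>) * K \<le>
            (C * (2 + (norm (U \<omega>) + 1) powr p) + C * (2 + (norm (U \<omega>) + 1) powr p)) * b n * K"
          using elim K(1) C0 by (intro mult_right_mono mult_mono) auto
        also have "\<dots> = b n * w \<omega>" by (simp add: w_def mult_ac)
        finally have "norm (blk_app (dx (D m) (U \<omega>)) (Y n \<omega>)) \<le> b n * w \<omega>"
          using K(2)[of "dx (D m) (U \<omega>)" "Y n \<omega>"] by linarith
        then show ?case by simp
      qed
    qed simp
    then have "(\<integral>x. D (M n) x \<partial>N n) - (\<integral>x. D (M n) x \<partial>m) - V n = (\<integral>\<omega>. q n \<omega> \<partial>P)"
      unfolding q_def V_def using i1 by (simp add: N_def m_def integral_distr)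
    then have "norm (g (N n) - g m - V n) \<le> norm (\<integral>\<omega>. q n \<omega> \<partial>P)"
      using le[of n] by (simp add: M_def)
    also have "\<dots> \<le> (\<integral>\<omega>. norm (q n \<omega>) \<partial>P)" by (rule integral_norm_bound)
    finally show ?thesis using b(2)[of n] by (simp add: divide_right_mono)
  qed
  have "(\<lambda>n. norm (g (N (n + n0)) - g m - V (n + n0)) / b (n + n0)) \<longlonglongrightarrow> 0"
    by (rule Lim_null_comparison[OF _ E[simplified]]) (use fin bp in \<open>auto intro!: always_eventually\<close>)
  then show ?thesis unfolding N_def V_def by (rule LIMSEQ_offset)
qed

text \<open>Uniformity over all displacements bounded by b: if it failed, violators at the scales
  1/(n+1) would form a sequence contradicting the sequential version.\<close>

lemma condition_R_expansion:
  fixes g :: "'d::finite path measure \<Rightarrow> real ^ 'k::finite" and U :: "'a \<Rightarrow> 'd path"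
  assumes R: "condition_R p g D" and p: "p > 1" and P: "prob_space P"
    and [measurable]: "U \<in> borel_measurable P"
    and U: "integrable P (\<lambda>\<omega>. norm (U \<omega>) powr p)" and e: "e > 0"
  defines "m \<equiv> distr P borel U"
  shows "\<exists>\<delta>>0. \<forall>Y\<in>borel_measurable P. \<forall>b. 0 < b \<longrightarrow> b \<le> \<delta> \<longrightarrow> (AE \<omega> in P. norm (Y \<omega>) \<le> b) \<longrightarrow>
    norm (g (distr P borel (\<lambda>\<omega>. U \<omega> + Y \<omega>)) - g m
      - (\<integral>\<omega>. blk_app (dx (D m) (U \<omega>)) (Y \<omega>) \<partial>P)) \<le> e * b"
proof (rule ccontr)
  assume neg: "\<not> ?thesis"
  have "\<exists>Y b. Y \<in> borel_measurable P \<and> 0 < b \<and> b \<le> 1 / real (Suc n) \<and> (AE \<omega> in P. norm (Y \<omega>) \<le> b) \<and>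
    \<not> norm (g (distr P borel (\<lambda>\<omega>. U \<omega> + Y \<omega>)) - g m
      - (\<integral>\<omega>. blk_app (dx (D m) (U \<omega>)) (Y \<omega>) \<partial>P)) \<le> e * b" for n
    using neg[simplified not_ex, rule_format, of "1 / real (Suc n)"] by fastforce
  then have "\<forall>n. \<exists>Y b. Y \<in> borel_measurable P \<and> 0 < b \<and> b \<le> 1 / real (Suc n) \<and> (AE \<omega> in P. norm (Y \<omega>) \<le> b) \<and>
    \<not> norm (g (distr P borel (\<lambda>\<omega>. U \<omega> + Y \<omega>)) - g m
      - (\<integral>\<omega>. blk_app (dx (D m) (U \<omega>)) (Y \<omega>) \<partial>P)) \<le> e * b"
    by blast
  then obtain Y b where *: "\<forall>n. Y n \<in> borel_measurable P \<and> 0 < b n \<and> b n \<le> 1 / real (Suc n) \<and> (AE \<omega> in P. norm (Y n \<omega>) \<le> b n) \<and>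
    \<not> norm (g (distr P borel (\<lambda>\<omega>. U \<omega> + Y n \<omega>)) - g m
      - (\<integral>\<omega>. blk_app (dx (D m) (U \<omega>)) (Y n \<omega>) \<partial>P)) \<le> e * b n"
    unfolding choice_iff by blast
  then have Y: "\<And>n. Y n \<in> borel_measurable P" and b: "\<And>n. 0 < b n" "\<And>n. b n \<le> 1 / real (Suc n)"
    "\<And>n. AE \<omega> in P. norm (Y n \<omega>) \<le> b n"
    and ge: "\<And>n. \<not> norm (g (distr P borel (\<lambda>\<omega>. U \<omega> + Y n \<omega>)) - g m
      - (\<integral>\<omega>. blk_app (dx (D m) (U \<omega>)) (Y n \<omega>) \<partial>P)) \<le> e * b n"
    by simp_all
  have "b \<longlonglongrightarrow> 0"
    by (rule Lim_null_comparison[OF _ LIMSEQ_inverse_real_of_nat])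
      (use b in \<open>auto intro!: always_eventually simp: less_imp_le inverse_eq_divide\<close>)
  then have "(\<lambda>n. norm (g (distr P borel (\<lambda>\<omega>. U \<omega> + Y n \<omega>)) - g m
    - (\<integral>\<omega>. blk_app (dx (D m) (U \<omega>)) (Y n \<omega>) \<partial>P)) / b n) \<longlonglongrightarrow> 0"
    unfolding m_def using assms(4) by (intro condition_R_expansion_seq[OF R p P] Y b U)
  then have "eventually (\<lambda>n. norm (g (distr P borel (\<lambda>\<omega>. U \<omega> + Y n \<omega>)) - g m
    - (\<integral>\<omega>. blk_app (dx (D m) (U \<omega>)) (Y n \<omega>) \<partial>P)) / b n < e) sequentially"
    using e by (rule order_tendstoD)
  then obtain n where "norm (g (distr P borel (\<lambda>\<omega>. U \<omega> + Y n \<omega>)) - g m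
    - (\<integral>\<omega>. blk_app (dx (D m) (U \<omega>)) (Y n \<omega>) \<partial>P)) / b n < e"
    by (auto simp: eventually_sequentially)
  then show False using ge[of n] b(1)[of n] by (simp add: divide_less_eq)
qed

section \<open>Integrability of the derivative and continuity under small displacements\<close>

lemma condition_R_dx:
  assumes R: "condition_R p g D" and p: "p > 1" and m: "m \<in> prob_moment p"
  shows "dx (D m) \<in> borel_measurable borel"
    and "\<exists>C\<ge>0. \<forall>x. norm (dx (D m) x) \<le> C * (1 + norm x powr (p - 1))"
proof -
  have jc: "jointly_continuous p (\<lambda>m. dx (D m))" and pg: "poly_growth p (p - 1) (\<lambda>m. dx (D m))"
    using R by (auto simp: condition_R_def)
  show "dx (D m) \<in> borel_measurable borel"
    using jointly_continuous_imp_continuous[OF jc m] p by (intro borel_measurable_continuous_onI) auto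
  obtain C where C: "\<forall>x. norm (dx (D m) x) \<le> C * (1 + norm x powr (p - 1))"
    using poly_growth_at[OF pg m] p by auto
  moreover from C[rule_format, of 0] have "0 \<le> C" using order_trans[OF norm_ge_zero] p by simp
  ultimately show "\<exists>C\<ge>0. \<forall>x. norm (dx (D m) x) \<le> C * (1 + norm x powr (p - 1))" by blast
qed

lemma powr_le_one_plus_powr:
  fixes a b c :: real
  assumes "0 \<le> c" "0 \<le> a" "a \<le> b"
  shows "c powr a \<le> 1 + c powr b"
proof (cases "c \<le> 1")
  case True
  then have "c powr a \<le> 1 powr a" using assms by (intro powr_mono2) auto
  then have "c powr a \<le> 1" by simp
  then show ?thesis using powr_ge_zero[of c b] by linarith
next
  case False
  then have "c powr a \<le> c powr b" using assms by (intro powr_mono) auto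
  then show ?thesis by simp
qed

lemma integrable_dx:
  fixes U :: "'a \<Rightarrow> 'd::finite path"
  assumes R: "condition_R p g D" and p: "p > 1" and P: "prob_space P"
    and m: "m \<in> prob_moment p" and [measurable]: "U \<in> borel_measurable P"
    and U: "integrable P (\<lambda>\<omega>. norm (U \<omega>) powr p)"
  shows "integrable P (\<lambda>\<omega>. dx (D m) (U \<omega>))"
proof -
  interpret prob_space P by fact
  note [measurable] = condition_R_dx(1)[OF R p m]
  obtain C where C: "C \<ge> 0" "\<And>x. norm (dx (D m) x) \<le> C * (1 + norm x powr (p - 1))"
    using condition_R_dx(2)[OF R p m] by blast
  show ?thesis
  proof (rule Bochner_Integration.integrable_bound)
    show "integrable P (\<lambda>\<omega>. C * (2 + norm (U \<omega>) powr p))" using U by auto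
    have "norm (dx (D m) (U \<omega>)) \<le> C * (2 + norm (U \<omega>) powr p)" for \<omega>
      using C(2)[of "U \<omega>"] powr_le_one_plus_powr[of "norm (U \<omega>)" "p - 1" p] p C(1)
      by (intro order_trans[OF C(2)] mult_left_mono) auto
    then show "AE \<omega> in P. norm (dx (D m) (U \<omega>)) \<le> norm (C * (2 + norm (U \<omega>) powr p))"
      by (intro AE_I2) (metis abs_ge_self order_trans real_norm_def)
  qed measurable
qed

lemma measurable_blk_app [measurable (raw)]:
  assumes "f \<in> borel_measurable M" "g \<in> borel_measurable M"
  shows "(\<lambda>x. blk_app (f x :: ('d::finite, 'k::finite) blocks) (g x)) \<in> borel_measurable M"
  by (rule borel_measurable_continuous_Pair[OF assms])
    (auto intro!: continuous_intros blk_app.continuous_on)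

lemma integrable_blk_app_bounded:
  fixes A :: "'a \<Rightarrow> ('d::finite, 'k::finite) blocks"
  assumes A: "integrable P A" and [measurable]: "Y \<in> borel_measurable P"
    and b: "AE \<omega> in P. norm (Y \<omega>) \<le> b"
  shows "integrable P (\<lambda>\<omega>. blk_app (A \<omega>) (Y \<omega>))"
proof -
  have [measurable]: "A \<in> borel_measurable P" using A by auto
  obtain K where K: "K \<ge> 0" "\<And>A v. norm (blk_app (A :: ('d, 'k) blocks) v) \<le> norm A * norm v * K"
    using blk_app.nonneg_bounded by blast
  show ?thesis
  proof (rule Bochner_Integration.integrable_bound)
    show "integrable P (\<lambda>\<omega>. norm (A \<omega>) * b * K)" using A by auto
    show "AE \<omega> in P. norm (blk_app (A \<omega>) (Y \<omega>)) \<le> norm (norm (A \<omega>) * b * K)"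
      using b
    proof eventually_elim
      case (elim \<omega>)
      have "norm (blk_app (A \<omega>) (Y \<omega>)) \<le> norm (A \<omega>) * norm (Y \<omega>) * K" by (rule K)
      also have "\<dots> \<le> norm (A \<omega>) * b * K" using elim K(1) by (intro mult_right_mono mult_left_mono) auto
      finally show ?case by simp
    qed
  qed measurable
qed

text \<open>Drop the first-order term of the expansion, which is bounded by a multiple of the
  displacement. The base variable U is general because continuity will be needed at laws that are
  already displaced.\<close>

lemma condition_R_continuous:
  fixes g :: "'d::finite path measure \<Rightarrow> real ^ 'k::finite" and U :: "'a \<Rightarrow> 'd path"
  assumes R: "condition_R p g D" and p: "p > 1" and P: "prob_space P"
    and [measurable]: "U \<in> borel_measurable P"
    and U: "integrable P (\<lambda>\<omega>. norm (U \<omega>) powr p)" and e: "e > 0"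
  shows "\<exists>\<delta>>0. \<forall>Y\<in>borel_measurable P. (AE \<omega> in P. norm (Y \<omega>) \<le> \<delta>) \<longrightarrow>
    norm (g (distr P borel (\<lambda>\<omega>. U \<omega> + Y \<omega>)) - g (distr P borel U)) < e"
proof -
  interpret prob_space P by fact
  define m where "m = distr P borel U"
  have m: "m \<in> prob_moment p"
    unfolding m_def using P U by (intro distr_in_prob_moment) auto
  obtain K where K: "K \<ge> 0" "\<And>A v. norm (blk_app (A :: ('d, 'k) blocks) v) \<le> norm A * norm v * K"
    using blk_app.nonneg_bounded by blast
  obtain \<delta> where \<delta>: "\<delta> > 0" "\<And>Y b. Y \<in> borel_measurable P \<Longrightarrow> 0 < b \<Longrightarrow> b \<le> \<delta> \<Longrightarrow> (AE \<omega> in P. norm (Y \<omega>) \<le> b) \<Longrightarrow>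
    norm (g (distr P borel (\<lambda>\<omega>. U \<omega> + Y \<omega>)) - g m
      - (\<integral>\<omega>. blk_app (dx (D m) (U \<omega>)) (Y \<omega>) \<partial>P)) \<le> 1 * b"
    using condition_R_expansion[OF R p P assms(4) U zero_less_one] unfolding m_def by blast
  define L where "L = (\<integral>\<omega>. norm (dx (D m) (U \<omega>)) * K \<partial>P)"
  have iD: "integrable P (\<lambda>\<omega>. dx (D m) (U \<omega>))" by (rule integrable_dx[OF R p P m assms(4) U])
  have L: "L \<ge> 0" unfolding L_def using K by (intro integral_nonneg_AE) auto
  \<comment> \<open>The first-order term contributes b L and the remainder b; dividing by 2 + L
    instead of 1 + L makes the final inequality strict.\<close>
  define b where "b = min \<delta> (e / (2 + L))"
  have b: "b > 0" "b \<le> \<delta>" using \<delta> e L by (auto simp: b_def)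
  have "b * (1 + L) < b * (2 + L)" using b by simp
  also have "\<dots> \<le> e / (2 + L) * (2 + L)" using L by (intro mult_right_mono) (auto simp: b_def)
  also have "\<dots> = e" using L by simp
  finally have be: "b * (1 + L) < e" .
  show ?thesis
  proof (intro exI[of _ b] conjI ballI impI b)
    fix Y :: "'a \<Rightarrow> 'd path"
    assume [measurable]: "Y \<in> borel_measurable P" and Yb: "AE \<omega> in P. norm (Y \<omega>) \<le> b"
    have "norm (\<integral>\<omega>. blk_app (dx (D m) (U \<omega>)) (Y \<omega>) \<partial>P) \<le> (\<integral>\<omega>. norm (blk_app (dx (D m) (U \<omega>)) (Y \<omega>)) \<partial>P)"
      by (rule integral_norm_bound)
    also have "\<dots> \<le> (\<integral>\<omega>. b * (norm (dx (D m) (U \<omega>)) * K) \<partial>P)"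
    proof (rule integral_mono_AE)
      show "integrable P (\<lambda>\<omega>. norm (blk_app (dx (D m) (U \<omega>)) (Y \<omega>)))"
        using integrable_blk_app_bounded[OF iD _ Yb] by simp
      show "integrable P (\<lambda>\<omega>. b * (norm (dx (D m) (U \<omega>)) * K))" using iD by auto
      show "AE \<omega> in P. norm (blk_app (dx (D m) (U \<omega>)) (Y \<omega>)) \<le> b * (norm (dx (D m) (U \<omega>)) * K)"
        using Yb
      proof eventually_elim
        case (elim \<omega>)
        have "norm (blk_app (dx (D m) (U \<omega>)) (Y \<omega>)) \<le> norm (dx (D m) (U \<omega>)) * norm (Y \<omega>) * K" by (rule K)
        also have "\<dots> \<le> norm (dx (D m) (U \<omega>)) * b * K" using elim K(1) by (intro mult_right_mono mult_left_mono) auto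
        finally show ?case by (simp add: mult_ac)
      qed
    qed
    also have "\<dots> = b * L" by (simp add: L_def)
    finally have 1: "norm (\<integral>\<omega>. blk_app (dx (D m) (U \<omega>)) (Y \<omega>) \<partial>P) \<le> b * L" .
    have "norm (g (distr P borel (\<lambda>\<omega>. U \<omega> + Y \<omega>)) - g m
      - (\<integral>\<omega>. blk_app (dx (D m) (U \<omega>)) (Y \<omega>) \<partial>P)) \<le> 1 * b"
      by (rule \<delta>(2)) (use b Yb in auto)
    with 1 have "norm (g (distr P borel (\<lambda>\<omega>. U \<omega> + Y \<omega>)) - g m) \<le> b * (1 + L)"
      using norm_triangle_sub[of "g (distr P borel (\<lambda>\<omega>. U \<omega> + Y \<omega>)) - g m"
        "\<integral>\<omega>. blk_app (dx (D m) (U \<omega>)) (Y \<omega>) \<partial>P"] by (simp add: algebra_simps)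
    then show "norm (g (distr P borel (\<lambda>\<omega>. U \<omega> + Y \<omega>)) - g (distr P borel U)) < e"
      using be by (simp add: m_def)
  qed
qed

section \<open>A topological zero theorem and linear algebra\<close>

text \<open>F r is close to a \<mapsto> r v + a, so a \<mapsto> a - F r a is close to the constant
  -r v and maps the ball of radius r (|v| + \<epsilon>) into itself. A fixed point is a zero of F r,
  and its size can be read off from the ball.\<close>

lemma zero_near_of_first_order_expansion:
  fixes F :: "real \<Rightarrow> 'b::euclidean_space \<Rightarrow> 'b"
  assumes exp: "\<And>e. e > 0 \<Longrightarrow> \<exists>\<delta>>0. \<forall>r a. 0 < r \<longrightarrow> r \<le> \<delta> \<longrightarrow> norm a \<le> \<delta> \<longrightarrow>
      norm (F r a - (r *\<^sub>R v + a)) \<le> e * (r + norm a)"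
    and cont: "\<delta>0 > 0" "\<And>r. 0 < r \<Longrightarrow> r \<le> \<delta>0 \<Longrightarrow> continuous_on (cball 0 \<delta>0) (F r)"
    and \<epsilon>: "\<epsilon> > 0"
  shows "\<exists>\<delta>>0. \<forall>r. 0 < r \<longrightarrow> r \<le> \<delta> \<longrightarrow> (\<exists>a. norm a \<le> r * (norm v + \<epsilon>) \<and> F r a = 0)"
proof -
  define K where "K = norm v + \<epsilon>"
  have K: "K > 0" using \<epsilon> by (simp add: K_def add_nonneg_pos)
  \<comment> \<open>On the ball, r + |a| \<le> r (1 + K), so this accuracy makes the total error at
    most \<epsilon> r, exactly the slack in the radius.\<close>
  have "\<epsilon> / (1 + K) > 0" using \<epsilon> K by simp
  from exp[OF this] obtain \<delta>1 where \<delta>1: "\<delta>1 > 0" "\<And>r a. 0 < r \<Longrightarrow> r \<le> \<delta>1 \<Longrightarrow> norm a \<le> \<delta>1 \<Longrightarrow>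
      norm (F r a - (r *\<^sub>R v + a)) \<le> \<epsilon> / (1 + K) * (r + norm a)" by blast
  define \<delta> where "\<delta> = min \<delta>0 \<delta>1 / (1 + K)"
  have \<delta>: "\<delta> > 0" using cont(1) \<delta>1(1) K by (simp add: \<delta>_def)
  show ?thesis
  proof (intro exI[of _ \<delta>] conjI allI impI \<delta>)
    fix r assume r: "0 < r" "r \<le> \<delta>"
    have "r * (1 + K) \<le> min \<delta>0 \<delta>1" using r K by (simp add: \<delta>_def pos_le_divide_eq)
    moreover have "r * K \<ge> 0" using r K by simp
    ultimately have rK: "r \<le> \<delta>0" "r \<le> \<delta>1" "r * K \<le> \<delta>0" "r * K \<le> \<delta>1"
      using r by (auto simp: algebra_simps)
    have im: "norm (a - F r a) \<le> r * K" if a: "norm a \<le> r * K" for a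
    proof -
      have "norm (F r a - (r *\<^sub>R v + a)) \<le> \<epsilon> / (1 + K) * (r + norm a)"
        using \<delta>1(2) r rK a by auto
      also have "\<dots> \<le> \<epsilon> / (1 + K) * (r + r * K)" using a \<epsilon> K by (intro mult_left_mono) auto
      also have "\<dots> = \<epsilon> * r" using K by (simp add: field_simps)
      finally have "norm (F r a - (r *\<^sub>R v + a)) \<le> \<epsilon> * r" .
      moreover have "a - F r a = - (F r a - (r *\<^sub>R v + a)) - r *\<^sub>R v" by simp
      ultimately have "norm (a - F r a) \<le> \<epsilon> * r + norm (r *\<^sub>R v)"
        by (metis (no_types, lifting) add_right_mono norm_minus_cancel norm_triangle_ineq4 order_trans)
      then show ?thesis using r by (simp add: K_def algebra_simps)
    qed
    have "continuous_on (cball 0 (r * K)) (\<lambda>a. a - F r a)"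
      using rK by (intro continuous_intros continuous_on_subset[OF cont(2)] r) (auto intro!: subset_cball)
    moreover have "(\<lambda>a. a - F r a) \<in> cball 0 (r * K) \<rightarrow> cball 0 (r * K)"
      using im by auto
    ultimately obtain a where "a \<in> cball 0 (r * K)" "a - F r a = a"
      using r K brouwer_ball[of "r * K" 0 "\<lambda>a. a - F r a"] by auto
    then show "\<exists>a. norm a \<le> r * (norm v + \<epsilon>) \<and> F r a = 0"
      by (auto simp: K_def)
  qed
qed

text \<open>The first-order responses of admissible fields form a subspace; nondegeneracy conditions
  speak about covectors, and this turns them into surjectivity.\<close>

lemma subspace_eq_UNIV:
  fixes S :: "'a::euclidean_space set"
  assumes "subspace S" "\<And>l. (\<And>s. s \<in> S \<Longrightarrow> l \<bullet> s = 0) \<Longrightarrow> l = 0"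
  shows "S = UNIV"
proof (rule ccontr)
  assume "S \<noteq> UNIV"
  then have "span S \<subset> span UNIV" using assms(1) by (auto simp: span_eq_iff[THEN iffD2])
  then obtain x where "x \<noteq> 0" "x \<in> span UNIV" "\<And>y. y \<in> span S \<Longrightarrow> orthogonal x y"
    using orthogonal_to_subspace_exists_gen[of S UNIV] by metis
  then show False using assms(2)[of x] by (auto simp: orthogonal_def span_base)
qed

section \<open>Eigenvalue bounds as quadratic forms\<close>

lemma symmetric_inner: "transpose A = A \<Longrightarrow> x \<bullet> (A *v y) = (A *v x) \<bullet> y" for A :: "real ^ 'n ^ 'n"
  by (metis dot_lmul_matrix vector_transpose_matrix)

text \<open>A minimiser of the quadratic form on the unit sphere is an eigenvector.\<close>

lemma lambda_min_nonneg_imp_psd: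
  fixes M :: "real ^ 'n::finite ^ 'n"
  assumes sym: "transpose M = M" and lm: "lambda_min M \<ge> 0"
  shows "0 \<le> x \<bullet> (M *v x)"
proof -
  define Q where "Q = (\<lambda>x. x \<bullet> (M *v x))"
  have "continuous_on (sphere 0 1) Q"
    unfolding Q_def by (intro continuous_intros linear_continuous_on matrix_vector_mul_bounded_linear)
  moreover have "sphere (0 :: real ^ 'n) 1 \<noteq> {}" by (simp)
  ultimately obtain v where v: "norm v = 1" "\<And>y. norm y = 1 \<Longrightarrow> Q v \<le> Q y"
    using continuous_attains_inf[of "sphere 0 1" Q] by auto
  define e where "e = Q v"
  have ge: "e * (y \<bullet> y) \<le> Q y" for y
  proof (cases "y = 0")
    case False
    have "Q (t *\<^sub>R u) = t\<^sup>2 * Q u" for t u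
      by (simp add: Q_def matrix_vector_mult_scaleR power2_eq_square)
    from this[of "norm y" "y /\<^sub>R norm y"] have "Q y = (norm y)\<^sup>2 * Q (y /\<^sub>R norm y)"
      using False by simp
    moreover have "e \<le> Q (y /\<^sub>R norm y)" unfolding e_def using False by (intro v) simp
    ultimately show ?thesis by (simp add: power2_norm_eq_inner)
        (metis inner_ge_zero mult.commute mult_left_mono)
  qed (simp add: Q_def)
  \<comment> \<open>The defect of v as an eigenvector is half the gradient at v of the nonnegative
    form Q(y) - e |y|^2, which vanishes at v. Varying v in the direction of the defect must
    therefore produce no linear term.\<close>
  define w where "w = M *v v - e *\<^sub>R v"
  have Qw: "Q (v + t *\<^sub>R w) - e * ((v + t *\<^sub>R w) \<bullet> (v + t *\<^sub>R w)) = 2 * t * (w \<bullet> w) + t\<^sup>2 * (Q w - e * (w \<bullet> w))" for t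
  proof -
    have "Q (v + t *\<^sub>R w) = Q v + 2 * t * (w \<bullet> (M *v v)) + t\<^sup>2 * Q w"
      using symmetric_inner[OF sym, of v w] unfolding Q_def
      by (simp add: matrix_vector_right_distrib matrix_vector_mult_scaleR inner_add_left inner_add_right
          inner_commute[of "M *v v"] power2_eq_square algebra_simps)
    moreover have "v \<bullet> v = 1" using v(1) by (simp add: power2_norm_eq_inner[symmetric])
    moreover have "w \<bullet> (M *v v) = w \<bullet> w + e * (v \<bullet> w)"
      by (simp add: w_def inner_diff_left inner_diff_right inner_commute algebra_simps)
    ultimately show ?thesis
      by (simp add: e_def[symmetric] inner_add_left inner_add_right inner_commute power2_eq_square algebra_simps)
  qed
  have "w \<bullet> w = 0"
  proof (rule ccontr)
    assume "w \<bullet> w \<noteq> 0"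
    then have pos: "w \<bullet> w > 0" by (simp add: order_less_le)
    define c where "c = Q w - e * (w \<bullet> w)"
    have c: "c \<ge> 0" using ge[of w] by (simp add: c_def)
    \<comment> \<open>Negative and so small that the linear term 2 t |w|^2 outweighs c t^2; the 1 in
      c + 1 keeps the denominator positive when c = 0.\<close>
    define t where "t = - (w \<bullet> w) / (c + 1)"
    have "0 \<le> 2 * t * (w \<bullet> w) + t\<^sup>2 * c" using ge[of "v + t *\<^sub>R w"] Qw[of t] by (simp add: c_def)
    also have "\<dots> = t * (2 * (w \<bullet> w) + t * c)" by (simp add: power2_eq_square algebra_simps)
    finally have "0 \<le> t * (2 * (w \<bullet> w) + t * c)" .
    moreover have "t < 0" using pos c by (simp add: t_def divide_neg_pos)
    ultimately have "2 * (w \<bullet> w) + t * c \<le> 0" by (simp add: zero_le_mult_iff)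
    moreover have "- t * c \<le> w \<bullet> w" using pos c by (simp add: t_def field_simps)
    ultimately show False using pos by simp
  qed
  then have "M *v v = e *\<^sub>R v" by (simp add: w_def)
  moreover have "v \<noteq> 0" using v(1) by auto
  ultimately have "e \<in> eigenvalues M" by (auto simp: eigenvalues_def)
  moreover have "bdd_below (eigenvalues M)"
  proof (rule bdd_belowI[of _ e])
    fix l assume "l \<in> eigenvalues M"
    then obtain y where y: "y \<noteq> 0" "M *v y = l *\<^sub>R y" by (auto simp: eigenvalues_def)
    then have "e * (y \<bullet> y) \<le> l * (y \<bullet> y)" using ge[of y] by (simp add: Q_def)
    then show "e \<le> l" using y by (simp add: mult_le_cancel_right_pos)
  qed
  ultimately have "lambda_min M \<le> e" unfolding lambda_min_def by (rule cInf_lower)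
  then have "0 \<le> e * (x \<bullet> x)" using lm by simp
  then show ?thesis using ge[of x] by (simp add: Q_def)
qed

lemma mat_ge_coercive:
  fixes A :: "real ^ 'n::finite ^ 'n"
  assumes sym: "transpose A = A" and ge: "mat_ge A (mat c)"
  shows "c * (x \<bullet> x) \<le> x \<bullet> (A *v x)"
proof -
  have "transpose (A - mat c) = A - mat c"
    using sym by (simp add: transpose_def mat_def vec_eq_iff)
  then have "0 \<le> x \<bullet> ((A - mat c) *v x)"
    using ge by (intro lambda_min_nonneg_imp_psd) (auto simp: mat_ge_def)
  moreover have "mat c *v x = c *\<^sub>R x"
    by (simp add: vec_eq_iff matrix_vector_mult_def mat_def if_distrib[of "\<lambda>z. z * _"] cong: if_cong)
  ultimately show ?thesis by (simp add: matrix_vector_mult_diff_rdistrib inner_diff_right)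
qed

lemma coercive_norm_le:
  fixes A :: "real ^ 'n::finite ^ 'n"
  assumes "\<And>x. c * (x \<bullet> x) \<le> x \<bullet> (A *v x)"
  shows "c * norm x \<le> norm (A *v x)"
proof (cases "x = 0")
  case False
  have "c * norm x * norm x \<le> norm (A *v x) * norm x"
    using assms[of x] norm_cauchy_schwarz[of x "A *v x"]
    by (simp add: power2_norm_eq_inner[symmetric] power2_eq_square mult_ac)
  then show ?thesis using False by (simp add: mult_le_cancel_right_pos)
qed simp

text \<open>The inverse by Cramer's rule: unlike \<open>matrix_inv\<close> it is visibly a measurable function.\<close>

definition cramer_inv :: "real ^ 'n ^ 'n \<Rightarrow> real ^ 'n ^ ('n::finite)" where
  "cramer_inv A = (\<chi> k m. det (\<chi> i j. if j = k then axis m 1 $ i else A $ i $ j) / det A)"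

lemma cramer_inv_right: "det A \<noteq> 0 \<Longrightarrow> A ** cramer_inv A = mat 1"
proof -
  assume A: "det A \<noteq> 0"
  have "A *v column m (cramer_inv A) = axis m 1" for m
    using cramer[OF A, of "column m (cramer_inv A)" "axis m 1"]
    by (simp add: cramer_inv_def column_def)
  then show ?thesis
    by (simp add: vec_eq_iff matrix_matrix_mult_def matrix_vector_mult_def column_def mat_def axis_def)
qed

lemma cramer_inv_mult:
  assumes "det A \<noteq> 0"
  shows "A *v (cramer_inv A *v x) = x" "cramer_inv A *v (A *v x) = x"
  using cramer_inv_right[OF assms] matrix_left_right_inverse[of A "cramer_inv A"]
  by (simp_all add: matrix_vector_mul_assoc)

lemma coercive_det:
  fixes A :: "real ^ 'n::finite ^ 'n"
  assumes "\<And>x. c * (x \<bullet> x) \<le> x \<bullet> (A *v x)" "c > 0"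
  shows "det A \<noteq> 0"
proof -
  have "x = 0" if "A *v x = 0" for x
    using coercive_norm_le[OF assms(1), of x] that assms(2) by (simp add: mult_le_0_iff)
  then have "\<exists>B. B ** A = mat 1" by (simp add: matrix_left_invertible_ker)
  then show ?thesis using invertible_det_nz[of A] by (simp add: invertible_left_inverse)
qed

section \<open>Measurability of matrix operations and of the Cramer inverse\<close>

lemma borel_measurable_vec_iff:
  fixes f :: "'a \<Rightarrow> 'b::euclidean_space ^ 'n::finite"
  shows "f \<in> borel_measurable M \<longleftrightarrow> (\<forall>i. (\<lambda>x. f x $ i) \<in> borel_measurable M)"
proof
  assume [measurable]: "f \<in> borel_measurable M"
  have "(\<lambda>v :: 'b ^ 'n. v $ i) \<in> borel_measurable borel" for i
    by (intro borel_measurable_continuous_onI continuous_intros)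
  then show "\<forall>i. (\<lambda>x. f x $ i) \<in> borel_measurable M"
    by (intro allI measurable_compose[OF \<open>f \<in> borel_measurable M\<close>])
next
  assume *: "\<forall>i. (\<lambda>x. f x $ i) \<in> borel_measurable M"
  show "f \<in> borel_measurable M"
    unfolding borel_measurable_euclidean_space[of f]
  proof
    fix b :: "'b ^ 'n" assume "b \<in> Basis"
    then obtain i u where b: "b = axis i u" by (auto simp: Basis_vec_def)
    have [measurable]: "(\<lambda>x. f x $ i) \<in> borel_measurable M" using * by auto
    show "(\<lambda>x. f x \<bullet> b) \<in> borel_measurable M" by (simp add: b inner_axis)
  qed
qed

lemma measurable_vec_nth [measurable (raw)]:
  fixes f :: "'a \<Rightarrow> 'b::euclidean_space ^ 'n::finite"
  shows "f \<in> borel_measurable M \<Longrightarrow> (\<lambda>x. f x $ i) \<in> borel_measurable M"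
  by (simp add: borel_measurable_vec_iff)

lemma measurable_vec_lambda [measurable (raw)]:
  fixes f :: "'a \<Rightarrow> 'n::finite \<Rightarrow> 'b::euclidean_space"
  shows "(\<And>i. (\<lambda>x. f x i) \<in> borel_measurable M) \<Longrightarrow> (\<lambda>x. \<chi> i. f x i) \<in> borel_measurable M"
  by (simp add: borel_measurable_vec_iff)

lemma measurable_det [measurable (raw)]:
  fixes f :: "'a \<Rightarrow> real ^ 'n ^ 'n::finite"
  shows "f \<in> borel_measurable M \<Longrightarrow> (\<lambda>x. det (f x)) \<in> borel_measurable M"
  unfolding det_def by measurable

lemma measurable_cramer_inv [measurable (raw)]:
  fixes f :: "'a \<Rightarrow> real ^ 'n ^ 'n::finite"
  assumes [measurable]: "f \<in> borel_measurable M"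
  shows "(\<lambda>x. cramer_inv (f x)) \<in> borel_measurable M"
proof -
  have [measurable]: "(\<lambda>x. if j = k then axis m 1 $ i else f x $ i $ j) \<in> borel_measurable M" for i j k m
    by (cases "j = k") simp_all
  show ?thesis unfolding cramer_inv_def by measurable
qed

lemma measurable_matrix_vector_mult [measurable (raw)]:
  fixes f :: "'a \<Rightarrow> real ^ 'n::finite ^ 'm::finite"
  assumes [measurable]: "f \<in> borel_measurable M" "g \<in> borel_measurable M"
  shows "(\<lambda>x. f x *v g x) \<in> borel_measurable M"
  unfolding matrix_vector_mult_def by measurable

lemma measurable_matrix_matrix_mult [measurable (raw)]:
  fixes f :: "'a \<Rightarrow> real ^ 'n::finite ^ 'm::finite" and g :: "'a \<Rightarrow> real ^ 'l::finite ^ 'n"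
  assumes [measurable]: "f \<in> borel_measurable M" "g \<in> borel_measurable M"
  shows "(\<lambda>x. f x ** g x) \<in> borel_measurable M"
  unfolding matrix_matrix_mult_def by measurable

lemma measurable_transpose [measurable (raw)]:
  fixes f :: "'a \<Rightarrow> real ^ 'n::finite ^ 'm::finite"
  assumes [measurable]: "f \<in> borel_measurable M"
  shows "(\<lambda>x. transpose (f x)) \<in> borel_measurable M"
  unfolding transpose_def by measurable

text \<open>One competitor per r bounds the infimum from above; the slack \<epsilon> is removed only
  after passing to the limit, so the competitor may depend on it.\<close>

lemma Limsup_tdist_set_le:
  assumes "\<And>\<epsilon>. \<epsilon> > 0 \<Longrightarrow> \<exists>\<delta>>0. \<forall>r. 0 < r \<longrightarrow> r \<le> \<delta> \<longrightarrow> (\<exists>n\<in>U. tdist d p (M r) n \<le> r * (B + \<epsilon>))"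
  shows "Limsup (at_right 0) (\<lambda>r. ereal (1 / r) * tdist_set d p (M r) U) \<le> ereal B"
proof (rule ereal_le_epsilon2)
  fix \<epsilon> :: real assume "\<epsilon> > 0"
  then obtain \<delta> where \<delta>: "\<delta> > 0" "\<And>r. 0 < r \<Longrightarrow> r \<le> \<delta> \<Longrightarrow> \<exists>n\<in>U. tdist d p (M r) n \<le> r * (B + \<epsilon>)"
    using assms by blast
  have "eventually (\<lambda>r. ereal (1 / r) * tdist_set d p (M r) U \<le> ereal (B + \<epsilon>)) (at_right 0)"
    unfolding eventually_at_right_field
  proof (intro exI[of _ \<delta>] conjI allI impI \<delta>)
    fix r assume r: "0 < r" "r < \<delta>"
    then obtain n where n: "n \<in> U" "tdist d p (M r) n \<le> r * (B + \<epsilon>)" using \<delta>(2)[of r] by auto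
    have "tdist_set d p (M r) U \<le> ereal (tdist d p (M r) n)"
      unfolding tdist_set_def by (rule INF_lower) (rule n)
    also have "\<dots> \<le> ereal (r * (B + \<epsilon>))" using n by simp
    finally have "ereal (1 / r) * tdist_set d p (M r) U \<le> ereal (1 / r) * ereal (r * (B + \<epsilon>))"
      using r by (intro ereal_mult_left_mono) auto
    then show "ereal (1 / r) * tdist_set d p (M r) U \<le> ereal (B + \<epsilon>)" using r by simp
  qed
  then show "Limsup (at_right 0) (\<lambda>r. ereal (1 / r) * tdist_set d p (M r) U) \<le> ereal B + ereal \<epsilon>"
    by (simp add: Limsup_bounded)
qed

section \<open>Perturbation families and the Wasserstein case\<close>

lemma prob_momentD:
  assumes "m \<in> prob_moment p"
  shows "prob_space m" "sets m = sets borel" "space m = UNIV" "integrable m (\<lambda>x. norm x powr p)"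
  using assms by (auto simp: prob_moment_def space_UNIV_of_sets_borel)

lemma prob_moment_measurable_eq:
  "m \<in> prob_moment p \<Longrightarrow> borel_measurable m = borel_measurable borel"
  by (auto simp: prob_moment_def cong: measurable_cong_sets)

lemma distr_borel_ident: "sets m = sets borel \<Longrightarrow> distr m borel (\<lambda>x. x) = m"
  by (intro distr_id2) simp

lemma push_in_prob_moment:
  fixes m :: "'d::finite path measure"
  assumes m: "m \<in> prob_moment p" and T: "T \<in> borel_measurable borel" "AE x in m. norm (T x) \<le> b" and p: "p > 1"
  shows "push m T \<in> prob_moment p"
proof -
  note m' = prob_momentD[OF m] and [simp] = prob_moment_measurable_eq[OF m]
  interpret prob_space m by fact
  have "integrable m (\<lambda>x. norm (x + T x) powr p)"
    using p T by (intro integrable_powr_add m'(4) integrable_powr_of_AE_bound[OF _ T(2)]) auto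
  then show ?thesis
    unfolding push_def using T by (intro distr_in_prob_moment m'(1)) auto
qed

text \<open>Shared by both distances. The family must be bounded and Lipschitz in a, respect the
  constraint exactly, and have first-order response r v + a. A zero in a of \<phi> along the family
  then has |a| \<le> r (|v| + \<epsilon>'), and the assumed distance bound turns this size into the
  limsup estimate.\<close>

lemma Limsup_tdist_set_le_of_family:
  fixes \<mu> :: "'d::finite path measure"
    and \<phi> :: "'d path measure \<Rightarrow> real ^ 'k::finite"
    and T :: "real \<Rightarrow> real ^ 'k \<Rightarrow> 'd path \<Rightarrow> 'd path"
  assumes p: "p > 1" and \<mu>: "\<mu> \<in> prob_moment p" and R: "condition_R p \<phi> D" and \<phi>0: "\<phi> \<mu> = 0"
    and K: "K > 0" and \<delta>0: "\<delta>0 > 0"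
    and meas: "\<And>r a. 0 < r \<Longrightarrow> r \<le> \<delta>0 \<Longrightarrow> norm a \<le> \<delta>0 \<Longrightarrow> T r a \<in> borel_measurable borel"
    and bound: "\<And>r a. 0 < r \<Longrightarrow> r \<le> \<delta>0 \<Longrightarrow> norm a \<le> \<delta>0 \<Longrightarrow> AE x in \<mu>. norm (T r a x) \<le> K * (r + norm a)"
    and lip: "\<And>r a a'. 0 < r \<Longrightarrow> r \<le> \<delta>0 \<Longrightarrow> norm a \<le> \<delta>0 \<Longrightarrow> norm a' \<le> \<delta>0 \<Longrightarrow>
      AE x in \<mu>. norm (T r a x - T r a' x) \<le> K * norm (a - a')"
    and lin: "\<And>e. e > 0 \<Longrightarrow> \<exists>\<delta>>0. \<forall>r a. 0 < r \<longrightarrow> r \<le> \<delta> \<longrightarrow> norm a \<le> \<delta> \<longrightarrow>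
      norm ((\<integral>x. blk_app (dx (D \<mu>) x) (T r a x) \<partial>\<mu>) - (r *\<^sub>R v + a)) \<le> e * (r + norm a)"
    and perp: "\<And>r a. 0 < r \<Longrightarrow> r \<le> \<delta>0 \<Longrightarrow> norm a \<le> \<delta>0 \<Longrightarrow> push \<mu> (T r a) \<in> test_perp p \<psi>"
    and dist: "\<And>e. e > 0 \<Longrightarrow> \<exists>\<delta>>0. \<forall>r a. 0 < r \<longrightarrow> r \<le> \<delta> \<longrightarrow> norm a \<le> \<delta> \<longrightarrow>
      tdist d p (M r) (push \<mu> (T r a)) \<le> K * norm a + r * B + e * (r + norm a)"
  shows "Limsup (at_right 0) (\<lambda>r. ereal (1 / r) * tdist_set d p (M r) (zero_set p \<phi> \<inter> test_perp p \<psi>))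
    \<le> ereal (K * norm v + B)"
proof (rule Limsup_tdist_set_le)
  fix \<epsilon> :: real assume \<epsilon>: "\<epsilon> > 0"
  note \<mu>' = prob_momentD[OF \<mu>] and [simp] = prob_moment_measurable_eq[OF \<mu>]
  interpret prob_space \<mu> by fact
  define F where "F = (\<lambda>r a. \<phi> (push \<mu> (T r a)))"
  have exp: "\<exists>\<delta>>0. \<forall>r a. 0 < r \<longrightarrow> r \<le> \<delta> \<longrightarrow> norm a \<le> \<delta> \<longrightarrow>
      norm (F r a - (r *\<^sub>R v + a)) \<le> e * (r + norm a)" if e: "e > 0" for e
  proof -
    \<comment> \<open>The displacement is bounded by K (r + |a|), so the expansion is applied with
      accuracy divided by K; the other half of e is left for the deviation of the response from r v
      + a.\<close>
    have "e / 2 / K > 0" using e K by simp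
    from condition_R_expansion[OF R p \<mu>'(1) _ _ this, of "\<lambda>x. x"] \<mu>'(4)
    obtain \<delta>1 where \<delta>1: "\<delta>1 > 0" "\<And>Y b. Y \<in> borel_measurable borel \<Longrightarrow> 0 < b \<Longrightarrow> b \<le> \<delta>1 \<Longrightarrow>
        (AE x in \<mu>. norm (Y x) \<le> b) \<Longrightarrow>
        norm (\<phi> (push \<mu> Y) - (\<integral>x. blk_app (dx (D \<mu>) x) (Y x) \<partial>\<mu>)) \<le> e / 2 / K * b"
      by (auto simp: push_def distr_borel_ident[OF \<mu>'(2)] \<phi>0)
    have "e / 2 > 0" using e by simp
    from lin[OF this] obtain \<delta>2 where \<delta>2: "\<delta>2 > 0" "\<And>r a. 0 < r \<Longrightarrow> r \<le> \<delta>2 \<Longrightarrow> norm a \<le> \<delta>2 \<Longrightarrow>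
      norm ((\<integral>x. blk_app (dx (D \<mu>) x) (T r a x) \<partial>\<mu>) - (r *\<^sub>R v + a)) \<le> e / 2 * (r + norm a)" by blast
    define \<delta> where "\<delta> = min \<delta>0 (min \<delta>2 (\<delta>1 / (2 * K)))"
    have \<delta>: "\<delta> > 0" using \<delta>0 \<delta>1 \<delta>2 K by (simp add: \<delta>_def)
    show ?thesis
    proof (intro exI[of _ \<delta>] conjI allI impI \<delta>)
      fix r a assume r: "0 < r" "r \<le> \<delta>" and a: "norm (a :: real ^ 'k) \<le> \<delta>"
      have le: "r \<le> \<delta>0" "norm a \<le> \<delta>0" "r \<le> \<delta>2" "norm a \<le> \<delta>2" using r a by (auto simp: \<delta>_def)
      have "r + norm a \<le> \<delta>1 / K" using r a K by (simp add: \<delta>_def field_simps)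
      then have b: "K * (r + norm a) \<le> \<delta>1" using K by (simp add: field_simps)
      have "0 < r + norm a" using r by (simp add: add_pos_nonneg)
      then have b0: "0 < K * (r + norm a)" using K by simp
      have "norm (F r a - (\<integral>x. blk_app (dx (D \<mu>) x) (T r a x) \<partial>\<mu>)) \<le> e / 2 / K * (K * (r + norm a))"
        unfolding F_def by (intro \<delta>1(2) meas bound r le b b0)
      also have "\<dots> = e / 2 * (r + norm a)" using K by simp
      finally have "norm (F r a - (\<integral>x. blk_app (dx (D \<mu>) x) (T r a x) \<partial>\<mu>)) \<le> e / 2 * (r + norm a)" .
      then have "norm ((F r a - (\<integral>x. blk_app (dx (D \<mu>) x) (T r a x) \<partial>\<mu>)) +
          ((\<integral>x. blk_app (dx (D \<mu>) x) (T r a x) \<partial>\<mu>) - (r *\<^sub>R v + a))) \<le> e / 2 * (r + norm a) + e / 2 * (r + norm a)"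
        by (intro norm_triangle_mono \<delta>2(2) r le)
      moreover have "(F r a - (\<integral>x. blk_app (dx (D \<mu>) x) (T r a x) \<partial>\<mu>)) +
          ((\<integral>x. blk_app (dx (D \<mu>) x) (T r a x) \<partial>\<mu>) - (r *\<^sub>R v + a)) = F r a - (r *\<^sub>R v + a)"
        by (simp add: algebra_simps)
      ultimately show "norm (F r a - (r *\<^sub>R v + a)) \<le> e * (r + norm a)" by simp
    qed
  qed
  have cont: "continuous_on (cball 0 \<delta>0) (F r)" if r: "0 < r" "r \<le> \<delta>0" for r
    unfolding continuous_on_iff
  proof (intro ballI allI impI)
    fix a :: "real ^ 'k" and e :: real assume "a \<in> cball 0 \<delta>0" and e: "0 < e"
    then have a: "norm a \<le> \<delta>0" by simp
    \<comment> \<open>Continuity is required at the law of X + T r a: this displaced variable is the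
      base point, and T r a' - T r a is the small displacement.\<close>
    have i: "integrable \<mu> (\<lambda>x. norm (x + T r a x) powr p)"
      using p meas[OF r a]
      by (intro integrable_powr_add \<mu>'(4) integrable_powr_of_AE_bound[OF _ bound[OF r a]]) auto
    from condition_R_continuous[OF R p \<mu>'(1) _ i e] meas[OF r a]
    obtain \<delta> where \<delta>: "\<delta> > 0" "\<And>Y. Y \<in> borel_measurable borel \<Longrightarrow> (AE x in \<mu>. norm (Y x) \<le> \<delta>) \<Longrightarrow>
      norm (\<phi> (distr \<mu> borel (\<lambda>x. x + T r a x + Y x)) - F r a) < e"
      by (auto simp: F_def push_def)
    show "\<exists>\<delta>>0. \<forall>a'\<in>cball 0 \<delta>0. dist a' a < \<delta> \<longrightarrow> dist (F r a') (F r a) < e"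
    proof (intro exI[of _ "\<delta> / K"] conjI ballI impI)
      fix a' :: "real ^ 'k" assume "a' \<in> cball 0 \<delta>0" and d: "dist a' a < \<delta> / K"
      then have a': "norm a' \<le> \<delta>0" by simp
      have "K * norm (a' - a) \<le> \<delta>" using d K by (simp add: dist_norm field_simps)
      then have "AE x in \<mu>. norm (T r a' x - T r a x) \<le> \<delta>"
        by (intro eventually_mono[OF lip[OF r a' a]]) (rule order_trans)
      then have "norm (\<phi> (distr \<mu> borel (\<lambda>x. x + T r a x + (T r a' x - T r a x))) - F r a) < e"
        using meas[OF r a] meas[OF r a'] by (intro \<delta>(2)) auto
      then show "dist (F r a') (F r a) < e" by (simp add: dist_norm F_def push_def)
    qed (use \<delta> K in simp)
  qed
  \<comment> \<open>The slack \<epsilon> is split in two halves: K \<epsilon>' from the size of a,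
    and e (2 + |v|) from the distance error. The cap \<epsilon>' \<le> 1 gives r + |a| \<le> r (2 +
    |v|), which also explains the divisor in the threshold \<delta> below.\<close>
  define \<epsilon>' where "\<epsilon>' = min 1 (\<epsilon> / (2 * K))"
  have \<epsilon>': "\<epsilon>' > 0" "\<epsilon>' \<le> 1" "K * \<epsilon>' \<le> \<epsilon> / 2" using \<epsilon> K by (auto simp: \<epsilon>'_def min_def field_simps)
  define e where "e = \<epsilon> / (2 * (2 + norm v))"
  have nv: "0 < 2 + norm v" by (simp add: add_pos_nonneg)
  then have e: "e > 0" "e * (2 + norm v) = \<epsilon> / 2" using \<epsilon> by (auto simp: e_def field_simps)
  obtain \<delta>1 where \<delta>1: "\<delta>1 > 0" "\<And>r. 0 < r \<Longrightarrow> r \<le> \<delta>1 \<Longrightarrow> (\<exists>a. norm a \<le> r * (norm v + \<epsilon>') \<and> F r a = 0)"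
    using zero_near_of_first_order_expansion[OF exp \<delta>0 cont \<epsilon>'(1)] by blast
  obtain \<delta>2 where \<delta>2: "\<delta>2 > 0" "\<And>r a. 0 < r \<Longrightarrow> r \<le> \<delta>2 \<Longrightarrow> norm a \<le> \<delta>2 \<Longrightarrow>
      tdist d p (M r) (push \<mu> (T r a)) \<le> K * norm a + r * B + e * (r + norm a)"
    using dist[OF e(1)] by blast
  define \<delta> where "\<delta> = min \<delta>1 (min \<delta>0 \<delta>2 / (2 + norm v))"
  have \<delta>: "\<delta> > 0" using \<delta>0 \<delta>1 \<delta>2 nv by (simp add: \<delta>_def)
  show "\<exists>\<delta>>0. \<forall>r. 0 < r \<longrightarrow> r \<le> \<delta> \<longrightarrow> (\<exists>n\<in>zero_set p \<phi> \<inter> test_perp p \<psi>.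
      tdist d p (M r) n \<le> r * (K * norm v + B + \<epsilon>))"
  proof (intro exI[of _ \<delta>] conjI allI impI \<delta>)
    fix r assume r: "0 < r" "r \<le> \<delta>"
    then obtain a where a: "norm a \<le> r * (norm v + \<epsilon>')" "F r a = 0" using \<delta>1(2)[of r] by (auto simp: \<delta>_def)
    have "r * (2 + norm v) \<le> min \<delta>0 \<delta>2" using r nv by (simp add: \<delta>_def pos_le_divide_eq)
    moreover have "r * (norm v + \<epsilon>') \<le> r * (2 + norm v)" using r \<epsilon>' by (intro mult_left_mono) auto
    moreover have "r * 1 \<le> r * (2 + norm v)" using r by (intro mult_left_mono) auto
    ultimately have le: "r \<le> \<delta>0" "r \<le> \<delta>2" "norm a \<le> \<delta>0" "norm a \<le> \<delta>2" using a by auto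
    have T: "push \<mu> (T r a) \<in> zero_set p \<phi> \<inter> test_perp p \<psi>"
      using perp[OF r(1) le(1,3)] a(2) by (auto simp: zero_set_def test_perp_def F_def)
    have "tdist d p (M r) (push \<mu> (T r a)) \<le> K * norm a + r * B + e * (r + norm a)"
      by (intro \<delta>2(2) r le)
    also have "\<dots> \<le> K * (r * (norm v + \<epsilon>')) + r * B + e * (r + r * (norm v + 1))"
    proof (intro add_mono mult_left_mono a(1) order_refl)
      show "norm a \<le> r * (norm v + 1)" using \<epsilon>'(2) r
        by (intro order_trans[OF a(1)] mult_left_mono) auto
    qed (use K e r in auto)
    also have "\<dots> = r * (K * norm v + B + (K * \<epsilon>' + e * (2 + norm v)))"
      by (simp add: algebra_simps)
    also have "\<dots> \<le> r * (K * norm v + B + \<epsilon>)" using r \<epsilon>'(3) e(2) by (intro mult_left_mono) auto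
    finally show "\<exists>n\<in>zero_set p \<phi> \<inter> test_perp p \<psi>. tdist d p (M r) n \<le> r * (K * norm v + B + \<epsilon>)"
      using T by blast
  qed
qed

lemma bounded_of_compact_support:
  fixes f :: "'a::topological_space \<Rightarrow> 'b::real_normed_vector"
  assumes "continuous_on UNIV f" "compact (closure {x. f x \<noteq> 0})"
  shows "\<exists>b>0. \<forall>x. norm (f x) \<le> b"
proof -
  have "compact (f ` closure {x. f x \<noteq> 0})"
    using assms by (intro compact_continuous_image continuous_on_subset[OF assms(1)]) auto
  then obtain b where b: "b > 0" "\<And>y. y \<in> f ` closure {x. f x \<noteq> 0} \<Longrightarrow> norm y \<le> b"
    using compact_imp_bounded bounded_pos by metis
  have "norm (f x) \<le> b" for x
  proof (cases "f x = 0")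
    case False
    then have "x \<in> closure {x. f x \<noteq> 0}" using closure_subset by fast
    then show ?thesis by (intro b) auto
  qed (use b in auto)
  then show ?thesis using b(1) by blast
qed

lemma C1_imp_continuous_on: "C1 f \<Longrightarrow> continuous_on UNIV f"
  unfolding C1_def by (meson continuous_at_imp_continuous_on has_derivative_continuous)

section \<open>Nondegeneracy by duality in the Wasserstein case\<close>

lemma inner_blk_app:
  fixes A :: "('d::finite, 'k::finite) blocks"
  shows "l \<bullet> blk_app A v = blk_tapp A l \<bullet> v"
proof -
  have "l \<bullet> (B *v y) = (transpose B *v l) \<bullet> y" for B :: "real ^ 'd ^ 'k" and y
    by (metis dot_lmul_matrix vector_transpose_matrix transpose_transpose)
  then show ?thesis by (simp add: blk_app_def blk_tapp_def inner_add_right inner_prod_def)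
qed

lemma inner_blk_mult_t: "l \<bullet> (blk_mult_t A A *v l) = (norm (blk_tapp A l))\<^sup>2"
proof -
  have "blk_mult_t A A *v l = blk_app A (blk_tapp A l)"
    by (simp add: blk_mult_t_def blk_app_def blk_tapp_def matrix_vector_mult_add_rdistrib
        matrix_vector_mul_assoc del: transpose_matrix_vector)
  then show ?thesis by (simp add: inner_blk_app power2_norm_eq_inner)
qed

lemma measurable_blk_tapp [measurable (raw)]:
  assumes "f \<in> borel_measurable M" "g \<in> borel_measurable M"
  shows "(\<lambda>x. blk_tapp (f x :: ('d::finite, 'k::finite) blocks) (g x)) \<in> borel_measurable M"
  unfolding blk_tapp_def using assms by measurable

lemma norm_sum_scaleR_le:
  fixes a :: "real ^ 'k::finite" and f :: "'k \<Rightarrow> 'b::real_normed_vector"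
  assumes "\<And>i. norm (f i) \<le> b"
  shows "norm (\<Sum>i\<in>UNIV. a $ i *\<^sub>R f i) \<le> real CARD('k) * b * norm a"
proof -
  have "norm (\<Sum>i\<in>UNIV. a $ i *\<^sub>R f i) \<le> (\<Sum>i::'k\<in>UNIV. norm a * b)"
    using assms component_le_norm_cart[of a]
    by (intro order_trans[OF norm_sum] sum_mono) (auto intro!: mult_mono)
  then show ?thesis by (simp add: mult_ac)
qed

lemma integral_quadratic_form:
  fixes M :: "'a \<Rightarrow> real ^ 'k::finite ^ 'k"
  assumes "integrable P M"
  shows "l \<bullet> ((\<integral>x. M x \<partial>P) *v l) = (\<integral>x. l \<bullet> (M x *v l) \<partial>P)"
proof -
  have "bounded_linear (\<lambda>A :: real ^ 'k ^ 'k. l \<bullet> (A *v l))"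
    unfolding linear_conv_bounded_linear[symmetric]
    by (auto intro!: linearI simp: matrix_vector_mult_add_rdistrib inner_add_right scaleR_matrix_vector_assoc[symmetric])
  from integral_bounded_linear[OF this assms] show ?thesis by simp
qed

text \<open>Symmetry is what allows \<open>lambda_min\<close> to be read as a bound on the quadratic
  form. The default value of a divergent integral is zero and hence symmetric as well.\<close>

lemma transpose_integral:
  fixes M :: "'a \<Rightarrow> real ^ 'k::finite ^ 'k"
  assumes "\<And>x. transpose (M x) = M x"
  shows "transpose (\<integral>x. M x \<partial>P) = (\<integral>x. M x \<partial>P)"
proof (cases "integrable P M")
  case True
  have "bounded_linear (transpose :: real ^ 'k ^ 'k \<Rightarrow> real ^ 'k ^ 'k)"
    unfolding linear_conv_bounded_linear[symmetric]
    by (auto intro!: linearI simp: transpose_def vec_eq_iff)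
  from integral_bounded_linear[OF this True] show ?thesis unfolding assms by (rule sym)
qed (simp add: not_integrable_integral_eq transpose_def vec_eq_iff zero_vec_def)

text \<open>Let l annihilate the responses of all bounded fields. Testing with a bounded field
  parallel to g = (\<partial>D)^T l shows g = 0 almost surely; then the quadratic form of the matrix
  in the condition vanishes at l, and its lower bound c forces l = 0.\<close>

lemma cond_A_W_nondegenerate:
  fixes \<mu> :: "'d::finite path measure" and D :: "'d path \<Rightarrow> real ^ 'k::finite"
  assumes A: "cond_A_W p \<mu> D \<psi>" and D: "integrable \<mu> (dx D)" and sets: "sets \<mu> = sets borel"
  shows "\<exists>\<eta>\<in>borel_measurable borel. (\<exists>b. \<forall>x. norm (\<eta> x) \<le> b) \<and> (\<integral>x. blk_app (dx D x) (\<eta> x) \<partial>\<mu>) = w"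
proof -
  define H where "H = {\<eta> \<in> borel_measurable (borel :: 'd path measure). \<exists>b. \<forall>x. norm (\<eta> x :: 'd path) \<le> b}"
  define S where "S = (\<lambda>\<eta>. \<integral>x. blk_app (dx D x) (\<eta> x) \<partial>\<mu>) ` H"
  have meas: "borel_measurable \<mu> = borel_measurable borel" using sets by (auto cong: measurable_cong_sets)
  have [measurable]: "dx D \<in> borel_measurable \<mu>" using D by auto
  have i: "integrable \<mu> (\<lambda>x. blk_app (dx D x) (\<eta> x))" if "\<eta> \<in> H" for \<eta>
  proof -
    obtain b where "\<And>x. norm (\<eta> x) \<le> b" "\<eta> \<in> borel_measurable borel" using \<open>\<eta> \<in> H\<close> unfolding H_def by blast
    then show ?thesis by (intro integrable_blk_app_bounded[OF D, where b=b]) (auto simp: meas)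
  qed
  have HI: "f \<in> H" if "f \<in> borel_measurable borel" "\<And>x. norm (f x) \<le> b" for f b
    using that unfolding H_def by blast
  have Hm: "f \<in> borel_measurable borel" if "f \<in> H" for f using that unfolding H_def by blast
  have SI: "(\<integral>x. blk_app (dx D x) (f x) \<partial>\<mu>) \<in> S" if "f \<in> H" for f
    unfolding S_def using imageI[OF that] .
  have "subspace S"
    unfolding subspace_def
  proof (intro conjI ballI allI)
    have "(\<lambda>_. 0) \<in> H" by (auto simp: H_def)
    from SI[OF this] show "0 \<in> S" by (simp add: blk_app.zero_right)
    fix x assume "x \<in> S"
    then obtain \<eta>1 where 1: "x = (\<integral>x. blk_app (dx D x) (\<eta>1 x) \<partial>\<mu>)" "\<eta>1 \<in> H" by (auto simp: S_def)
    { fix y assume "y \<in> S"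
      then obtain \<eta>2 where 2: "y = (\<integral>x. blk_app (dx D x) (\<eta>2 x) \<partial>\<mu>)" "\<eta>2 \<in> H" by (auto simp: S_def)
      obtain b1 b2 where "\<And>x. norm (\<eta>1 x) \<le> b1" "\<And>x. norm (\<eta>2 x) \<le> b2"
        using 1(2) 2(2) unfolding H_def by blast
      then have "norm (\<eta>1 x + \<eta>2 x) \<le> b1 + b2" for x by (intro norm_triangle_mono)
      then have "(\<lambda>x. \<eta>1 x + \<eta>2 x) \<in> H" using Hm[OF 1(2)] Hm[OF 2(2)] by (intro HI) measurable
      from SI[OF this] have "(\<integral>x. blk_app (dx D x) (\<eta>1 x + \<eta>2 x) \<partial>\<mu>) \<in> S" .
      moreover have "x + y = (\<integral>x. blk_app (dx D x) (\<eta>1 x + \<eta>2 x) \<partial>\<mu>)"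
        unfolding 1(1) 2(1) blk_app.add_right
        by (rule Bochner_Integration.integral_add[symmetric]) (rule i[OF 1(2)], rule i[OF 2(2)])
      ultimately show "x + y \<in> S" by simp }
    { fix c :: real
      obtain b where "\<And>x. norm (\<eta>1 x) \<le> b" using 1(2) unfolding H_def by blast
      then have "norm (c *\<^sub>R \<eta>1 x) \<le> \<bar>c\<bar> * b" for x by (simp add: mult_left_mono)
      then have "(\<lambda>x. c *\<^sub>R \<eta>1 x) \<in> H" using Hm[OF 1(2)] by (intro HI) measurable
      from SI[OF this] have "(\<integral>x. blk_app (dx D x) (c *\<^sub>R \<eta>1 x) \<partial>\<mu>) \<in> S" .
      moreover have "c *\<^sub>R x = (\<integral>x. blk_app (dx D x) (c *\<^sub>R \<eta>1 x) \<partial>\<mu>)"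
        by (simp add: 1(1) blk_app.scaleR_right)
      ultimately show "c *\<^sub>R x \<in> S" by simp }
  qed
  moreover have "l = 0" if orth: "\<And>s. s \<in> S \<Longrightarrow> l \<bullet> s = 0" for l
  proof -
    define g where "g = (\<lambda>x. blk_tapp (dx D x) l)"
    have [measurable]: "g \<in> borel_measurable \<mu>" unfolding g_def by measurable
    \<comment> \<open>The denominator makes the field bounded, while its pairing with g stays
      positive wherever g is nonzero. The field g itself may be unbounded and is only known to be
      integrable.\<close>
    define \<eta> where "\<eta> = (\<lambda>x. g x /\<^sub>R (1 + norm (g x)))"
    have n: "0 < 1 + norm (g x)" for x by (simp add: add_pos_nonneg)
    have key: "l \<bullet> blk_app (dx D x) (\<eta> x) = (norm (g x))\<^sup>2 / (1 + norm (g x))" for x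
      unfolding inner_blk_app power2_norm_eq_inner by (simp add: \<eta>_def g_def divide_inverse mult.commute)
    have "norm (\<eta> x) \<le> 1" for x using n[of x] by (simp add: \<eta>_def field_simps)
    moreover have "\<eta> \<in> borel_measurable \<mu>" unfolding \<eta>_def by measurable
    ultimately have \<eta>: "\<eta> \<in> H" by (auto simp: H_def meas)
    have "0 = l \<bullet> (\<integral>x. blk_app (dx D x) (\<eta> x) \<partial>\<mu>)" using orth \<eta> by (auto simp: S_def)
    also have "\<dots> = (\<integral>x. l \<bullet> blk_app (dx D x) (\<eta> x) \<partial>\<mu>)" using i[OF \<eta>] by simp
    also have "\<dots> = (\<integral>x. (norm (g x))\<^sup>2 / (1 + norm (g x)) \<partial>\<mu>)"
      by (simp add: key)
    finally have "(\<integral>x. (norm (g x))\<^sup>2 / (1 + norm (g x)) \<partial>\<mu>) = 0" by simp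
    moreover have "integrable \<mu> (\<lambda>x. (norm (g x))\<^sup>2 / (1 + norm (g x)))"
      using integrable_inner_right[OF i[OF \<eta>], of l]
      by (simp add: key)
    ultimately have "AE x in \<mu>. (norm (g x))\<^sup>2 / (1 + norm (g x)) = 0"
      by (subst (asm) integral_nonneg_eq_0_iff_AE) auto
    then have g0: "AE x in \<mu>. g x = 0"
    proof (rule eventually_mono)
      fix x assume "(norm (g x))\<^sup>2 / (1 + norm (g x)) = 0"
      then show "g x = 0" using n[of x] by simp
    qed
    define M where "M = (\<lambda>x. blk_mult_t (dx D x) (dx D x) /\<^sub>R (norm (dx D x) powr (2 - conj_exp p)))"
    obtain c where c: "c > 0" "mat_ge (\<integral>x. M x \<partial>\<mu>) (mat c)"
      using A by (auto simp: cond_A_W_def M_def)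
    have "transpose (blk_mult_t (dx D x) (dx D x)) = blk_mult_t (dx D x) (dx D x)" for x
      by (simp add: blk_mult_t_def vec_eq_iff transpose_def matrix_matrix_mult_def mult.commute)
    then have "transpose (M x) = M x" for x
      by (simp add: M_def transpose_def vec_eq_iff)
    then have le: "c * (l \<bullet> l) \<le> l \<bullet> ((\<integral>x. M x \<partial>\<mu>) *v l)"
      by (intro mat_ge_coercive transpose_integral c)
    \<comment> \<open>If M is not integrable, its integral is zero by convention and the claim is
      immediate.\<close>
    have "l \<bullet> ((\<integral>x. M x \<partial>\<mu>) *v l) = 0"
    proof (cases "integrable \<mu> M")
      case True
      have "l \<bullet> (M x *v l) = (norm (g x))\<^sup>2 / (norm (dx D x) powr (2 - conj_exp p))" for x
        by (simp add: M_def scaleR_matrix_vector_assoc[symmetric] inner_blk_mult_t g_def divide_inverse mult_ac)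
      then have "AE x in \<mu>. l \<bullet> (M x *v l) = 0"
        by (intro eventually_mono[OF g0]) simp
      then show ?thesis unfolding integral_quadratic_form[OF True] by (rule integral_eq_zero_AE)
    qed (simp add: not_integrable_integral_eq)
    then have "c * (l \<bullet> l) \<le> 0" using le by simp
    then have "l \<bullet> l \<le> 0" using c by (simp add: mult_le_0_iff)
    then show "l = 0" by (metis inner_eq_zero_iff inner_ge_zero order_antisym)
  qed
  ultimately have "S = UNIV" by (rule subspace_eq_UNIV)
  then have "w \<in> S" by simp
  then obtain \<eta> where "w = (\<integral>x. blk_app (dx D x) (\<eta> x) \<partial>\<mu>)" "\<eta> \<in> H"
    unfolding S_def by (rule imageE)
  then show ?thesis unfolding H_def by (intro bexI[of _ \<eta>]) auto
qed

lemma test_perp_zero: "(\<And>x. \<psi> x = 0) \<Longrightarrow> test_perp p \<psi> = prob_moment p"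
  by (auto simp: test_perp_def test_funs_def)

text \<open>Here T is affine in (r, a) and its response equals r v + a without error. The law of X +
  r \<Theta> and the corrected one are coupled through the same X, so only the correction \<Sum> a_i
  \<eta>_i is transported and B = 0.\<close>

lemma Limsup_wasserstein_le:
  fixes \<mu> :: "'d::finite path measure" and \<phi> :: "'d path measure \<Rightarrow> real ^ 'k::finite"
    and \<psi> :: "'d path \<Rightarrow> real ^ 'l::finite"
  assumes p: "p > 1" and \<mu>: "\<mu> \<in> prob_moment p" and R: "condition_R p \<phi> D" and \<phi>0: "\<phi> \<mu> = 0"
    and A: "cond_A_W p \<mu> (D \<mu>) \<psi>" and \<Theta>: "\<Theta> \<in> borel_measurable borel" "\<And>x. norm (\<Theta> x) \<le> t"
  shows "\<exists>C>0. Limsup (at_right 0)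
      (\<lambda>r. ereal (1 / r) * tdist_set W p (push \<mu> (\<lambda>x. r *\<^sub>R \<Theta> x)) (zero_set p \<phi> \<inter> test_perp p \<psi>))
    \<le> ereal (C * norm (\<integral>x. blk_app (dx (D \<mu>) x) (\<Theta> x) \<partial>\<mu>))"
proof -
  note \<mu>' = prob_momentD[OF \<mu>] and [simp] = prob_moment_measurable_eq[OF \<mu>]
  interpret prob_space \<mu> by fact
  have iD: "integrable \<mu> (dx (D \<mu>))"
    using integrable_dx[OF R p \<mu>'(1) \<mu> _ \<mu>'(4)] by simp
  have "\<forall>i. \<exists>\<eta>. \<eta> \<in> borel_measurable borel \<and> (\<exists>b. \<forall>x. norm (\<eta> x) \<le> b) \<and>
      (\<integral>x. blk_app (dx (D \<mu>) x) (\<eta> x) \<partial>\<mu>) = axis i 1"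
    using cond_A_W_nondegenerate[OF A iD \<mu>'(2)] by (meson)
  from choice[OF this] obtain \<eta> where \<eta>': "\<forall>i. \<eta> i \<in> borel_measurable borel \<and>
      (\<exists>b. \<forall>x. norm (\<eta> i x) \<le> b) \<and> (\<integral>x. blk_app (dx (D \<mu>) x) (\<eta> i x) \<partial>\<mu>) = axis i 1"
    by (rule exE)
  then have \<eta>: "\<eta> i \<in> borel_measurable borel"
    "(\<integral>x. blk_app (dx (D \<mu>) x) (\<eta> i x) \<partial>\<mu>) = axis i 1" for i by simp_all
  have "\<forall>i. \<exists>b. \<forall>x. norm (\<eta> i x) \<le> b" using \<eta>' by simp
  from choice[OF this] obtain b' where b': "\<forall>i x. norm (\<eta> i x) \<le> b' i" by (rule exE)
  define b where "b = Max (range b')"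
  have "b' i \<le> b" for i unfolding b_def by (rule Max_ge) auto
  then have b: "norm (\<eta> i x) \<le> b" for i x
    using b' order_trans by blast
  define v where "v = (\<integral>x. blk_app (dx (D \<mu>) x) (\<Theta> x) \<partial>\<mu>)"
  define T where "T = (\<lambda>r (a :: real ^ 'k) x. r *\<^sub>R \<Theta> x + (\<Sum>i\<in>UNIV. a $ i *\<^sub>R \<eta> i x))"
  define K where "K = 1 + \<bar>t\<bar> + \<bar>real CARD('k) * b\<bar>"
  have K: "K > 0" by (simp add: K_def add_pos_nonneg)
  have sb: "norm (\<Sum>i\<in>UNIV. a $ i *\<^sub>R \<eta> i x) \<le> K * norm a" for a x
    by (rule order_trans[OF norm_sum_scaleR_le[OF b] mult_right_mono]) (auto simp: K_def)
  have tb: "norm (r *\<^sub>R \<Theta> x) \<le> K * r" if "r > 0" for r x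
    using that order_trans[OF \<Theta>(2), of K x] by (auto simp: K_def)
  have Tm: "T r a \<in> borel_measurable borel" for r a
    unfolding T_def using \<Theta> \<eta> by measurable
  have Tb: "norm (T r a x) \<le> K * (r + norm a)" if "r > 0" for r a x
    using norm_triangle_mono[OF tb[OF that] sb[of a]] by (simp add: T_def algebra_simps)
  have Td: "T r a x - T r a' x = (\<Sum>i\<in>UNIV. (a - a') $ i *\<^sub>R \<eta> i x)" for r a a' x
    by (simp add: T_def sum_subtractf[symmetric] scaleR_diff_left)
  have lin: "(\<integral>x. blk_app (dx (D \<mu>) x) (T r a x) \<partial>\<mu>) = r *\<^sub>R v + a" for r a
  proof -
    have i\<eta>: "integrable \<mu> (\<lambda>x. blk_app (dx (D \<mu>) x) (\<eta> i x))" for i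
      using \<eta>(1) b by (intro integrable_blk_app_bounded[OF iD, where b=b]) auto
    have i\<Theta>: "integrable \<mu> (\<lambda>x. blk_app (dx (D \<mu>) x) (\<Theta> x))"
      using \<Theta> by (intro integrable_blk_app_bounded[OF iD, where b=t]) auto
    have "(\<integral>x. blk_app (dx (D \<mu>) x) (T r a x) \<partial>\<mu>) = r *\<^sub>R v + (\<Sum>i\<in>UNIV. a $ i *\<^sub>R axis i 1)"
      using i\<eta> i\<Theta> \<eta>(2) by (simp add: T_def v_def blk_app.add_right blk_app.sum_right blk_app.scaleR_right)
    also have "(\<Sum>i\<in>UNIV. a $ i *\<^sub>R axis i 1) = a"
      using basis_expansion[of a] by (simp add: scalar_mult_eq_scaleR)
    finally show ?thesis .
  qed
  have perp: "push \<mu> (T r a) \<in> test_perp p \<psi>" if "0 < r" for r a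
  proof -
    have "push \<mu> (T r a) \<in> prob_moment p"
      by (rule push_in_prob_moment[OF \<mu> Tm _ p, where b="K * (r + norm a)"]) (use Tb[OF that] in auto)
    moreover have "\<psi> x = 0" for x using A by (auto simp: cond_A_W_def simp del: split_paired_All)
    ultimately show ?thesis by (subst test_perp_zero)
  qed
  have dist: "tdist W p (push \<mu> (\<lambda>x. r *\<^sub>R \<Theta> x)) (push \<mu> (T r a)) \<le> K * norm a" for r a
  proof -
    have m: "(\<lambda>x. x + r *\<^sub>R \<Theta> x) \<in> borel_measurable \<mu>" "(\<lambda>x. x + T r a x) \<in> borel_measurable \<mu>"
      using \<Theta> Tm by auto
    have "wasserstein p (push \<mu> (\<lambda>x. r *\<^sub>R \<Theta> x)) (push \<mu> (T r a))
        \<le> transport_cost p (distr \<mu> borel (\<lambda>x. (x + r *\<^sub>R \<Theta> x, x + T r a x)))"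
      unfolding push_def by (intro wasserstein_le coupling_distr m)
    also have "\<dots> \<le> K * norm a"
    proof (rule transport_cost_distr_le[OF \<mu>'(1) m])
      show "AE x in \<mu>. norm (x + r *\<^sub>R \<Theta> x - (x + T r a x)) \<le> K * norm a"
        using sb[of a] by (simp add: T_def)
    qed (use K p in auto)
    finally show ?thesis by simp
  qed
  have "Limsup (at_right 0)
      (\<lambda>r. ereal (1 / r) * tdist_set W p (push \<mu> (\<lambda>x. r *\<^sub>R \<Theta> x)) (zero_set p \<phi> \<inter> test_perp p \<psi>))
    \<le> ereal (K * norm v + 0)"
  proof (rule Limsup_tdist_set_le_of_family[where T=T, OF p \<mu> R \<phi>0 K zero_less_one])
    fix r :: real and a a' :: "real ^ 'k" assume r: "0 < r"
    show "AE x in \<mu>. norm (T r a x) \<le> K * (r + norm a)" using Tb[OF r] by simp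
    show "AE x in \<mu>. norm (T r a x - T r a' x) \<le> K * norm (a - a')" 
      unfolding Td by (intro AE_I2 sb)
    show "push \<mu> (T r a) \<in> test_perp p \<psi>" by (rule perp[OF r])
  next
    fix e :: real assume e: "e > 0"
    show "\<exists>\<delta>>0. \<forall>r a. 0 < r \<longrightarrow> r \<le> \<delta> \<longrightarrow> norm a \<le> \<delta> \<longrightarrow>
      norm ((\<integral>x. blk_app (dx (D \<mu>) x) (T r a x) \<partial>\<mu>) - (r *\<^sub>R v + a)) \<le> e * (r + norm a)"
      using e by (intro exI[of _ 1]) (simp add: lin add_nonneg_nonneg)
    have "tdist W p (push \<mu> (\<lambda>x. r *\<^sub>R \<Theta> x)) (push \<mu> (T r a)) \<le> K * norm a + r * 0 + e * (r + norm a)" if "r > 0" for r a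
      using dist[of r a] e that by (simp add: add_increasing2)
    then show "\<exists>\<delta>>0. \<forall>r a. 0 < r \<longrightarrow> r \<le> \<delta> \<longrightarrow> norm a \<le> \<delta> \<longrightarrow>
      tdist W p (push \<mu> (\<lambda>x. r *\<^sub>R \<Theta> x)) (push \<mu> (T r a)) \<le> K * norm a + r * 0 + e * (r + norm a)"
      by (intro exI[of _ 1]) simp
  qed (rule Tm)
  then show ?thesis using K unfolding v_def by (intro exI[of _ K]) simp
qed

section \<open>Vector-valued conditional expectations\<close>

lemma cond_ex_inner:
  assumes "b \<in> Basis"
  shows "cond_ex M Y f x \<bullet> b = real_cond_exp M (vimage_algebra (space M) Y borel) (\<lambda>y. f y \<bullet> b) x"
proof -
  have "cond_ex M Y f x \<bullet> b = (\<Sum>c\<in>Basis.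
      real_cond_exp M (vimage_algebra (space M) Y borel) (\<lambda>y. f y \<bullet> c) x * (c \<bullet> b))"
    by (simp add: cond_ex_def inner_sum_left)
  also have "\<dots> = (\<Sum>c\<in>Basis. if c = b then
      real_cond_exp M (vimage_algebra (space M) Y borel) (\<lambda>y. f y \<bullet> c) x else 0)"
    using assms by (intro sum.cong) (auto simp: inner_Basis)
  also have "\<dots> = real_cond_exp M (vimage_algebra (space M) Y borel) (\<lambda>y. f y \<bullet> b) x"
    using assms by simp
  finally show ?thesis .
qed

lemma cond_ex_real: "cond_ex M Y (f :: _ \<Rightarrow> real) = real_cond_exp M (vimage_algebra (space M) Y borel) f"
  by (simp add: cond_ex_def)

lemma AE_euclidean_eqI:
  fixes f g :: "'a \<Rightarrow> 'b::euclidean_space"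
  assumes "\<And>b. b \<in> Basis \<Longrightarrow> AE x in M. f x \<bullet> b = g x \<bullet> b"
  shows "AE x in M. f x = g x"
proof -
  have "AE x in M. \<forall>b\<in>Basis. f x \<bullet> b = g x \<bullet> b"
    using assms by (intro AE_finite_allI) auto
  then show ?thesis by (rule eventually_mono) (rule euclidean_eqI, blast)
qed

lemma integrable_euclideanI:
  fixes f :: "'a \<Rightarrow> 'b::euclidean_space"
  assumes "\<And>b. b \<in> Basis \<Longrightarrow> integrable M (\<lambda>x. f x \<bullet> b)"
  shows "integrable M f"
proof -
  have "integrable M (\<lambda>x. \<Sum>b\<in>Basis. (f x \<bullet> b) *\<^sub>R b)"
    using assms by (intro Bochner_Integration.integrable_sum integrable_scaleR_left)
  then show ?thesis by (simp add: euclidean_representation)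
qed

locale conditioning = prob_space M for M :: "'a measure" +
  fixes Y :: "'a \<Rightarrow> 'c::topological_space"
  assumes measurable_Y [measurable]: "Y \<in> borel_measurable M"
begin

abbreviation "\<F> \<equiv> vimage_algebra (space M) Y borel"

lemma sets_F: "sets \<F> = {Y -` A \<inter> space M | A. A \<in> sets borel}"
  by (rule sets_vimage_algebra2) simp

lemma subalgebra_F: "subalgebra M \<F>"
  unfolding subalgebra_def sets_F using measurable_sets[OF measurable_Y] by auto

sublocale C: sigma_finite_subalgebra M \<F>
  by (rule finite_measure_subalgebra_is_sigma_finite, unfold_locales) (rule subalgebra_F)

lemma F_measurable_compose: "h \<in> borel_measurable borel \<Longrightarrow> (\<lambda>x. h (Y x)) \<in> borel_measurable \<F>"
  by (rule measurable_compose[OF measurable_vimage_algebra1]) auto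

lemma F_measurable_M: "f \<in> borel_measurable \<F> \<Longrightarrow> f \<in> borel_measurable M"
  by (rule measurable_from_subalg[OF subalgebra_F])

text \<open>The preimage of the singleton {f x} is a Y-preimage and therefore contains y together
  with x. In this way a \<sigma>(X_1)-measurable covector becomes an honest function of x_1, the
  form in which condition (iv) takes its argument.\<close>

lemma F_measurable_cong_Y:
  fixes f :: "'a \<Rightarrow> 'e::t1_space"
  assumes "f \<in> borel_measurable \<F>" "x \<in> space M" "y \<in> space M" "Y x = Y y"
  shows "f x = f y"
proof -
  have "f -` {f x} \<inter> space \<F> \<in> sets \<F>" using assms(1) by (rule measurable_sets) simp
  then obtain A where A: "f -` {f x} \<inter> space M = Y -` A \<inter> space M" by (auto simp: sets_F)
  have "x \<in> Y -` A \<inter> space M" unfolding A[symmetric] using assms(2) by simp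
  then have "y \<in> Y -` A \<inter> space M" using assms(3,4) by simp
  then have "y \<in> f -` {f x} \<inter> space M" unfolding A .
  then have "f y \<in> {f x}" by (rule IntD1[THEN vimageD])
  then show ?thesis by (rule singletonD[symmetric])
qed

section \<open>Linearity, pulling out known factors, and norm bounds\<close>

lemma measurable_cond_ex_F [measurable]:
  fixes f :: "'a \<Rightarrow> 'b::euclidean_space"
  shows "cond_ex M Y f \<in> borel_measurable \<F>"
proof (subst borel_measurable_euclidean_space, rule ballI)
  fix b :: 'b assume b: "b \<in> Basis"
  show "(\<lambda>x. cond_ex M Y f x \<bullet> b) \<in> borel_measurable \<F>"
    unfolding cond_ex_inner[OF b] by (rule borel_measurable_cond_exp)
qed

lemma measurable_cond_ex [measurable]:
  fixes f :: "'a \<Rightarrow> 'b::euclidean_space"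
  shows "cond_ex M Y f \<in> borel_measurable M"
  by (rule F_measurable_M) measurable

lemma integrable_cond_ex:
  fixes f :: "'a \<Rightarrow> 'b::euclidean_space"
  assumes "integrable M f"
  shows "integrable M (cond_ex M Y f)"
proof (rule integrable_euclideanI)
  fix b :: 'b assume b: "b \<in> Basis"
  show "integrable M (\<lambda>x. cond_ex M Y f x \<bullet> b)"
    unfolding cond_ex_inner[OF b] using assms by (intro C.real_cond_exp_int) auto
qed

lemma integral_cond_ex:
  fixes f :: "'a \<Rightarrow> 'b::euclidean_space"
  assumes "integrable M f"
  shows "(\<integral>x. cond_ex M Y f x \<partial>M) = (\<integral>x. f x \<partial>M)"
proof (rule euclidean_eqI)
  fix b :: 'b assume b: "b \<in> Basis"
  have "(\<integral>x. cond_ex M Y f x \<partial>M) \<bullet> b = (\<integral>x. cond_ex M Y f x \<bullet> b \<partial>M)"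
    using integrable_cond_ex[OF assms] by simp
  also have "\<dots> = (\<integral>x. f x \<bullet> b \<partial>M)"
    unfolding cond_ex_inner[OF b] using assms by (intro C.real_cond_exp_int) auto
  finally show "(\<integral>x. cond_ex M Y f x \<partial>M) \<bullet> b = (\<integral>x. f x \<partial>M) \<bullet> b"
    using assms by simp
qed

lemma cond_ex_add:
  fixes f g :: "'a \<Rightarrow> 'b::euclidean_space"
  assumes "integrable M f" "integrable M g"
  shows "AE x in M. cond_ex M Y (\<lambda>x. f x + g x) x = cond_ex M Y f x + cond_ex M Y g x"
proof (rule AE_euclidean_eqI)
  fix b :: 'b assume b: "b \<in> Basis"
  have "integrable M (\<lambda>x. f x \<bullet> b)" "integrable M (\<lambda>x. g x \<bullet> b)" using assms by auto
  from C.real_cond_exp_add[OF this]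
  show "AE x in M. cond_ex M Y (\<lambda>x. f x + g x) x \<bullet> b = (cond_ex M Y f x + cond_ex M Y g x) \<bullet> b"
    unfolding inner_add_left cond_ex_inner[OF b] .
qed

lemma cond_ex_diff:
  fixes f g :: "'a \<Rightarrow> 'b::euclidean_space"
  assumes "integrable M f" "integrable M g"
  shows "AE x in M. cond_ex M Y (\<lambda>x. f x - g x) x = cond_ex M Y f x - cond_ex M Y g x"
proof (rule AE_euclidean_eqI)
  fix b :: 'b assume b: "b \<in> Basis"
  have "integrable M (\<lambda>x. f x \<bullet> b)" "integrable M (\<lambda>x. g x \<bullet> b)" using assms by auto
  from C.real_cond_exp_diff[OF this]
  show "AE x in M. cond_ex M Y (\<lambda>x. f x - g x) x \<bullet> b = (cond_ex M Y f x - cond_ex M Y g x) \<bullet> b"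
    unfolding inner_diff_left cond_ex_inner[OF b] .
qed

lemma cond_ex_F_measurable:
  fixes f :: "'a \<Rightarrow> 'b::euclidean_space"
  assumes "integrable M f" "f \<in> borel_measurable \<F>"
  shows "AE x in M. cond_ex M Y f x = f x"
proof (rule AE_euclidean_eqI)
  fix b :: 'b assume b: "b \<in> Basis"
  have [measurable]: "f \<in> borel_measurable \<F>" by fact
  show "AE x in M. cond_ex M Y f x \<bullet> b = f x \<bullet> b"
    unfolding cond_ex_inner[OF b] using assms(1) by (intro C.real_cond_exp_F_meas) auto
qed

text \<open>Expand both arguments in bases and pull out scalar factors. Stated for an arbitrary
  bilinear product, it serves scalar multiples, matrix-vector products in either order, transposed
  products and inner products alike.\<close>

lemma cond_ex_bilinear:
  fixes f :: "'a \<Rightarrow> 'b::euclidean_space" and A :: "'a \<Rightarrow> 'e::euclidean_space"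
    and B :: "'e \<Rightarrow> 'b \<Rightarrow> 'g::euclidean_space"
  assumes B: "bounded_bilinear B" and A [measurable]: "A \<in> borel_measurable \<F>"
    and f [measurable]: "f \<in> borel_measurable M" and i: "integrable M (\<lambda>x. norm (A x) * norm (f x))"
  shows "AE x in M. cond_ex M Y (\<lambda>x. B (A x) (f x)) x = B (A x) (cond_ex M Y f x)"
    and "integrable M (\<lambda>x. B (A x) (f x))"
proof -
  interpret B: bounded_bilinear B by fact
  have [measurable]: "A \<in> borel_measurable M" using A by (rule F_measurable_M)
  have expand: "B a v = (\<Sum>i\<in>Basis. \<Sum>j\<in>Basis. ((a \<bullet> i) * (v \<bullet> j)) *\<^sub>R B i j)" for a v
  proof -
    have "B a v = B (\<Sum>i\<in>Basis. (a \<bullet> i) *\<^sub>R i) (\<Sum>j\<in>Basis. (v \<bullet> j) *\<^sub>R j)"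
      by (simp add: euclidean_representation)
    also have "\<dots> = (\<Sum>j\<in>Basis. \<Sum>i\<in>Basis. ((a \<bullet> i) * (v \<bullet> j)) *\<^sub>R B i j)"
      by (simp add: B.sum_left B.sum_right B.scaleR_left B.scaleR_right scaleR_sum_right mult.commute)
    also have "\<dots> = (\<Sum>i\<in>Basis. \<Sum>j\<in>Basis. ((a \<bullet> i) * (v \<bullet> j)) *\<^sub>R B i j)"
      by (rule sum.swap)
    finally show ?thesis .
  qed
  have ij: "integrable M (\<lambda>x. (A x \<bullet> i) * (f x \<bullet> j))" if "i \<in> Basis" "j \<in> Basis" for i j
  proof (rule Bochner_Integration.integrable_bound[OF i])
    show "AE x in M. norm ((A x \<bullet> i) * (f x \<bullet> j)) \<le> norm (norm (A x) * norm (f x))"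
      using that by (auto simp: abs_mult Basis_le_norm intro!: mult_mono AE_I2)
  qed measurable
  show "integrable M (\<lambda>x. B (A x) (f x))"
    by (subst expand) (intro Bochner_Integration.integrable_sum integrable_scaleR_left ij)
  show "AE x in M. cond_ex M Y (\<lambda>x. B (A x) (f x)) x = B (A x) (cond_ex M Y f x)"
  proof (rule AE_euclidean_eqI)
    fix b :: 'g assume b: "b \<in> Basis"
    have 0: "B a v \<bullet> b = (\<Sum>(i,j)\<in>Basis \<times> Basis. (B i j \<bullet> b) * ((a \<bullet> i) * (v \<bullet> j)))" for a v
      by (subst expand) (simp add: inner_sum_left sum.cartesian_product[symmetric] mult_ac)
    have s: "AE x in M. real_cond_exp M \<F> (\<lambda>x. (B i j \<bullet> b) * ((A x \<bullet> i) * (f x \<bullet> j))) x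
        = (B i j \<bullet> b) * ((A x \<bullet> i) * real_cond_exp M \<F> (\<lambda>x. f x \<bullet> j) x)"
      if "i \<in> Basis" "j \<in> Basis" for i j
    proof -
      have "AE x in M. real_cond_exp M \<F> (\<lambda>x. (B i j \<bullet> b) * ((A x \<bullet> i) * (f x \<bullet> j))) x
          = (B i j \<bullet> b) * real_cond_exp M \<F> (\<lambda>x. (A x \<bullet> i) * (f x \<bullet> j)) x"
        by (intro C.real_cond_exp_cmult ij that)
      moreover have "AE x in M. real_cond_exp M \<F> (\<lambda>x. (A x \<bullet> i) * (f x \<bullet> j)) x
          = (A x \<bullet> i) * real_cond_exp M \<F> (\<lambda>x. f x \<bullet> j) x"
        by (intro C.real_cond_exp_mult ij that) measurable
      ultimately show ?thesis by eventually_elim simp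
    qed
    \<comment> \<open>Extended by zero off the bases: the sum rule for conditional expectations asks
      for integrability at every index of the type, not only at the summed ones.\<close>
    define H where "H = (\<lambda>(i, j) x. if i \<in> Basis \<and> j \<in> Basis then (B i j \<bullet> b) * ((A x \<bullet> i) * (f x \<bullet> j)) else 0)"
    have eqH: "(\<lambda>x. \<Sum>k\<in>Basis \<times> Basis. H k x) = (\<lambda>x. B (A x) (f x) \<bullet> b)"
      by (rule ext, subst 0) (auto simp: H_def intro!: sum.cong)
    have "AE x in M. real_cond_exp M \<F> (\<lambda>x. \<Sum>k\<in>Basis \<times> Basis. H k x) x
        = (\<Sum>k\<in>Basis \<times> Basis. real_cond_exp M \<F> (H k) x)"
    proof (rule C.real_cond_exp_sum)
      fix k :: "'e \<times> 'b"
      obtain i j where k: "k = (i, j)" by (cases k)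
      show "integrable M (H k)"
      proof (cases "i \<in> Basis \<and> j \<in> Basis")
        case True
        then show ?thesis using ij[of i j] by (simp add: H_def k)
      next
        case False
        then have "H k = (\<lambda>_. 0)" by (auto simp: H_def k)
        then show ?thesis by simp
      qed
    qed
    moreover have "AE x in M. \<forall>k\<in>Basis \<times> Basis. real_cond_exp M \<F> (H k) x
        = (case k of (i, j) \<Rightarrow> (B i j \<bullet> b) * ((A x \<bullet> i) * real_cond_exp M \<F> (\<lambda>x. f x \<bullet> j) x))"
      using s by (intro AE_finite_allI) (auto simp: H_def)
    ultimately show "AE x in M. cond_ex M Y (\<lambda>x. B (A x) (f x)) x \<bullet> b = B (A x) (cond_ex M Y f x) \<bullet> b"
    proof eventually_elim
      case (elim x)
      have "cond_ex M Y (\<lambda>x. B (A x) (f x)) x \<bullet> b = (\<Sum>(i,j)\<in>Basis \<times> Basis. (B i j \<bullet> b) * ((A x \<bullet> i) * (cond_ex M Y f x \<bullet> j)))"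
        using elim unfolding cond_ex_inner[OF b] eqH[symmetric]
        by (auto simp: cond_ex_inner intro!: sum.cong)
      also have "\<dots> = B (A x) (cond_ex M Y f x) \<bullet> b" by (rule 0[symmetric])
      finally show ?case .
    qed
  qed
qed

lemma integral_bilinear_cond_ex:
  fixes f :: "'a \<Rightarrow> 'b::euclidean_space" and A :: "'a \<Rightarrow> 'e::euclidean_space"
    and B :: "'e \<Rightarrow> 'b \<Rightarrow> 'g::euclidean_space"
  assumes B: "bounded_bilinear B" and A: "A \<in> borel_measurable \<F>"
    and f: "f \<in> borel_measurable M" and i: "integrable M (\<lambda>x. norm (A x) * norm (f x))"
  shows "(\<integral>x. B (A x) (cond_ex M Y f x) \<partial>M) = (\<integral>x. B (A x) (f x) \<partial>M)"
proof -
  note P = cond_ex_bilinear[OF B A f i]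
  have [measurable]: "(\<lambda>x. B (A x) (cond_ex M Y f x)) \<in> borel_measurable M"
    using B A
    by (intro borel_measurable_continuous_Pair[where H=B] F_measurable_M[OF A] measurable_cond_ex)
      (auto intro!: continuous_intros bounded_bilinear.continuous_on[OF B])
  have "(\<integral>x. B (A x) (cond_ex M Y f x) \<partial>M) = (\<integral>x. cond_ex M Y (\<lambda>x. B (A x) (f x)) x \<partial>M)"
    using P(1) by (intro integral_cong_AE) (auto elim: eventually_mono)
  also have "\<dots> = (\<integral>x. B (A x) (f x) \<partial>M)" by (rule integral_cond_ex[OF P(2)])
  finally show ?thesis .
qed

lemma cond_ex_linear:
  fixes f :: "'a \<Rightarrow> 'b::euclidean_space" and T :: "'b \<Rightarrow> 'g::euclidean_space"
  assumes T: "bounded_linear T" and f: "integrable M f"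
  shows "AE x in M. cond_ex M Y (\<lambda>x. T (f x)) x = T (cond_ex M Y f x)"
proof -
  have "bounded_bilinear (\<lambda>(c::real) y. c *\<^sub>R T y)"
    by (rule bounded_bilinear.comp[OF bounded_bilinear_scaleR bounded_linear_ident T])
  from cond_ex_bilinear(1)[OF this, of "\<lambda>_. 1" f] f show ?thesis by simp
qed

text \<open>Each coordinate and its negative are compared with g and the coordinates are summed. The
  resulting dimension factor is harmless, since constants are not optimised, but it reappears as
  \<open>CARD('l)\<close> in the constants below.\<close>

lemma cond_ex_norm_le_real_cond_exp:
  fixes f :: "'a \<Rightarrow> 'b::euclidean_space"
  assumes f: "integrable M f" and g: "integrable M g" and le: "AE x in M. norm (f x) \<le> g x"
  shows "AE x in M. norm (cond_ex M Y f x) \<le> real DIM('b) * real_cond_exp M \<F> g x"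
proof -
  have "AE x in M. \<bar>cond_ex M Y f x \<bullet> b\<bar> \<le> real_cond_exp M \<F> g x" if b: "b \<in> Basis" for b
  proof -
    have 1: "AE x in M. f x \<bullet> b \<le> g x" "AE x in M. - (f x \<bullet> b) \<le> g x"
      using le by (eventually_elim, use Basis_le_norm[OF b] in \<open>fastforce simp: abs_le_iff intro: order_trans\<close>)+
    have i: "integrable M (\<lambda>x. f x \<bullet> b)" "integrable M (\<lambda>x. - (f x \<bullet> b))" using f by auto
    have "AE x in M. real_cond_exp M \<F> (\<lambda>x. f x \<bullet> b) x \<le> real_cond_exp M \<F> g x"
      by (intro C.real_cond_exp_mono 1 i g)
    moreover have "AE x in M. real_cond_exp M \<F> (\<lambda>x. - (f x \<bullet> b)) x \<le> real_cond_exp M \<F> g x"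
      by (intro C.real_cond_exp_mono 1 i g)
    moreover have "AE x in M. real_cond_exp M \<F> (\<lambda>x. (- 1) * (f x \<bullet> b)) x = (- 1) * real_cond_exp M \<F> (\<lambda>x. f x \<bullet> b) x"
      by (intro C.real_cond_exp_cmult i)
    ultimately show ?thesis by eventually_elim (simp add: cond_ex_inner[OF b] abs_le_iff)
  qed
  then have "AE x in M. \<forall>b\<in>Basis. \<bar>cond_ex M Y f x \<bullet> b\<bar> \<le> real_cond_exp M \<F> g x" by (intro AE_finite_allI) auto
  then show ?thesis
  proof (rule eventually_mono)
    fix x assume *: "\<forall>b\<in>Basis. \<bar>cond_ex M Y f x \<bullet> b\<bar> \<le> real_cond_exp M \<F> g x"
    have "norm (cond_ex M Y f x) \<le> (\<Sum>b\<in>Basis. \<bar>cond_ex M Y f x \<bullet> b\<bar>)" by (rule norm_le_l1)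
    also have "\<dots> \<le> (\<Sum>b\<in>(Basis :: 'b set). real_cond_exp M \<F> g x)" using * by (intro sum_mono) auto
    finally show "norm (cond_ex M Y f x) \<le> real DIM('b) * real_cond_exp M \<F> g x" by simp
  qed
qed

lemma cond_ex_norm_le:
  fixes f :: "'a \<Rightarrow> 'b::euclidean_space"
  assumes f: "integrable M f" and g: "integrable M g" "g \<in> borel_measurable \<F>"
    and le: "AE x in M. norm (f x) \<le> g x"
  shows "AE x in M. norm (cond_ex M Y f x) \<le> real DIM('b) * g x"
  using cond_ex_norm_le_real_cond_exp[OF f g(1) le] C.real_cond_exp_F_meas[OF g]
  by eventually_elim simp

text \<open>Conditional Jensen for the power q, applied to a scalar majorant of |f|.\<close>

lemma integrable_powr_cond_ex:
  fixes f :: "'a \<Rightarrow> 'b::euclidean_space"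
  assumes f: "integrable M f" and q: "q \<ge> 1" and fq: "integrable M (\<lambda>x. norm (f x) powr q)"
  shows "integrable M (\<lambda>x. norm (cond_ex M Y f x) powr q)"
proof -
  \<comment> \<open>Adding 1 places the majorant in the open half-line on which the power is known
    to be convex.\<close>
  define X where "X = (\<lambda>x. 1 + norm (f x))"
  have X: "integrable M X" using f by (simp add: X_def)
  have Xq: "integrable M (\<lambda>x. X x powr q)"
  proof -
    have "integrable M (\<lambda>x. norm (1 + norm (f x)) powr q)"
      using f fq q by (intro integrable_powr_add) auto
    moreover have "norm (1 + norm (f x)) = X x" for x using norm_ge_zero[of "f x"] by (simp add: X_def del: norm_ge_zero)
    ultimately show ?thesis by simp
  qed
  have Xpos: "AE x in M. X x \<in> {0<..}" by (auto simp: X_def add_pos_nonneg)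
  have Eq: "integrable M (\<lambda>x. real_cond_exp M \<F> X x powr q)"
    by (rule C.integrable_convex_cond_exp[OF X Xpos _ Xq powr_convex[OF q]]) (auto simp: emeasure_space_1)
  have le: "AE x in M. norm (cond_ex M Y f x) \<le> real DIM('b) * real_cond_exp M \<F> X x"
    by (rule cond_ex_norm_le_real_cond_exp[OF f X]) (simp add: X_def)
  show ?thesis
  proof (rule Bochner_Integration.integrable_bound)
    show "integrable M (\<lambda>x. real DIM('b) powr q * real_cond_exp M \<F> X x powr q)" using Eq by simp
    show "AE x in M. norm (norm (cond_ex M Y f x) powr q) \<le> norm (real DIM('b) powr q * real_cond_exp M \<F> X x powr q)"
      using le
    proof (rule eventually_mono)
      fix x assume *: "norm (cond_ex M Y f x) \<le> real DIM('b) * real_cond_exp M \<F> X x"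
      then have "0 \<le> real DIM('b) * real_cond_exp M \<F> X x" using norm_ge_zero order_trans by blast
      then have "0 \<le> real_cond_exp M \<F> X x" by (simp add: zero_le_mult_iff)
      moreover have "norm (cond_ex M Y f x) powr q \<le> (real DIM('b) * real_cond_exp M \<F> X x) powr q"
        using * q by (intro powr_mono2) auto
      ultimately show "norm (norm (cond_ex M Y f x) powr q) \<le> norm (real DIM('b) powr q * real_cond_exp M \<F> X x powr q)"
        by (simp add: powr_mult)
    qed
  qed measurable
qed

end

text \<open>Adapted fields have Lipschitz first components, so orthogonality is available against
  Lipschitz functions of Y only. Such functions decrease to indicators of closed sets, and closed
  sets are an intersection-stable generator, so Dynkin's argument reaches every event of
  \<sigma>(Y).\<close>

lemma cond_ex_eq_0_of_lipschitz_tests: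
  fixes Y :: "'a \<Rightarrow> 'c::metric_space" and u :: "'a \<Rightarrow> real"
  assumes "conditioning M Y" and u: "integrable M u"
    and test: "\<And>k L. (\<And>s. 0 \<le> k s \<and> k s \<le> 1) \<Longrightarrow> (\<And>s t. \<bar>k s - k t\<bar> \<le> L * dist s t) \<Longrightarrow>
      (\<integral>x. u x * k (Y x) \<partial>M) = 0"
  shows "AE x in M. cond_ex M Y u x = 0"
proof -
  interpret conditioning M Y by fact
  have closed: "(\<integral>x. u x * indicator S (Y x) \<partial>M) = 0" if S: "closed S" for S
  proof (cases "S = {}")
    case False
    \<comment> \<open>Equal to 1 on S, zero from distance 1/n onward, with Lipschitz constant
      n.\<close>
    define k where "k = (\<lambda>n s. max 0 (1 - real n * infdist s S))"
    have 01: "0 \<le> k n s \<and> k n s \<le> 1" for n s by (auto simp: k_def infdist_nonneg)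
    have Lip: "\<bar>k n s - k n t\<bar> \<le> real n * dist s t" for n s t
    proof -
      have "\<bar>k n s - k n t\<bar> \<le> \<bar>real n * infdist s S - real n * infdist t S\<bar>" by (auto simp: k_def)
      also have "\<dots> = real n * \<bar>infdist s S - infdist t S\<bar>" by (simp add: right_diff_distrib[symmetric] abs_mult)
      also have "\<dots> \<le> real n * dist s t" by (intro mult_left_mono infdist_triangle_abs) auto
      finally show ?thesis .
    qed
    have cont: "continuous_on UNIV (k n)" for n
      unfolding k_def by (intro continuous_intros)
    then have [measurable]: "k n \<in> borel_measurable borel" for n by (rule borel_measurable_continuous_onI)
    have lim: "(\<lambda>n. k n s) \<longlonglongrightarrow> indicator S s" for s
    proof (cases "s \<in> S")
      case True
      then show ?thesis by (simp add: k_def)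
    next
      case s: False
      then have "infdist s S > 0" using S False by (intro infdist_pos_not_in_closed)
      then obtain N where N: "real N * infdist s S > 1" using ex_less_of_nat_mult by blast
      have "k n s = 0" if "n \<ge> N" for n
      proof -
        have "real N * infdist s S \<le> real n * infdist s S" using that by (intro mult_right_mono) (auto simp: infdist_nonneg)
        then show ?thesis using N by (simp add: k_def)
      qed
      then have "eventually (\<lambda>n. k n s = indicator S s) sequentially"
        using s by (auto simp: eventually_sequentially)
      then show ?thesis by (rule tendsto_eventually)
    qed
    have [measurable]: "S \<in> sets borel" using S by simp
    have "(\<lambda>n. \<integral>x. u x * k n (Y x) \<partial>M) \<longlonglongrightarrow> (\<integral>x. u x * indicator S (Y x) \<partial>M)"
    proof (rule integral_dominated_convergence[where w="\<lambda>x. \<bar>u x\<bar>"])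
      show "AE x in M. norm (u x * k n (Y x)) \<le> \<bar>u x\<bar>" for n
        using 01 by (auto simp: abs_mult intro!: AE_I2 mult_left_le)
      show "AE x in M. (\<lambda>n. u x * k n (Y x)) \<longlonglongrightarrow> u x * indicator S (Y x)"
        by (intro AE_I2 tendsto_mult_left lim)
    qed (use u in auto)
    moreover have "(\<integral>x. u x * k n (Y x) \<partial>M) = 0" for n by (rule test[OF 01 Lip])
    ultimately show ?thesis using LIMSEQ_unique[OF _ tendsto_const[of 0]] by simp
  qed simp
  have all: "(\<integral>x. u x * indicator A (Y x) \<partial>M) = 0" if A: "A \<in> sets borel" for A
  proof -
    have Int: "Int_stable (Collect closed :: 'c set set)" by (auto simp: Int_stable_def)
    have P: "Collect closed \<subseteq> Pow (UNIV :: 'c set)" by simp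
    have sb: "sets borel = sigma_sets (UNIV :: 'c set) (Collect closed)"
      by (subst borel_eq_closed) simp
    have "A \<in> sigma_sets UNIV (Collect closed)" using A sb by simp
    with Int P show ?thesis
    proof (induction rule: sigma_sets_induct_disjoint)
      case (compl A)
      then have [measurable]: "A \<in> sets borel" by (simp add: sb)
      have "(\<integral>x. u x * indicator (UNIV - A) (Y x) \<partial>M) = (\<integral>x. u x * indicator UNIV (Y x) - u x * indicator A (Y x) \<partial>M)"
        by (intro Bochner_Integration.integral_cong) (auto simp: indicator_def)
      also have "\<dots> = (\<integral>x. u x * indicator UNIV (Y x) \<partial>M) - (\<integral>x. u x * indicator A (Y x) \<partial>M)"
        using u by (intro Bochner_Integration.integral_diff)
          (auto intro!: Bochner_Integration.integrable_bound[OF u] simp: indicator_def)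
      also have "\<dots> = 0" using compl closed[of UNIV] by simp
      finally show ?case .
    next
      case (union A)
      then have [measurable]: "A i \<in> sets borel" for i using sb by auto
      have i: "integrable M (\<lambda>x. u x * indicator (A i) (Y x))" for i
        by (rule Bochner_Integration.integrable_bound[OF u]) (use u in \<open>auto simp: indicator_def\<close>)
      have "(\<lambda>x. \<Sum>i. u x * indicator (A i) (Y x)) = (\<lambda>x. u x * indicator (\<Union>i. A i) (Y x))"
      proof
        fix x
        have "(\<lambda>i. indicator (A i) (Y x) :: real) sums indicator (\<Union>i. A i) (Y x)"
          by (intro indicator_sums) (use union(1) in \<open>auto simp: disjoint_family_on_def\<close>)
        then show "(\<Sum>i. u x * indicator (A i) (Y x)) = u x * indicator (\<Union>i. A i) (Y x)"
          by (intro sums_unique[symmetric] sums_mult)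
      qed
      moreover have "(\<lambda>n. \<integral>x. (\<Sum>i<n. u x * indicator (A i) (Y x)) \<partial>M) \<longlonglongrightarrow> (\<integral>x. (\<Sum>i. u x * indicator (A i) (Y x)) \<partial>M)"
      proof (rule integral_dominated_convergence[where w="\<lambda>x. \<bar>u x\<bar>"])
        have sm: "(\<lambda>i. u x * indicator (A i) (Y x)) sums (u x * indicator (\<Union>i. A i) (Y x))" for x
          by (intro sums_mult indicator_sums) (use union(1) in \<open>auto simp: disjoint_family_on_def\<close>)
        then show "AE x in M. (\<lambda>n. \<Sum>i<n. u x * indicator (A i) (Y x)) \<longlonglongrightarrow> (\<Sum>i. u x * indicator (A i) (Y x))"
          by (intro AE_I2) (metis sums_def sums_unique)
        show "AE x in M. norm (\<Sum>i<n. u x * indicator (A i) (Y x)) \<le> \<bar>u x\<bar>" for n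
        proof (rule AE_I2)
          fix x
          have "(\<Sum>i<n. indicator (A i) (Y x) :: real) = indicator (\<Union>i<n. A i) (Y x)"
            using union(1) by (intro indicator_UN_disjoint[symmetric]) (auto simp: disjoint_family_on_def)
          then show "norm (\<Sum>i<n. u x * indicator (A i) (Y x)) \<le> \<bar>u x\<bar>"
            by (simp add: sum_distrib_left[symmetric] abs_mult indicator_def)
        qed
      qed (use u in auto)
      moreover have "(\<integral>x. (\<Sum>i<n. u x * indicator (A i) (Y x)) \<partial>M) = 0" for n
        using i union by (subst Bochner_Integration.integral_sum) auto
      ultimately show ?case using LIMSEQ_unique[OF _ tendsto_const[of 0]] by simp
    qed (use closed in auto)
  qed
  have "AE x in M. real_cond_exp M \<F> u x = 0"
  proof (rule C.real_cond_exp_charact)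
    fix B assume "B \<in> sets \<F>"
    then obtain A where A: "A \<in> sets borel" "B = Y -` A \<inter> space M" by (auto simp: sets_F)
    have "(LINT x:B|M. u x) = (\<integral>x. u x * indicator A (Y x) \<partial>M)"
      unfolding set_lebesgue_integral_def
      by (intro Bochner_Integration.integral_cong) (auto simp: A indicator_def)
    then show "(LINT x:B|M. u x) = (LINT x:B|M. 0)" using all[OF A(1)] by (simp add: set_lebesgue_integral_def)
  qed (use u in auto)
  then show ?thesis by (simp add: cond_ex_real)
qed

section \<open>The conditional constraint\<close>

lemma norm_vec_le_sum: "norm (x :: 'b::real_normed_vector ^ 'n::finite) \<le> (\<Sum>i\<in>UNIV. norm (x $ i))"
  by (simp add: norm_vec_def L2_set_le_sum)

section \<open>Taylor estimates for the constraint map\<close>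

lemma dx_components:
  fixes u :: "'d::finite path \<Rightarrow> real ^ 'k::finite"
  shows "dx1 u x $ i $ j = blk_app (dx u x) (axis j 1, 0) $ i" "dx2 u x $ i $ j = blk_app (dx u x) (0, axis j 1) $ i"
  by (simp_all add: blk_app_def dx_def matrix_vector_mul_component inner_axis)

lemma C1_measurable_dx:
  fixes u :: "'d::finite path \<Rightarrow> real ^ 'k::finite"
  assumes "C1 u"
  shows "dx1 u \<in> borel_measurable borel" "dx2 u \<in> borel_measurable borel" "dx u \<in> borel_measurable borel"
proof -
  obtain u' :: "'d path \<Rightarrow> 'd path \<Rightarrow>\<^sub>L (real ^ 'k)" where u': "\<And>x. (u has_derivative blinfun_apply (u' x)) (at x)"
    "continuous_on UNIV u'" using assms unfolding C1_def by blast
  have "blk_app (dx u x) v = blinfun_apply (u' x) v" for x v using has_derivative_blk_app[OF u'(1)] by simp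
  then have [measurable]: "(\<lambda>x. blk_app (dx u x) v) \<in> borel_measurable borel" for v
    using u'(2) by (auto intro!: borel_measurable_continuous_onI continuous_intros)
  have "(\<lambda>x. dx1 u x $ i $ j) \<in> borel_measurable borel" "(\<lambda>x. dx2 u x $ i $ j) \<in> borel_measurable borel" for i j
    unfolding dx_components by measurable
  then show *: "dx1 u \<in> borel_measurable borel" "dx2 u \<in> borel_measurable borel"
    by (simp_all add: borel_measurable_vec_iff)
  show "dx u \<in> borel_measurable borel"
    unfolding dx_def using * by measurable
qed

text \<open>The third estimate compares two displaced points rather than one displaced point with x.
  Its factor |v| + |w| makes the remainder a small multiple of |v - w|, as a contraction argument
  needs.\<close>

lemma C2_bounded_derivs_estimates:
  fixes \<psi> :: "'d::finite path \<Rightarrow> real ^ 'l::finite"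
  assumes "C2_bounded_derivs \<psi>"
  shows "C1 \<psi>"
    and "\<exists>L\<ge>0. \<forall>x v. norm (blk_app (dx \<psi> x) v) \<le> L * norm v"
    and "\<exists>L\<ge>0. \<forall>x v w. norm (\<psi> (x + v) - \<psi> (x + w) - blk_app (dx \<psi> x) (v - w)) \<le> L * (norm v + norm w) * norm (v - w)"
proof -
  obtain f' :: "'d path \<Rightarrow> 'd path \<Rightarrow>\<^sub>L (real ^ 'l)" and f'' :: "'d path \<Rightarrow> 'd path \<Rightarrow>\<^sub>L ('d path \<Rightarrow>\<^sub>L (real ^ 'l))" where
    f': "\<And>x. (\<psi> has_derivative blinfun_apply (f' x)) (at x)"
    and f'': "\<And>x. (f' has_derivative blinfun_apply (f'' x)) (at x)"
    and b: "bounded (range f')" "bounded (range f'')"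
    using assms unfolding C2_bounded_derivs_def by blast
  have "continuous_on UNIV f'" using f'' by (meson continuous_at_imp_continuous_on has_derivative_continuous)
  then show "C1 \<psi>" using f' unfolding C1_def by blast
  obtain L1 where L1: "\<And>x. norm (f' x) \<le> L1" using b(1) by (auto simp: bounded_iff)
  obtain L2 where L2: "\<And>x. norm (f'' x) \<le> L2" using b(2) by (auto simp: bounded_iff)
  have L0: "0 \<le> L1" "0 \<le> L2" using order_trans[OF norm_ge_zero L1] order_trans[OF norm_ge_zero L2] by auto
  have eq: "blk_app (dx \<psi> x) v = blinfun_apply (f' x) v" for x v using has_derivative_blk_app[OF f'] by simp
  have "norm (blk_app (dx \<psi> x) v) \<le> L1 * norm v" for x v
    unfolding eq by (rule order_trans[OF norm_blinfun]) (intro mult_right_mono L1 norm_ge_zero)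
  then show "\<exists>L\<ge>0. \<forall>x v. norm (blk_app (dx \<psi> x) v) \<le> L * norm v" using L0 by blast
  have lip: "norm (f' x - f' y) \<le> L2 * norm (x - y)" for x y
  proof (rule differentiable_bound[of UNIV f' "\<lambda>x. blinfun_apply (f'' x)"])
    show "(f' has_derivative blinfun_apply (f'' z)) (at z within UNIV)" for z by (rule f'')
    show "onorm (blinfun_apply (f'' z)) \<le> L2" for z using L2[of z] by (simp only: norm_blinfun.rep_eq)
  qed auto
  have "norm (\<psi> (x + v) - \<psi> (x + w) - blk_app (dx \<psi> x) (v - w)) \<le> L2 * (norm v + norm w) * norm (v - w)" for x v w
  proof -
    \<comment> \<open>The derivative of g at z is \<psi>'(x + z) - \<psi>'(x). On the ball of radius
      |v| + |w|, which contains both points, it is at most L2 (|v| + |w|).\<close>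
    define g where "g = (\<lambda>z. \<psi> (x + z) - blinfun_apply (f' x) z)"
    have "norm (g v - g w) \<le> L2 * (norm v + norm w) * norm (v - w)"
    proof (rule differentiable_bound[of "cball 0 (norm v + norm w)" g "\<lambda>z. blinfun_apply (f' (x + z) - f' x)"])
      fix z :: "'d path" assume z: "z \<in> cball 0 (norm v + norm w)"
      have "((\<lambda>z. x + z) has_derivative (\<lambda>h. h)) (at z)" by (auto intro!: derivative_eq_intros)
      from has_derivative_compose[OF this f']
      have "(g has_derivative (\<lambda>h. blinfun_apply (f' (x + z)) h - blinfun_apply (f' x) h)) (at z)"
        unfolding g_def by (intro has_derivative_diff bounded_linear.has_derivative[OF blinfun.bounded_linear_right] has_derivative_ident)
      then show "(g has_derivative blinfun_apply (f' (x + z) - f' x)) (at z within cball 0 (norm v + norm w))"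
        unfolding minus_blinfun.rep_eq by (rule has_derivative_at_withinI)
      have "onorm (blinfun_apply (f' (x + z) - f' x)) = norm (f' (x + z) - f' x)" by (simp only: norm_blinfun.rep_eq)
      also have "\<dots> \<le> L2 * norm z" using lip[of "x + z" x] by simp
      also have "\<dots> \<le> L2 * (norm v + norm w)" using z L0 by (intro mult_left_mono) auto
      finally show "onorm (blinfun_apply (f' (x + z) - f' x)) \<le> L2 * (norm v + norm w)" .
    qed auto
    then show ?thesis by (simp add: g_def eq blinfun.diff_right algebra_simps)
  qed
  then show "\<exists>L\<ge>0. \<forall>x v w. norm (\<psi> (x + v) - \<psi> (x + w) - blk_app (dx \<psi> x) (v - w)) \<le> L * (norm v + norm w) * norm (v - w)"
    using L0 by blast
qed

lemma bounded_bilinear_matrix_vector_mult: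
  "bounded_bilinear ((*v) :: real ^ 'n::finite ^ 'm::finite \<Rightarrow> real ^ 'n \<Rightarrow> real ^ 'm)"
  unfolding bilinear_conv_bounded_bilinear[symmetric] bilinear_def
proof (intro conjI allI linearI)
  fix A B :: "real ^ 'n ^ 'm" and v w :: "real ^ 'n" and c :: real
  show "A *v (v + w) = A *v v + A *v w" "(A + B) *v v = A *v v + B *v v"
    by (simp_all add: matrix_vector_mult_add_rdistrib matrix_vector_right_distrib)
  show "A *v (c *\<^sub>R v) = c *\<^sub>R (A *v v)" by (simp add: matrix_vector_mult_scaleR)
  show "(c *\<^sub>R A) *v v = c *\<^sub>R (A *v v)" by (simp add: scaleR_matrix_vector_assoc[symmetric])
qed

text \<open>What the adapted condition provides, in usable form: L1 bounds the first derivative of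
  \<psi>, L2 its second-order remainders, and c is the eigenvalue bound for the conditional Gram
  matrix. The latter is rewritten for all vectors v at once, so that one null set suffices.\<close>

locale constrained = prob_space \<mu> for \<mu> :: "'d::finite path measure" +
  fixes \<psi> :: "'d path \<Rightarrow> real ^ 'l::finite" and L1 L2 c :: real
  assumes sets_mu [measurable_cong]: "sets \<mu> = sets borel"
    and integrable_norm: "integrable \<mu> norm"
    and C1_psi: "C1 \<psi>"
    and L1: "0 \<le> L1" "\<And>x v. norm (blk_app (dx \<psi> x) v) \<le> L1 * norm v"
    and L2: "0 \<le> L2"
      "\<And>x v w. norm (\<psi> (x + v) - \<psi> (x + w) - blk_app (dx \<psi> x) (v - w)) \<le> L2 * (norm v + norm w) * norm (v - w)"
    and cond_psi: "AE x in \<mu>. cond_ex \<mu> fst \<psi> x = 0"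
    and c_pos: "0 < c"
    and coercive: "AE x in \<mu>. \<forall>v. c * (v \<bullet> v) \<le> v \<bullet> (cond_ex \<mu> fst (\<lambda>y. dx2 \<psi> y ** transpose (dx2 \<psi> y)) x *v v)"
begin

sublocale conditioning \<mu> "fst :: 'd path \<Rightarrow> real ^ 'd"
  by unfold_locales measurable

definition gram :: "'d path \<Rightarrow> real ^ 'l ^ 'l" where
  "gram = cond_ex \<mu> fst (\<lambda>y. dx2 \<psi> y ** transpose (dx2 \<psi> y))"

text \<open>To first order a displacement by \<open>lift h\<close> changes \<psi> by the Gram
  integrand applied to h, which is coercive after conditioning. The first component stays untouched
  although h is merely measurable.\<close>

definition lift :: "('d path \<Rightarrow> real ^ 'l) \<Rightarrow> 'd path \<Rightarrow> 'd path" where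
  "lift h x = (0, transpose (dx2 \<psi> x) *v h x)"

section \<open>Measurability, integrability and linear bounds for displaced constraints\<close>

lemma measurable_borel_eq: "borel_measurable \<mu> = borel_measurable borel"
  using sets_mu by (auto cong: measurable_cong_sets)

lemma measurable_psi [measurable]: "\<psi> \<in> borel_measurable borel"
  using C1_imp_continuous_on[OF C1_psi] by (rule borel_measurable_continuous_onI)

lemmas measurable_dx_psi [measurable] = C1_measurable_dx[OF C1_psi]

lemma measurable_gram_F [measurable]: "gram \<in> borel_measurable \<F>"
  unfolding gram_def by measurable

lemma measurable_gram [measurable]: "gram \<in> borel_measurable \<mu>"
  by (rule F_measurable_M) measurable

lemma measurable_lift [measurable]: "h \<in> borel_measurable \<mu> \<Longrightarrow> lift h \<in> borel_measurable \<mu>"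
  unfolding lift_def[abs_def] measurable_borel_eq by measurable

lemma norm_transpose_dx2_le: "norm (transpose (dx2 \<psi> x) *v w) \<le> L1 * norm w"
proof (cases "transpose (dx2 \<psi> x) *v w = 0")
  case False
  define z where "z = transpose (dx2 \<psi> x) *v w"
  have "norm z * norm z = z \<bullet> z" by (simp add: power2_norm_eq_inner[symmetric] power2_eq_square)
  also have "\<dots> = w \<bullet> (dx2 \<psi> x *v z)"
    unfolding z_def by (metis dot_lmul_matrix vector_transpose_matrix transpose_transpose)
  also have "\<dots> = w \<bullet> blk_app (dx \<psi> x) (0, z)" by (simp add: blk_app_def dx_def)
  also have "\<dots> \<le> norm w * (L1 * norm (0 :: real ^ 'd, z))"
    by (rule order_trans[OF norm_cauchy_schwarz]) (intro mult_left_mono L1 norm_ge_zero)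
  finally have "norm z * norm z \<le> L1 * norm w * norm z" by (simp add: norm_prod_def mult_ac)
  then show ?thesis using False by (simp add: z_def mult_le_cancel_right_pos)
qed (use L1 in simp)

lemma norm_lift_le: "norm (lift h x) \<le> L1 * norm (h x)"
  using norm_transpose_dx2_le[of x "h x"] by (simp add: lift_def norm_prod_def)

lemma lift_diff: "lift h x - lift h' x = lift (\<lambda>x. h x - h' x) x"
  by (simp add: lift_def matrix_vector_mult_diff_distrib)

lemma blk_app_lift: "blk_app (dx \<psi> x) (lift h x) = (dx2 \<psi> x ** transpose (dx2 \<psi> x)) *v h x"
  by (simp add: blk_app_def dx_def lift_def matrix_vector_mul_assoc del: transpose_matrix_vector)

lemma integrable_of_AE_bound:
  fixes f :: "'d path \<Rightarrow> 'b::euclidean_space"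
  shows "f \<in> borel_measurable \<mu> \<Longrightarrow> AE x in \<mu>. norm (f x) \<le> B \<Longrightarrow> integrable \<mu> f"
  by (rule integrable_const_bound)

lemma norm_gram_integrand: "norm (dx2 \<psi> x ** transpose (dx2 \<psi> x)) \<le> real CARD('l) * (L1 * L1)"
proof -
  have "norm (dx2 \<psi> x ** transpose (dx2 \<psi> x)) \<le> (\<Sum>i\<in>UNIV. norm ((dx2 \<psi> x ** transpose (dx2 \<psi> x)) $ i))"
    by (rule norm_vec_le_sum)
  also have "\<dots> \<le> (\<Sum>i::'l\<in>UNIV. L1 * L1)"
  proof (rule sum_mono)
    fix i :: 'l
    have "(dx2 \<psi> x ** transpose (dx2 \<psi> x)) $ i = blk_app (dx \<psi> x) (lift (\<lambda>_. axis i 1) x)"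
      unfolding blk_app_lift
      by (simp add: vec_eq_iff matrix_vector_mul_component inner_axis)
        (simp add: matrix_matrix_mult_def transpose_def mult.commute)
    also have "norm \<dots> \<le> L1 * (L1 * norm (axis i 1 :: real ^ 'l))"
      by (rule order_trans[OF L1(2)]) (intro mult_left_mono norm_lift_le L1)
    finally show "norm ((dx2 \<psi> x ** transpose (dx2 \<psi> x)) $ i) \<le> L1 * L1" by simp
  qed
  finally show ?thesis by simp
qed

lemma integrable_psi:
  assumes [measurable]: "V \<in> borel_measurable \<mu>" and b: "AE x in \<mu>. norm (V x) \<le> b"
  shows "integrable \<mu> (\<lambda>x. \<psi> (x + V x))"
proof (rule Bochner_Integration.integrable_bound)
  show "integrable \<mu> (\<lambda>x. norm (\<psi> 0) + L1 * (norm x + b))"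
    using integrable_norm by auto
  show "AE x in \<mu>. norm (\<psi> (x + V x)) \<le> norm (norm (\<psi> 0) + L1 * (norm x + b))"
    using b
  proof (rule eventually_mono)
    fix x assume x: "norm (V x) \<le> b"
    have "norm (\<psi> (x + V x) - \<psi> 0) \<le> L1 * norm ((x + V x) - 0)"
    proof (rule differentiable_bound[of UNIV \<psi> "\<lambda>x. blk_app (dx \<psi> x)"])
      show "onorm (blk_app (dx \<psi> y)) \<le> L1" for y by (rule onorm_le) (rule L1)
    qed (auto intro: has_derivative_at_withinI C1_has_derivative[OF C1_psi])
    also have "\<dots> \<le> L1 * (norm x + b)" using x L1(1) norm_triangle_ineq[of x "V x"] by (intro mult_left_mono) auto
    finally have "norm (\<psi> (x + V x)) \<le> norm (\<psi> 0) + L1 * (norm x + b)"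
      using norm_triangle_sub[of "\<psi> (x + V x)" "\<psi> 0"] by simp
    then show "norm (\<psi> (x + V x)) \<le> norm (norm (\<psi> 0) + L1 * (norm x + b))" by simp
  qed
qed measurable

lemma integrable_blk_psi:
  assumes [measurable]: "V \<in> borel_measurable \<mu>" and b: "AE x in \<mu>. norm (V x) \<le> b"
  shows "integrable \<mu> (\<lambda>x. blk_app (dx \<psi> x) (V x))"
proof (rule integrable_of_AE_bound)
  show "AE x in \<mu>. norm (blk_app (dx \<psi> x) (V x)) \<le> L1 * b"
    using b by (rule eventually_mono) (rule order_trans[OF L1(2)], use L1(1) in \<open>simp add: mult_left_mono\<close>)
qed measurable

lemma cond_ex_blk_lift:
  assumes h [measurable]: "h \<in> borel_measurable \<F>" and b: "AE x in \<mu>. norm (h x) \<le> \<beta>"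
  shows "AE x in \<mu>. cond_ex \<mu> fst (\<lambda>x. blk_app (dx \<psi> x) (lift h x)) x = gram x *v h x"
proof -
  have [measurable]: "h \<in> borel_measurable \<mu>" by (rule F_measurable_M[OF h])
  have flip: "bounded_bilinear (\<lambda>v (A :: real ^ 'l ^ 'l). A *v v)"
    by (rule bounded_bilinear.flip[OF bounded_bilinear_matrix_vector_mult])
  have "integrable \<mu> (\<lambda>x. norm (h x) * norm (dx2 \<psi> x ** transpose (dx2 \<psi> x)))"
  proof (rule integrable_of_AE_bound)
    show "AE x in \<mu>. norm (norm (h x) * norm (dx2 \<psi> x ** transpose (dx2 \<psi> x))) \<le> \<beta> * (real CARD('l) * (L1 * L1))"
      using b
    proof (rule eventually_mono)
      fix x assume x: "norm (h x) \<le> \<beta>"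
      then have "norm (h x) * norm (dx2 \<psi> x ** transpose (dx2 \<psi> x)) \<le> \<beta> * (real CARD('l) * (L1 * L1))"
        by (intro mult_mono norm_gram_integrand) (auto intro: order_trans[OF norm_ge_zero])
      then show "norm (norm (h x) * norm (dx2 \<psi> x ** transpose (dx2 \<psi> x))) \<le> \<beta> * (real CARD('l) * (L1 * L1))" by simp
    qed
  qed measurable
  from cond_ex_bilinear(1)[OF flip h _ this] show ?thesis
    unfolding blk_app_lift gram_def by simp
qed

text \<open>Origin of the factors: \<open>CARD('l)\<close> is the price of bounding a conditional
  expectation coordinatewise; for the total displacements V and V', the sum |V| + |V'| is at most 2
  (1 + L1) (b + \<beta>), and |V - V'| is at most (1 + L1) (d + |h - h'|).\<close>

definition K\<psi> :: real where "K\<psi> = real CARD('l) * (2 * L2 * (1 + L1)\<^sup>2)"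

lemma K\<psi>_nonneg: "0 \<le> K\<psi>" using L2 by (simp add: K\<psi>_def)

text \<open>The constraint \<open>h \<mapsto> E\<^sub>1[\<psi>(X + U + (0, (\<partial>\<^sub>2\<psi>)\<^sup>T h))]\<close> is a small perturbation of the linear map given
  by the Gram matrix, uniformly in the conditioning variable because \<open>\<psi>\<close> has bounded second derivatives.\<close>

lemma constraint_estimate:
  assumes [measurable]: "U \<in> borel_measurable \<mu>" "U' \<in> borel_measurable \<mu>"
    and h [measurable]: "h \<in> borel_measurable \<F>" "h' \<in> borel_measurable \<F>"
    and b: "AE x in \<mu>. norm (U x) \<le> b" "AE x in \<mu>. norm (U' x) \<le> b"
    and \<beta>: "AE x in \<mu>. norm (h x) \<le> \<beta>" "AE x in \<mu>. norm (h' x) \<le> \<beta>"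
    and d: "AE x in \<mu>. norm (U x - U' x) \<le> d" and nonneg: "0 \<le> b" "0 \<le> \<beta>" "0 \<le> d"
  shows "AE x in \<mu>. norm (cond_ex \<mu> fst (\<lambda>x. \<psi> (x + (U x + lift h x))) x
      - cond_ex \<mu> fst (\<lambda>x. \<psi> (x + (U' x + lift h' x))) x
      - cond_ex \<mu> fst (\<lambda>x. blk_app (dx \<psi> x) (U x - U' x)) x - gram x *v (h x - h' x))
    \<le> K\<psi> * (b + \<beta>) * (d + norm (h x - h' x))"
proof -
  have [measurable]: "h \<in> borel_measurable \<mu>" "h' \<in> borel_measurable \<mu>" by (intro F_measurable_M h)+
  define V where "V = (\<lambda>x. U x + lift h x)"
  define V' where "V' = (\<lambda>x. U' x + lift h' x)"
  define k where "k = (\<lambda>x. h x - h' x)"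
  have [measurable]: "V \<in> borel_measurable \<mu>" "V' \<in> borel_measurable \<mu>" "k \<in> borel_measurable \<F>" "k \<in> borel_measurable \<mu>"
    unfolding V_def V'_def k_def by measurable
  have Vb: "AE x in \<mu>. norm (V x) \<le> b + L1 * \<beta>"
    using b(1) \<beta>(1)
  proof eventually_elim
    case (elim x)
    have "norm (lift h x) \<le> L1 * \<beta>" using norm_lift_le[of h x] mult_left_mono[OF elim(2) L1(1)] by simp
    then show ?case unfolding V_def by (intro norm_triangle_mono elim)
  qed
  have V'b: "AE x in \<mu>. norm (V' x) \<le> b + L1 * \<beta>"
    using b(2) \<beta>(2)
  proof eventually_elim
    case (elim x)
    have "norm (lift h' x) \<le> L1 * \<beta>" using norm_lift_le[of h' x] mult_left_mono[OF elim(2) L1(1)] by simp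
    then show ?case unfolding V'_def by (intro norm_triangle_mono elim)
  qed
  have kb: "AE x in \<mu>. norm (k x) \<le> \<beta> + \<beta>"
    using \<beta> by eventually_elim (auto simp: k_def intro: order_trans[OF norm_triangle_ineq4])
  have VV: "V x - V' x = (U x - U' x) + lift k x" for x
    using lift_diff[of h x h'] by (simp add: V_def V'_def k_def)
  define f where "f = (\<lambda>x. \<psi> (x + V x) - \<psi> (x + V' x) - blk_app (dx \<psi> x) (V x - V' x))"
  define g where "g = (\<lambda>x. 2 * L2 * (1 + L1)\<^sup>2 * (b + \<beta>) * (d + norm (k x)))"
  have lb: "AE x in \<mu>. norm (lift k x) \<le> L1 * (\<beta> + \<beta>)"
    using kb by (rule eventually_mono) (rule order_trans[OF norm_lift_le], use L1(1) in \<open>simp add: mult_left_mono\<close>)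
  have i1: "integrable \<mu> (\<lambda>x. \<psi> (x + V x))" "integrable \<mu> (\<lambda>x. \<psi> (x + V' x))"
    by (intro integrable_psi[OF _ Vb] integrable_psi[OF _ V'b]; measurable)+
  have i2: "integrable \<mu> (\<lambda>x. blk_app (dx \<psi> x) (U x - U' x))" "integrable \<mu> (\<lambda>x. blk_app (dx \<psi> x) (lift k x))"
    by (intro integrable_blk_psi[OF _ d] integrable_blk_psi[OF _ lb]; measurable)+
  have fe: "f x = (\<psi> (x + V x) - \<psi> (x + V' x)) - (blk_app (dx \<psi> x) (U x - U' x) + blk_app (dx \<psi> x) (lift k x))" for x
    by (simp add: f_def VV blk_app.add_right)
  have fi: "integrable \<mu> f" unfolding fe[abs_def] using i1 i2 by auto
  have gi: "integrable \<mu> g"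
  proof (rule integrable_of_AE_bound)
    show "AE x in \<mu>. norm (g x) \<le> 2 * L2 * (1 + L1)\<^sup>2 * (b + \<beta>) * (d + (\<beta> + \<beta>))"
      using kb
    proof (rule eventually_mono)
      fix x assume "norm (k x) \<le> \<beta> + \<beta>"
      then have "g x \<le> 2 * L2 * (1 + L1)\<^sup>2 * (b + \<beta>) * (d + (\<beta> + \<beta>))"
        unfolding g_def using L2 nonneg by (intro mult_left_mono) auto
      moreover have "0 \<le> g x" unfolding g_def using L2 nonneg by simp
      ultimately show "norm (g x) \<le> 2 * L2 * (1 + L1)\<^sup>2 * (b + \<beta>) * (d + (\<beta> + \<beta>))" by simp
    qed
  qed (simp add: g_def)
  have "AE x in \<mu>. norm (f x) \<le> g x"
    using Vb V'b d
  proof eventually_elim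
    case (elim x)
    have "norm (f x) \<le> L2 * (norm (V x) + norm (V' x)) * norm (V x - V' x)"
      unfolding f_def by (rule L2)
    also have "\<dots> \<le> L2 * ((b + L1 * \<beta>) + (b + L1 * \<beta>)) * (d + L1 * norm (k x))"
    proof (intro mult_mono mult_left_mono add_mono elim L2)
      show "norm (V x - V' x) \<le> d + L1 * norm (k x)"
        unfolding VV by (intro norm_triangle_mono elim norm_lift_le)
      show "0 \<le> L2 * ((b + L1 * \<beta>) + (b + L1 * \<beta>))" using L1 L2 nonneg by simp
    qed auto
    also have "\<dots> = 2 * L2 * ((b + L1 * \<beta>) * (d + L1 * norm (k x)))" by (simp add: algebra_simps)
    also have "\<dots> \<le> 2 * L2 * (((1 + L1) * (b + \<beta>)) * ((1 + L1) * (d + norm (k x))))"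
      using L1(1) L2(1) nonneg by (intro mult_left_mono mult_mono) (auto simp: algebra_simps)
    also have "\<dots> = g x" by (simp add: g_def power2_eq_square)
    finally show ?case .
  qed
  moreover have "g \<in> borel_measurable \<F>" unfolding g_def by measurable
  ultimately have A: "AE x in \<mu>. norm (cond_ex \<mu> fst f x) \<le> real DIM(real ^ 'l) * g x"
    using cond_ex_norm_le[OF fi gi] by simp
  have B: "AE x in \<mu>. cond_ex \<mu> fst f x = cond_ex \<mu> fst (\<lambda>x. \<psi> (x + V x) - \<psi> (x + V' x)) x
      - cond_ex \<mu> fst (\<lambda>x. blk_app (dx \<psi> x) (U x - U' x) + blk_app (dx \<psi> x) (lift k x)) x"
    unfolding fe[abs_def] using i1 i2 by (intro cond_ex_diff) auto
  have C: "AE x in \<mu>. cond_ex \<mu> fst (\<lambda>x. \<psi> (x + V x) - \<psi> (x + V' x)) x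
      = cond_ex \<mu> fst (\<lambda>x. \<psi> (x + V x)) x - cond_ex \<mu> fst (\<lambda>x. \<psi> (x + V' x)) x"
    by (rule cond_ex_diff[OF i1])
  have D: "AE x in \<mu>. cond_ex \<mu> fst (\<lambda>x. blk_app (dx \<psi> x) (U x - U' x) + blk_app (dx \<psi> x) (lift k x)) x
      = cond_ex \<mu> fst (\<lambda>x. blk_app (dx \<psi> x) (U x - U' x)) x + cond_ex \<mu> fst (\<lambda>x. blk_app (dx \<psi> x) (lift k x)) x"
    by (rule cond_ex_add[OF i2])
  have E: "AE x in \<mu>. cond_ex \<mu> fst (\<lambda>x. blk_app (dx \<psi> x) (lift k x)) x = gram x *v k x"
    by (rule cond_ex_blk_lift[OF _ kb]) measurable
  show ?thesis
    using A B C D E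
  proof eventually_elim
    case (elim x)
    have "cond_ex \<mu> fst f x = cond_ex \<mu> fst (\<lambda>x. \<psi> (x + V x)) x - cond_ex \<mu> fst (\<lambda>x. \<psi> (x + V' x)) x
      - cond_ex \<mu> fst (\<lambda>x. blk_app (dx \<psi> x) (U x - U' x)) x - gram x *v k x"
      using elim by simp
    moreover have "real DIM(real ^ 'l) * g x = K\<psi> * (b + \<beta>) * (d + norm (k x))"
      by (simp add: g_def K\<psi>_def)
    ultimately show ?case using elim(1) unfolding V_def V'_def k_def by simp
  qed
qed

lemma cond_ex_blk_le:
  assumes [measurable]: "U \<in> borel_measurable \<mu>" and d: "AE x in \<mu>. norm (U x) \<le> d"
  shows "AE x in \<mu>. norm (cond_ex \<mu> fst (\<lambda>x. blk_app (dx \<psi> x) (U x)) x) \<le> real CARD('l) * L1 * d"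
proof -
  have "AE x in \<mu>. norm (blk_app (dx \<psi> x) (U x)) \<le> L1 * d"
    using d by (rule eventually_mono) (rule order_trans[OF L1(2)], use L1(1) in \<open>simp add: mult_left_mono\<close>)
  from cond_ex_norm_le[OF integrable_blk_psi[OF _ d] _ _ this] show ?thesis by (simp add: mult.assoc)
qed

lemma gram_coercive: "AE x in \<mu>. \<forall>v. c * norm v \<le> norm (gram x *v v)"
  using coercive unfolding gram_def[symmetric]
  by (rule eventually_mono) (auto intro!: coercive_norm_le)

text \<open>The first Newton step below has size at most \<open>K0 * b / 2\<close> and the steps halve, so that \<open>K0 * b\<close>
  bounds the solution.\<close>

definition K0 :: real where "K0 = 2 * real CARD('l) * L1 / c + 1"

lemma K0_pos: "K0 > 0" using L1 c_pos by (simp add: K0_def add_nonneg_pos)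

text \<open>Subtract the two constraint equations: the Gram matrix applied to h - h' equals minus
  the linear effect of U - U', up to c/2 (d + |h - h'|). Coercivity absorbs the part with h - h'.
  Applied to two parameters a and a', this gives the continuity in a required for the fixed
  point.\<close>

lemma solution_lipschitz:
  assumes [measurable]: "U \<in> borel_measurable \<mu>" "U' \<in> borel_measurable \<mu>"
    and h [measurable]: "h \<in> borel_measurable \<F>" "h' \<in> borel_measurable \<F>"
    and b: "AE x in \<mu>. norm (U x) \<le> b" "AE x in \<mu>. norm (U' x) \<le> b"
    and \<beta>: "AE x in \<mu>. norm (h x) \<le> \<beta>" "AE x in \<mu>. norm (h' x) \<le> \<beta>"
    and d: "AE x in \<mu>. norm (U x - U' x) \<le> d" and nonneg: "0 \<le> b" "0 \<le> \<beta>" "0 \<le> d"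
    and small: "K\<psi> * (b + \<beta>) \<le> c / 2"
    and sol: "AE x in \<mu>. cond_ex \<mu> fst (\<lambda>x. \<psi> (x + (U x + lift h x))) x = 0"
      "AE x in \<mu>. cond_ex \<mu> fst (\<lambda>x. \<psi> (x + (U' x + lift h' x))) x = 0"
  shows "AE x in \<mu>. norm (h x - h' x) \<le> K0 * d"
proof -
  have "AE x in \<mu>. norm (cond_ex \<mu> fst (\<lambda>x. blk_app (dx \<psi> x) (U x - U' x)) x) \<le> real CARD('l) * L1 * d"
    by (rule cond_ex_blk_le[OF _ d]) measurable
  with constraint_estimate[OF assms(1-12)] sol gram_coercive show ?thesis
  proof eventually_elim
    case (elim x)
    define k where "k = norm (h x - h' x)"
    define E where "E = cond_ex \<mu> fst (\<lambda>x. blk_app (dx \<psi> x) (U x - U' x)) x"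
    have "norm (- E - gram x *v (h x - h' x)) \<le> K\<psi> * (b + \<beta>) * (d + k)"
      using elim by (simp add: k_def E_def)
    also have "\<dots> \<le> c / 2 * (d + k)" using small nonneg by (intro mult_right_mono) (auto simp: k_def)
    finally have "norm (- E - gram x *v (h x - h' x)) \<le> c / 2 * (d + k)" .
    moreover have "norm (gram x *v (h x - h' x)) \<le> norm E + norm (- E - gram x *v (h x - h' x))"
      using norm_triangle_ineq4[of "- E" "- E - gram x *v (h x - h' x)"] by simp
    moreover have "c * k \<le> norm (gram x *v (h x - h' x))" using elim by (simp add: k_def)
    ultimately have "c * k \<le> real CARD('l) * L1 * d + c / 2 * (d + k)" using elim by (simp add: E_def)
    then have "c * k \<le> 2 * real CARD('l) * L1 * d + c * d" by (simp add: field_simps)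
    also have "\<dots> = c * (K0 * d)" using c_pos by (simp add: K0_def field_simps)
    finally have "c * k \<le> c * (K0 * d)" .
    then show ?case using c_pos by (simp add: k_def)
  qed
qed

text \<open>Compare with zero field and zero multiplier, where the constraint holds because
  E_1[\<psi>] = 0. Field and solution are both of order b, so the remainder is quadratic in
  b.\<close>

lemma solution_expansion:
  assumes [measurable]: "U \<in> borel_measurable \<mu>"
    and h [measurable]: "h \<in> borel_measurable \<F>"
    and b: "AE x in \<mu>. norm (U x) \<le> b" and \<beta>: "AE x in \<mu>. norm (h x) \<le> K0 * b" and nonneg: "0 \<le> b"
    and sol: "AE x in \<mu>. cond_ex \<mu> fst (\<lambda>x. \<psi> (x + (U x + lift h x))) x = 0"
  shows "AE x in \<mu>. norm (gram x *v h x + cond_ex \<mu> fst (\<lambda>x. blk_app (dx \<psi> x) (U x)) x) \<le> K\<psi> * (1 + K0)\<^sup>2 * b\<^sup>2"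
proof -
  have "AE x in \<mu>. norm (cond_ex \<mu> fst (\<lambda>x. \<psi> (x + (U x + lift h x))) x
      - cond_ex \<mu> fst (\<lambda>x. \<psi> (x + (0 + lift (\<lambda>_. 0) x))) x
      - cond_ex \<mu> fst (\<lambda>x. blk_app (dx \<psi> x) (U x - 0)) x - gram x *v (h x - 0))
    \<le> K\<psi> * (b + K0 * b) * (b + norm (h x - 0))"
    using b \<beta> nonneg K0_pos by (intro constraint_estimate) auto
  with sol cond_psi \<beta> show ?thesis
  proof eventually_elim
    case (elim x)
    have "lift (\<lambda>_. 0) y = 0" for y by (simp add: lift_def zero_prod_def)
    then have "norm (- cond_ex \<mu> fst (\<lambda>x. blk_app (dx \<psi> x) (U x)) x - gram x *v h x) \<le> K\<psi> * (b + K0 * b) * (b + norm (h x))"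
      using elim by simp
    moreover have "- cond_ex \<mu> fst (\<lambda>x. blk_app (dx \<psi> x) (U x)) x - gram x *v h x
        = - (gram x *v h x + cond_ex \<mu> fst (\<lambda>x. blk_app (dx \<psi> x) (U x)) x)" by simp
    ultimately have "norm (gram x *v h x + cond_ex \<mu> fst (\<lambda>x. blk_app (dx \<psi> x) (U x)) x) \<le> K\<psi> * (b + K0 * b) * (b + norm (h x))"
      by (simp only: norm_minus_cancel)
    also have "\<dots> \<le> K\<psi> * (b + K0 * b) * (b + K0 * b)"
      using elim nonneg K0_pos K\<psi>_nonneg by (intro mult_left_mono) auto
    also have "\<dots> = K\<psi> * (1 + K0)\<^sup>2 * b\<^sup>2" by (simp add: power2_eq_square algebra_simps)
    finally show ?case by simp
  qed
qed

section \<open>Inverting the Gram matrix and solving the constraint\<close>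

lemma gram_inverse: "AE x in \<mu>. \<forall>v. gram x *v (cramer_inv (gram x) *v v) = v \<and> cramer_inv (gram x) *v (gram x *v v) = v"
  using coercive unfolding gram_def[symmetric]
proof (rule eventually_mono)
  fix x assume "\<forall>v. c * (v \<bullet> v) \<le> v \<bullet> (gram x *v v)"
  then have "det (gram x) \<noteq> 0" using c_pos by (intro coercive_det) auto
  then show "\<forall>v. gram x *v (cramer_inv (gram x) *v v) = v \<and> cramer_inv (gram x) *v (gram x *v v) = v"
    by (simp add: cramer_inv_mult)
qed

lemma norm_gram_inverse_le: "AE x in \<mu>. \<forall>v. c * norm (cramer_inv (gram x) *v v) \<le> norm v"
  using gram_inverse gram_coercive by eventually_elim metis


text \<open>Newton iteration with the Gram matrix in place of the true derivative; each step at least halves the defect.\<close>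

lemma solution_exists:
  assumes [measurable]: "U \<in> borel_measurable \<mu>" and b: "AE x in \<mu>. norm (U x) \<le> b" and b0: "0 \<le> b"
    and small: "K\<psi> * (b + K0 * b) \<le> c / 2"
  shows "\<exists>h\<in>borel_measurable \<F>. (AE x in \<mu>. norm (h x) \<le> K0 * b) \<and>
    (AE x in \<mu>. cond_ex \<mu> fst (\<lambda>x. \<psi> (x + (U x + lift h x))) x = 0)"
proof -
  define Ee where "Ee = (\<lambda>h. cond_ex \<mu> fst (\<lambda>x. \<psi> (x + (U x + lift h x))))"
  define hs where "hs = rec_nat (\<lambda>_. 0) (\<lambda>_ h x. h x - cramer_inv (gram x) *v Ee h x)"
  have hs0: "hs 0 = (\<lambda>_. 0)" and hsS: "hs (Suc n) = (\<lambda>x. hs n x - cramer_inv (gram x) *v Ee (hs n) x)" for n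
    by (simp_all add: hs_def)
  have EeF: "Ee h \<in> borel_measurable \<F>" for h unfolding Ee_def by (rule measurable_cond_ex_F)
  have hsF: "hs n \<in> borel_measurable \<F>" for n
  proof (induction n)
    case (Suc n)
    note [measurable] = Suc EeF
    show ?case unfolding hsS by measurable
  qed (simp add: hs0)
  define \<beta> where "\<beta> = K0 * b"
  have \<beta>0: "0 \<le> \<beta>" using b0 K0_pos by (simp add: \<beta>_def)
  have sm: "K\<psi> * (b + \<beta>) * t \<le> c / 2 * t" if "0 \<le> t" for t
    using small that unfolding \<beta>_def by (intro mult_right_mono)
  have est: "AE x in \<mu>. norm (Ee h x - Ee h' x - gram x *v (h x - h' x)) \<le> c / 2 * norm (h x - h' x)"
    if "h \<in> borel_measurable \<F>" "h' \<in> borel_measurable \<F>" "AE x in \<mu>. norm (h x) \<le> \<beta>" "AE x in \<mu>. norm (h' x) \<le> \<beta>" for h h'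
  proof -
    have "AE x in \<mu>. norm (cond_ex \<mu> fst (\<lambda>x. \<psi> (x + (U x + lift h x))) x
      - cond_ex \<mu> fst (\<lambda>x. \<psi> (x + (U x + lift h' x))) x
      - cond_ex \<mu> fst (\<lambda>x. blk_app (dx \<psi> x) (U x - U x)) x - gram x *v (h x - h' x))
      \<le> K\<psi> * (b + \<beta>) * (0 + norm (h x - h' x))"
      using that b b0 \<beta>0 by (intro constraint_estimate) auto
    moreover have "AE x in \<mu>. norm (cond_ex \<mu> fst (\<lambda>x. blk_app (dx \<psi> x) (U x - U x)) x) \<le> real CARD('l) * L1 * 0"
      by (rule cond_ex_blk_le) auto
    ultimately show ?thesis
    proof eventually_elim
      case (elim x)
      have z: "cond_ex \<mu> fst (\<lambda>x. blk_app (dx \<psi> x) (U x - U x)) x = 0" using elim(2) by simp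
      show ?case using elim(1) sm[of "norm (h x - h' x)"] unfolding Ee_def z by simp
    qed
  qed
  define B where "B = K0 / 2 * b"
  have B0: "0 \<le> B" using b0 K0_pos by (simp add: B_def)
  \<comment> \<open>The starting defect is compared with E_1[\<psi>] = 0. It consists of the linear
    effect of U, at most CARD('l) L1 b, and a remainder c b / 2; the sum is exactly c B by the
    choice of K0.\<close>
  have base: "AE x in \<mu>. norm (Ee (\<lambda>_. 0) x) \<le> c * B"
  proof -
    have "AE x in \<mu>. norm (cond_ex \<mu> fst (\<lambda>x. \<psi> (x + (U x + lift (\<lambda>_. 0) x))) x
      - cond_ex \<mu> fst (\<lambda>x. \<psi> (x + (0 + lift (\<lambda>_. 0) x))) x
      - cond_ex \<mu> fst (\<lambda>x. blk_app (dx \<psi> x) (U x - 0)) x - gram x *v (0 - 0))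
      \<le> K\<psi> * (b + \<beta>) * (b + norm (0 - 0 :: real ^ 'l))"
      using b b0 \<beta>0 by (intro constraint_estimate) auto
    moreover have "AE x in \<mu>. norm (cond_ex \<mu> fst (\<lambda>x. blk_app (dx \<psi> x) (U x)) x) \<le> real CARD('l) * L1 * b"
      by (rule cond_ex_blk_le[OF _ b]) auto
    ultimately show ?thesis using cond_psi
    proof eventually_elim
      case (elim x)
      have l0: "lift (\<lambda>_. 0) y = 0" for y by (simp add: lift_def zero_prod_def)
      have "norm (Ee (\<lambda>_. 0) x - cond_ex \<mu> fst (\<lambda>x. blk_app (dx \<psi> x) (U x)) x) \<le> c / 2 * b"
        using elim(1,3) sm[OF b0] by (simp add: Ee_def l0)
      then have "norm (Ee (\<lambda>_. 0) x) \<le> real CARD('l) * L1 * b + c / 2 * b"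
        using elim(2) norm_triangle_sub[of "Ee (\<lambda>_. 0) x" "cond_ex \<mu> fst (\<lambda>x. blk_app (dx \<psi> x) (U x)) x"] by simp
      also have "\<dots> = c * B" using c_pos by (simp add: B_def K0_def field_simps)
      finally show ?case .
    qed
  qed
  \<comment> \<open>The partial geometric sum keeps every iterate within \<beta> = 2 B, where
    \<open>est\<close> is valid. The inverse Gram matrix costs 1/c and \<open>est\<close> returns
    c/2, so the defect halves at each step.\<close>
  have ind: "AE x in \<mu>. norm (hs n x) \<le> 2 * B * (1 - (1/2)^n) \<and> norm (Ee (hs n) x) \<le> c * B * (1/2)^n" for n
  proof (induction n)
    case 0
    then show ?case using base by (simp add: hs0)
  next
    case (Suc n)
    have ge: "B * (1/2)^n \<ge> 0" for n using B0 by simp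
    have 1: "AE x in \<mu>. norm (hs (Suc n) x) \<le> 2 * B * (1 - (1/2)^Suc n)"
      using Suc norm_gram_inverse_le
    proof eventually_elim
      case (elim x)
      have "c * norm (cramer_inv (gram x) *v Ee (hs n) x) \<le> c * (B * (1/2)^n)" using elim by (auto intro: order_trans simp: mult.assoc)
      then have "norm (cramer_inv (gram x) *v Ee (hs n) x) \<le> B * (1/2)^n" using c_pos by simp
      then have "norm (hs (Suc n) x) \<le> 2 * B * (1 - (1/2)^n) + B * (1/2)^n"
        unfolding hsS using elim norm_triangle_ineq4[of "hs n x" "cramer_inv (gram x) *v Ee (hs n) x"] by linarith
      then show ?case by (simp add: algebra_simps)
    qed
    have le\<beta>: "2 * B * (1 - (1/2)^n) \<le> \<beta>" for n
      using ge[of n] unfolding right_diff_distrib by (simp add: B_def \<beta>_def)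
    have 2: "AE x in \<mu>. norm (Ee (hs (Suc n)) x - Ee (hs n) x - gram x *v (hs (Suc n) x - hs n x)) \<le> c / 2 * norm (hs (Suc n) x - hs n x)"
    proof (rule est[OF hsF hsF])
      show "AE x in \<mu>. norm (hs (Suc n) x) \<le> \<beta>" using 1 by (rule eventually_mono) (rule order_trans[OF _ le\<beta>])
      show "AE x in \<mu>. norm (hs n x) \<le> \<beta>" using Suc by (rule eventually_mono) (blast intro: order_trans[OF _ le\<beta>])
    qed
    from 1 2 Suc norm_gram_inverse_le gram_inverse show ?case
    proof eventually_elim
      case (elim x)
      have d: "hs (Suc n) x - hs n x = - (cramer_inv (gram x) *v Ee (hs n) x)" by (simp add: hsS)
      \<comment> \<open>By the choice of the step this term cancels the old defect in
        \<open>est\<close>, which then bounds the new defect alone.\<close>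
      have g: "gram x *v (hs (Suc n) x - hs n x) = - Ee (hs n) x" unfolding d using elim(5) by (simp add: linear_neg[OF matrix_vector_mul_linear])
      have "c * norm (hs (Suc n) x - hs n x) \<le> c * B * (1/2)^n" unfolding d using elim(3,4) by (auto intro: order_trans)
      then have "norm (Ee (hs (Suc n)) x) \<le> c * B * (1/2)^n / 2" using elim(2) unfolding g by simp
      then show ?case using elim(1) by simp
    qed
  qed
  have allind: "AE x in \<mu>. \<forall>n. norm (hs n x) \<le> \<beta> \<and> norm (Ee (hs n) x) \<le> c * B * (1/2)^n"
    unfolding AE_all_countable
  proof
    fix n
    have "2 * B * (1 - (1/2)^n) \<le> \<beta>"
      using mult_nonneg_nonneg[OF B0, of "(1/2)^n"] unfolding right_diff_distrib by (simp add: B_def \<beta>_def)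
    with ind[of n] show "AE x in \<mu>. norm (hs n x) \<le> \<beta> \<and> norm (Ee (hs n) x) \<le> c * B * (1/2)^n"
      by (elim eventually_mono) auto
  qed
  \<comment> \<open>Taking \<open>lim\<close> at every point gives measurability for the
    conditioning field everywhere, although convergence is only known almost everywhere.\<close>
  define h where "h = (\<lambda>x. lim (\<lambda>n. hs n x))"
  have hF: "h \<in> borel_measurable \<F>" unfolding h_def by (rule borel_measurable_lim_metric) (rule hsF)
  have conv: "AE x in \<mu>. (\<lambda>n. hs n x) \<longlonglongrightarrow> h x"
    using allind norm_gram_inverse_le
  proof eventually_elim
    case (elim x)
    have le: "norm (hs (Suc n) x - hs n x) \<le> B * (1/2)^n" for n
    proof -
      have "c * norm (hs (Suc n) x - hs n x) \<le> c * (B * (1/2)^n)"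
        using elim(1)[rule_format, of n] elim(2)[rule_format, of "Ee (hs n) x"] by (simp add: hsS mult.assoc)
      then show ?thesis using c_pos by simp
    qed
    have "summable (\<lambda>n. B * (1/2)^n)" by (intro summable_mult summable_geometric) simp
    then have "summable (\<lambda>n. hs (Suc n) x - hs n x)"
      by (rule summable_comparison_test'[where N=0]) (rule le)
    then have "convergent (\<lambda>n. \<Sum>i<n. hs (Suc i) x - hs i x)" by (simp add: summable_iff_convergent)
    then have "convergent (\<lambda>n. hs n x)" unfolding sum_lessThan_telescope[of "\<lambda>i. hs i x"] by (simp add: hs0)
    then show ?case unfolding h_def by (simp add: convergent_LIMSEQ_iff)
  qed
  have h\<beta>: "AE x in \<mu>. norm (h x) \<le> \<beta>"
    using conv allind
  proof eventually_elim
    case (elim x)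
    then show ?case by (intro LIMSEQ_le_const2[OF tendsto_norm[OF elim(1)]]) auto
  qed
  \<comment> \<open>The equation passes to the limit through \<open>est\<close> between h and the
    iterates; no convergence theorem for conditional expectations is involved.\<close>
  have "AE x in \<mu>. \<forall>n. norm (Ee h x - Ee (hs n) x - gram x *v (h x - hs n x)) \<le> c / 2 * norm (h x - hs n x)"
    unfolding AE_all_countable
  proof
    fix n
    have "AE x in \<mu>. norm (hs n x) \<le> \<beta>" using allind by (rule eventually_mono) blast
    then show "AE x in \<mu>. norm (Ee h x - Ee (hs n) x - gram x *v (h x - hs n x)) \<le> c / 2 * norm (h x - hs n x)"
      by (intro est hF hsF h\<beta>)
  qed
  with conv allind have "AE x in \<mu>. Ee h x = 0"
  proof eventually_elim
    case (elim x)
    have l: "(\<lambda>n. h x - hs n x) \<longlonglongrightarrow> 0" using tendsto_diff[OF tendsto_const elim(1), of "h x"] by simp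
    have E0: "(\<lambda>n. Ee (hs n) x) \<longlonglongrightarrow> 0"
    proof (rule Lim_null_comparison)
      show "eventually (\<lambda>n. norm (Ee (hs n) x) \<le> c * B * (1/2)^n) sequentially" using elim(2) by simp
      show "(\<lambda>n. c * B * (1/2)^n) \<longlonglongrightarrow> 0" by (intro tendsto_mult_right_zero LIMSEQ_power_zero) simp
    qed
    have G0: "(\<lambda>n. gram x *v (h x - hs n x)) \<longlonglongrightarrow> 0"
      using bounded_linear.tendsto[OF matrix_vector_mul_bounded_linear l] by simp
    have "(\<lambda>n. Ee h x - Ee (hs n) x - gram x *v (h x - hs n x)) \<longlonglongrightarrow> 0"
    proof (rule Lim_null_comparison)
      show "eventually (\<lambda>n. norm (Ee h x - Ee (hs n) x - gram x *v (h x - hs n x)) \<le> c / 2 * norm (h x - hs n x)) sequentially"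
        using elim(3) by simp
      show "(\<lambda>n. c / 2 * norm (h x - hs n x)) \<longlonglongrightarrow> 0" by (intro tendsto_mult_right_zero tendsto_norm_zero l)
    qed
    moreover have "(\<lambda>n. Ee h x - Ee (hs n) x - gram x *v (h x - hs n x)) \<longlonglongrightarrow> Ee h x - 0 - 0"
      by (intro tendsto_diff tendsto_const E0 G0)
    ultimately show ?case using LIMSEQ_unique by fastforce
  qed
  then show ?thesis using hF h\<beta> by (auto simp: Ee_def \<beta>_def)
qed

text \<open>To first order the Gram matrix maps \<open>h\<close> to \<open>- E\<^sub>1[(\<partial>\<psi>) U]\<close>; the multiplier therefore expresses the
  effect of the correction \<open>lift h\<close> on \<open>\<integral> \<partial>D\<close> through \<open>U\<close> alone.\<close>

definition multiplier :: "('d path \<Rightarrow> real ^ 'k::finite) \<Rightarrow> 'd path \<Rightarrow> real ^ 'l ^ 'k" where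
  "multiplier D x = cond_ex \<mu> fst (\<lambda>y. dx2 D y ** transpose (dx2 \<psi> y)) x ** cramer_inv (gram x)"

definition lin_response :: "('d path \<Rightarrow> real ^ 'k::finite) \<Rightarrow> ('d path \<Rightarrow> 'd path) \<Rightarrow> real ^ 'k" where
  "lin_response D U = (\<integral>x. blk_app (dx D x) (U x) \<partial>\<mu>) - (\<integral>x. multiplier D x *v blk_app (dx \<psi> x) (U x) \<partial>\<mu>)"

lemma measurable_multiplier_F [measurable]: "multiplier D \<in> borel_measurable \<F>"
  unfolding multiplier_def[abs_def] by measurable

lemma measurable_multiplier [measurable]: "multiplier D \<in> borel_measurable \<mu>"
  by (rule F_measurable_M) measurable

lemma norm_cross_le:
  fixes D :: "'d path \<Rightarrow> real ^ 'k::finite"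
  shows "norm (dx2 D x ** transpose (dx2 \<psi> x)) \<le> real CARD('k) * L1 * norm (dx D x)"
proof -
  have "norm (dx2 D x ** transpose (dx2 \<psi> x)) \<le> (\<Sum>i\<in>UNIV. norm ((dx2 D x ** transpose (dx2 \<psi> x)) $ i))"
    by (rule norm_vec_le_sum)
  also have "\<dots> \<le> (\<Sum>i::'k\<in>UNIV. L1 * norm (dx D x))"
  proof (rule sum_mono)
    fix i :: 'k
    have "(dx2 D x ** transpose (dx2 \<psi> x)) $ i = blk_app (dx \<psi> x) (0, dx2 D x $ i)"
      by (simp add: blk_app_def dx_def vec_eq_iff matrix_vector_mult_def matrix_matrix_mult_def transpose_def mult.commute)
    also have "norm \<dots> \<le> L1 * norm (0 :: real ^ 'd, dx2 D x $ i)" by (rule L1)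
    also have "\<dots> \<le> L1 * norm (dx D x)"
    proof (intro mult_left_mono L1)
      have "norm (dx2 D x $ i) \<le> norm (dx2 D x)" by (rule Finite_Cartesian_Product.norm_nth_le)
      also have "\<dots> \<le> norm (dx D x)" by (simp add: dx_def norm_prod_def)
      finally show "norm (0 :: real ^ 'd, dx2 D x $ i) \<le> norm (dx D x)" by (simp add: norm_prod_def)
    qed
    finally show "norm ((dx2 D x ** transpose (dx2 \<psi> x)) $ i) \<le> L1 * norm (dx D x)" .
  qed
  finally show ?thesis by simp
qed

text \<open>Condition (iv) admits only covectors in the conjugate space, so the multiplier must
  inherit the integrability of order q from the derivative of D. Conditioning preserves it by
  Jensen, and the inverse Gram matrix is bounded by 1/c.\<close>

lemma integrable_multiplier_powr:
  fixes D :: "'d path \<Rightarrow> real ^ 'k::finite"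
  assumes D: "integrable \<mu> (dx D)" "integrable \<mu> (\<lambda>x. norm (dx D x) powr q)" and q: "q \<ge> 1"
  shows "integrable \<mu> (\<lambda>x. norm (multiplier D x) powr q)" "integrable \<mu> (multiplier D)"
proof -
  have [measurable]: "dx D \<in> borel_measurable \<mu>" using D by auto
  have "dx2 D = (\<lambda>x. snd (dx D x))" by (simp add: dx_def)
  then have [measurable]: "dx2 D \<in> borel_measurable \<mu>" by simp
  define Q where "Q = cond_ex \<mu> fst (\<lambda>y. dx2 D y ** transpose (dx2 \<psi> y))"
  have [measurable]: "(\<lambda>y. dx2 D y ** transpose (dx2 \<psi> y)) \<in> borel_measurable \<mu>" by measurable
  have i1: "integrable \<mu> (\<lambda>y. dx2 D y ** transpose (dx2 \<psi> y))"
  proof (rule Bochner_Integration.integrable_bound)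
    show "integrable \<mu> (\<lambda>x. real CARD('k) * L1 * norm (dx D x))" using D by simp
    show "AE x in \<mu>. norm (dx2 D x ** transpose (dx2 \<psi> x)) \<le> norm (real CARD('k) * L1 * norm (dx D x))"
      using L1(1) by (intro AE_I2 order_trans[OF norm_cross_le]) simp
  qed measurable
  have iq: "integrable \<mu> (\<lambda>y. norm (dx2 D y ** transpose (dx2 \<psi> y)) powr q)"
  proof (rule Bochner_Integration.integrable_bound)
    show "integrable \<mu> (\<lambda>x. (real CARD('k) * L1) powr q * norm (dx D x) powr q)" using D by simp
    have "norm (dx2 D x ** transpose (dx2 \<psi> x)) powr q \<le> (real CARD('k) * L1 * norm (dx D x)) powr q" for x
      using q by (intro powr_mono2 norm_cross_le) auto
    then show "AE x in \<mu>. norm (norm (dx2 D x ** transpose (dx2 \<psi> x)) powr q) \<le> norm ((real CARD('k) * L1) powr q * norm (dx D x) powr q)"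
      using L1(1) by (intro AE_I2) (simp add: powr_mult mult_ac)
  qed measurable
  have Qq: "integrable \<mu> (\<lambda>x. norm (Q x) powr q)" unfolding Q_def by (rule integrable_powr_cond_ex[OF i1 q iq])
  have Q1: "integrable \<mu> Q" unfolding Q_def by (rule integrable_cond_ex[OF i1])
  have le: "AE x in \<mu>. norm (multiplier D x) \<le> real CARD('k) / c * norm (Q x)"
    using norm_gram_inverse_le
  proof (rule eventually_mono)
    fix x assume inv: "\<forall>v. c * norm (cramer_inv (gram x) *v v) \<le> norm v"
    define R where "R = cramer_inv (gram x)"
    \<comment> \<open>A row of Q R is the transpose of R applied to the corresponding row of Q, so
      the bound on the inverse is needed for its transpose.\<close>
    have tr: "c * norm (transpose R *v w) \<le> norm w" for w
    proof (cases "transpose R *v w = 0")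
      case False
      define z where "z = transpose R *v w"
      have "norm z * norm z = z \<bullet> z" by (simp add: power2_norm_eq_inner[symmetric] power2_eq_square)
      also have "\<dots> = w \<bullet> (R *v z)"
        unfolding z_def by (metis dot_lmul_matrix vector_transpose_matrix transpose_transpose)
      also have "\<dots> \<le> norm w * norm (R *v z)" by (rule norm_cauchy_schwarz)
      finally have "c * (norm z * norm z) \<le> c * (norm w * norm (R *v z))" using c_pos by (intro mult_left_mono) auto
      also have "\<dots> = norm w * (c * norm (R *v z))" by simp
      also have "\<dots> \<le> norm w * norm z" using inv unfolding R_def[symmetric] by (intro mult_left_mono) auto
      finally have "c * norm z * norm z \<le> norm w * norm z" by simp
      then show ?thesis using False by (simp add: z_def mult_le_cancel_right_pos)
    qed simp
    have "norm (multiplier D x) \<le> (\<Sum>i\<in>UNIV. norm (multiplier D x $ i))" by (rule norm_vec_le_sum)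
    also have "\<dots> \<le> (\<Sum>i::'k\<in>UNIV. norm (Q x) / c)"
    proof (rule sum_mono)
      fix i :: 'k
      have "multiplier D x $ i = transpose R *v (Q x $ i)"
        by (simp add: multiplier_def Q_def R_def vec_eq_iff matrix_vector_mult_def matrix_matrix_mult_def transpose_def mult.commute)
      then have "c * norm (multiplier D x $ i) \<le> norm (Q x $ i)" using tr by simp
      also have "\<dots> \<le> norm (Q x)" by (rule Finite_Cartesian_Product.norm_nth_le)
      finally show "norm (multiplier D x $ i) \<le> norm (Q x) / c" using c_pos by (simp add: pos_le_divide_eq mult.commute)
    qed
    finally show "norm (multiplier D x) \<le> real CARD('k) / c * norm (Q x)" by simp
  qed
  show "integrable \<mu> (multiplier D)"
  proof (rule Bochner_Integration.integrable_bound)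
    show "integrable \<mu> (\<lambda>x. real CARD('k) / c * norm (Q x))" using Q1 by simp
    show "AE x in \<mu>. norm (multiplier D x) \<le> norm (real CARD('k) / c * norm (Q x))"
      using le by (rule eventually_mono) (use c_pos in simp)
  qed measurable
  show "integrable \<mu> (\<lambda>x. norm (multiplier D x) powr q)"
  proof (rule Bochner_Integration.integrable_bound)
    show "integrable \<mu> (\<lambda>x. (real CARD('k) / c) powr q * norm (Q x) powr q)" using Qq by simp
    show "AE x in \<mu>. norm (norm (multiplier D x) powr q) \<le> norm ((real CARD('k) / c) powr q * norm (Q x) powr q)"
      using le
    proof (rule eventually_mono)
      fix x assume "norm (multiplier D x) \<le> real CARD('k) / c * norm (Q x)"
      then have "norm (multiplier D x) powr q \<le> (real CARD('k) / c * norm (Q x)) powr q" using q by (intro powr_mono2) auto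
      also have "\<dots> = (real CARD('k) / c) powr q * norm (Q x) powr q"
        by (rule powr_mult)
      finally show "norm (norm (multiplier D x) powr q) \<le> norm ((real CARD('k) / c) powr q * norm (Q x) powr q)"
        by simp
    qed
  qed measurable
qed

end

section \<open>First-order response to adapted fields\<close>

lemma norm_fst_prod_le: "norm (fst z) \<le> norm z"
  using norm_fst_le[of "fst z" "snd z"] by simp

lemma norm_snd_prod_le: "norm (snd z) \<le> norm z"
  using norm_snd_le[of "snd z" "fst z"] by simp

lemma norm_blk_tapp_le:
  fixes A :: "('d::finite, 'k::finite) blocks"
  assumes "\<And>v. norm (blk_app A v) \<le> L * norm v" "0 \<le> L"
  shows "norm (blk_tapp A w) \<le> L * norm w"
proof (cases "blk_tapp A w = 0")
  case False
  have "norm (blk_tapp A w) * norm (blk_tapp A w) = w \<bullet> blk_app A (blk_tapp A w)"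
    unfolding inner_blk_app by (simp add: power2_norm_eq_inner[symmetric] power2_eq_square)
  also have "\<dots> \<le> norm w * (L * norm (blk_tapp A w))"
    by (rule order_trans[OF norm_cauchy_schwarz]) (intro mult_left_mono assms norm_ge_zero)
  finally have "norm (blk_tapp A w) * norm (blk_tapp A w) \<le> (L * norm w) * norm (blk_tapp A w)" by (simp add: mult_ac)
  then show ?thesis using False by (simp add: mult_le_cancel_right_pos)
qed (use assms in simp)

lemma bounded_bilinear_transpose_mult:
  "bounded_bilinear (\<lambda>(v :: real ^ 'm::finite) (A :: real ^ 'n::finite ^ 'm). transpose A *v v)"
  unfolding bilinear_conv_bounded_bilinear[symmetric] bilinear_def
proof (intro conjI allI linearI)
  fix A B :: "real ^ 'n ^ 'm" and v w :: "real ^ 'm" and c :: real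
  have "transpose (A + B) = transpose A + transpose B" "transpose (c *\<^sub>R A) = c *\<^sub>R transpose A"
    by (simp_all add: transpose_def vec_eq_iff)
  then show "transpose (A + B) *v v = transpose A *v v + transpose B *v v"
    "transpose (c *\<^sub>R A) *v v = c *\<^sub>R (transpose A *v v)"
    by (simp_all only: matrix_vector_mult_add_rdistrib scaleR_matrix_vector_assoc[symmetric])
  show "transpose A *v (v + w) = transpose A *v v + transpose A *v w"
    by (rule matrix_vector_right_distrib)
  show "transpose A *v (c *\<^sub>R v) = c *\<^sub>R (transpose A *v v)"
    by (rule matrix_vector_mult_scaleR)
qed

lemma integrable_bilinear_bounded:
  fixes f :: "'a \<Rightarrow> 'b::euclidean_space" and g :: "'a \<Rightarrow> 'e::euclidean_space" and B :: "'b \<Rightarrow> 'e \<Rightarrow> 'g::euclidean_space"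
  assumes B: "bounded_bilinear B" and f: "integrable M f" and [measurable]: "g \<in> borel_measurable M"
    and b: "AE x in M. norm (g x) \<le> b"
  shows "integrable M (\<lambda>x. B (f x) (g x))" "integrable M (\<lambda>x. norm (f x) * norm (g x))"
proof -
  have [measurable]: "f \<in> borel_measurable M" using f by auto
  obtain K where K: "K \<ge> 0" "\<And>a v. norm (B a v) \<le> norm a * norm v * K"
    using bounded_bilinear.nonneg_bounded[OF B] by blast
  show i: "integrable M (\<lambda>x. norm (f x) * norm (g x))"
  proof (rule Bochner_Integration.integrable_bound)
    show "integrable M (\<lambda>x. norm (f x) * b)" using f by auto
    show "AE x in M. norm (norm (f x) * norm (g x)) \<le> norm (norm (f x) * b)"
      using b by (rule eventually_mono) (simp add: abs_mult mult_left_mono)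
  qed measurable
  have [measurable]: "(\<lambda>x. B (f x) (g x)) \<in> borel_measurable M"
    by (rule borel_measurable_continuous_Pair[where H=B])
      (auto intro!: continuous_intros bounded_bilinear.continuous_on[OF B])
  show "integrable M (\<lambda>x. B (f x) (g x))"
  proof (rule Bochner_Integration.integrable_bound)
    show "integrable M (\<lambda>x. norm (f x) * norm (g x) * K)" using i by simp
    show "AE x in M. norm (B (f x) (g x)) \<le> norm (norm (f x) * norm (g x) * K)"
      using K by (intro AE_I2 order_trans[OF K(2)]) simp
  qed measurable
qed

text \<open>An adapted field has a \<sigma>(X_1)-measurable first component, which may move in and
  out of the conditioning of the first derivative. Hence the adapted derivatives in the theorem can
  be replaced by ordinary ones in both terms of the bound.\<close>

lemma cond_ex_blk_dx_ad:
  fixes \<mu> :: "'d::finite path measure" and u :: "'d path \<Rightarrow> real ^ 'k::finite"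
  assumes "conditioning \<mu> (fst :: 'd path \<Rightarrow> _)" and sets: "sets \<mu> = sets borel"
    and u: "integrable \<mu> (dx u)" and \<Theta>: "\<Theta> \<in> borel_measurable borel" "\<And>x. norm (\<Theta> x) \<le> b"
    and ad: "\<And>x. fst (\<Theta> x) = t (fst x)"
  shows "AE x in \<mu>. cond_ex \<mu> fst (\<lambda>x. blk_app (dx_ad \<mu> u x) (\<Theta> x)) x = cond_ex \<mu> fst (\<lambda>x. blk_app (dx u x) (\<Theta> x)) x"
    and "(\<integral>x. blk_app (dx_ad \<mu> u x) (\<Theta> x) \<partial>\<mu>) = (\<integral>x. blk_app (dx u x) (\<Theta> x) \<partial>\<mu>)"
proof -
  interpret conditioning \<mu> "fst :: 'd path \<Rightarrow> _" by fact
  have [simp]: "borel_measurable \<mu> = borel_measurable borel" using sets by (auto cong: measurable_cong_sets)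
  have m1: "integrable \<mu> (dx1 u)" "integrable \<mu> (dx2 u)"
    using integrable_fst[OF u] integrable_snd[OF u] by (simp_all add: dx_def[abs_def])
  have tb: "t = (\<lambda>s. fst (\<Theta> (s, 0)))" using ad by auto
  have "t \<in> borel_measurable borel" unfolding tb
    by (intro measurable_compose[OF _ measurable_fst_borel] measurable_compose[OF _ \<Theta>(1)] borel_measurable_continuous_onI continuous_intros)
  then have tF: "(\<lambda>x. t (fst x)) \<in> borel_measurable \<F>" by (rule F_measurable_compose)
  note tM = F_measurable_M[OF tF]
  have t_le: "norm (t (fst x)) \<le> b" for x :: "'d path"
    using \<Theta>(2)[of x] norm_fst_prod_le[of "\<Theta> x"] by (simp add: ad[symmetric])
  have s_le: "norm (snd (\<Theta> x)) \<le> b" for x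
    using \<Theta>(2)[of x] norm_snd_prod_le[of "\<Theta> x"] by linarith
  have sM: "(\<lambda>x. snd (\<Theta> x)) \<in> borel_measurable \<mu>" using \<Theta>(1) by simp
  note BM = bounded_bilinear_matrix_vector_mult
  have i1: "integrable \<mu> (\<lambda>x. dx1 u x *v t (fst x))"
    by (rule integrable_bilinear_bounded(1)[OF BM m1(1) tM, where b=b]) (use t_le in simp)
  have i2: "integrable \<mu> (\<lambda>x. dx2 u x *v snd (\<Theta> x))"
    by (rule integrable_bilinear_bounded(1)[OF BM m1(2) sM, where b=b]) (use s_le in simp)
  have i3: "integrable \<mu> (\<lambda>x. cond_ex \<mu> fst (dx1 u) x *v t (fst x))"
    by (rule integrable_bilinear_bounded(1)[OF BM integrable_cond_ex[OF m1(1)] tM, where b=b]) (use t_le in simp)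
  have F3: "(\<lambda>x. cond_ex \<mu> fst (dx1 u) x *v t (fst x)) \<in> borel_measurable \<F>"
    using tF by measurable
  have "integrable \<mu> (\<lambda>x. norm (t (fst x)) * norm (dx1 u x))"
    using integrable_bilinear_bounded(2)[OF BM m1(1) tM, where b=b] t_le by (simp add: mult.commute)
  from cond_ex_bilinear(1)[OF bounded_bilinear.flip[OF BM] tF borel_measurable_integrable[OF m1(1)] this]
  have c1: "AE x in \<mu>. cond_ex \<mu> fst (\<lambda>x. dx1 u x *v t (fst x)) x = cond_ex \<mu> fst (dx1 u) x *v t (fst x)" .
  have c3: "AE x in \<mu>. cond_ex \<mu> fst (\<lambda>x. cond_ex \<mu> fst (dx1 u) x *v t (fst x)) x = cond_ex \<mu> fst (dx1 u) x *v t (fst x)"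
    by (rule cond_ex_F_measurable[OF i3 F3])
  have e1: "blk_app (dx u x) (\<Theta> x) = dx1 u x *v t (fst x) + dx2 u x *v snd (\<Theta> x)" for x
    by (simp add: blk_app_def dx_def ad)
  have e2: "blk_app (dx_ad \<mu> u x) (\<Theta> x) = cond_ex \<mu> fst (dx1 u) x *v t (fst x) + dx2 u x *v snd (\<Theta> x)" for x
    by (simp add: blk_app_def dx_ad_def ad)
  show eq: "AE x in \<mu>. cond_ex \<mu> fst (\<lambda>x. blk_app (dx_ad \<mu> u x) (\<Theta> x)) x = cond_ex \<mu> fst (\<lambda>x. blk_app (dx u x) (\<Theta> x)) x"
    unfolding e1 e2 using c1 c3 cond_ex_add[OF i1 i2] cond_ex_add[OF i3 i2] by eventually_elim simp
  have "(\<integral>x. blk_app (dx_ad \<mu> u x) (\<Theta> x) \<partial>\<mu>) = (\<integral>x. cond_ex \<mu> fst (\<lambda>x. blk_app (dx_ad \<mu> u x) (\<Theta> x)) x \<partial>\<mu>)"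
    unfolding e2 using i3 i2 by (intro integral_cond_ex[symmetric]) auto
  also have "\<dots> = (\<integral>x. cond_ex \<mu> fst (\<lambda>x. blk_app (dx u x) (\<Theta> x)) x \<partial>\<mu>)"
    by (intro integral_cong_AE measurable_cond_ex eq)
  also have "\<dots> = (\<integral>x. blk_app (dx u x) (\<Theta> x) \<partial>\<mu>)"
    unfolding e1 using i1 i2 by (intro integral_cond_ex) auto
  finally show "(\<integral>x. blk_app (dx_ad \<mu> u x) (\<Theta> x) \<partial>\<mu>) = (\<integral>x. blk_app (dx u x) (\<Theta> x) \<partial>\<mu>)" .
qed

text \<open>The Lipschitz condition keeps \<open>x\<^sub>1 \<mapsto> x\<^sub>1 + \<eta>\<^sub>1(x\<^sub>1)\<close> invertible for small multiples of \<open>\<eta>\<close>.\<close>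

definition adapted_fields :: "(('d::finite) path \<Rightarrow> 'd path) set" where
  "adapted_fields = {\<eta>. \<eta> \<in> borel_measurable borel \<and> (\<exists>b. \<forall>x. norm (\<eta> x) \<le> b) \<and>
    (\<exists>t L. (\<forall>x. fst (\<eta> x) = t (fst x)) \<and> (\<forall>s s'. norm (t s - t s') \<le> L * norm (s - s')))}"

lemma adapted_fieldsI:
  assumes "\<eta> \<in> borel_measurable borel" "\<And>x. norm (\<eta> x) \<le> b" "\<And>x. fst (\<eta> x) = t (fst x)"
    "\<And>s s'. norm (t s - t s') \<le> L * norm (s - s')"
  shows "\<eta> \<in> adapted_fields"
  using assms unfolding adapted_fields_def by blast

lemma adapted_fieldsE:
  assumes "\<eta> \<in> adapted_fields"
  obtains b t L where "\<eta> \<in> borel_measurable borel" "\<And>x. norm (\<eta> x) \<le> b" "\<And>x. fst (\<eta> x) = t (fst x)"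
    "\<And>s s'. norm (t s - t s') \<le> L * norm (s - s')"
  using assms unfolding adapted_fields_def by blast

lemma adapted_fields_add:
  assumes "\<eta> \<in> adapted_fields" "\<zeta> \<in> adapted_fields"
  shows "(\<lambda>x. \<eta> x + \<zeta> x) \<in> adapted_fields"
proof -
  obtain b t L where 1: "\<eta> \<in> borel_measurable borel" "\<And>x. norm (\<eta> x) \<le> b" "\<And>x. fst (\<eta> x) = t (fst x)"
    "\<And>s s'. norm (t s - t s') \<le> L * norm (s - s')" by (rule adapted_fieldsE[OF assms(1)]) blast
  obtain b' t' L' where 2: "\<zeta> \<in> borel_measurable borel" "\<And>x. norm (\<zeta> x) \<le> b'" "\<And>x. fst (\<zeta> x) = t' (fst x)"
    "\<And>s s'. norm (t' s - t' s') \<le> L' * norm (s - s')" by (rule adapted_fieldsE[OF assms(2)]) blast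
  show ?thesis
  proof (rule adapted_fieldsI)
    show "(\<lambda>x. \<eta> x + \<zeta> x) \<in> borel_measurable borel" using 1(1) 2(1) by measurable
    show "norm (\<eta> x + \<zeta> x) \<le> b + b'" for x by (intro norm_triangle_mono 1 2)
    show "fst (\<eta> x + \<zeta> x) = (\<lambda>s. t s + t' s) (fst x)" for x by (simp add: 1 2)
    show "norm ((\<lambda>s. t s + t' s) s - (\<lambda>s. t s + t' s) s') \<le> (L + L') * norm (s - s')" for s s'
      using norm_triangle_mono[OF 1(4)[of s s'] 2(4)[of s s']] by (simp add: algebra_simps)
  qed
qed

lemma adapted_fields_scaleR:
  assumes "\<eta> \<in> adapted_fields"
  shows "(\<lambda>x. r *\<^sub>R \<eta> x) \<in> adapted_fields"
proof -
  obtain b t L where 1: "\<eta> \<in> borel_measurable borel" "\<And>x. norm (\<eta> x) \<le> b" "\<And>x. fst (\<eta> x) = t (fst x)"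
    "\<And>s s'. norm (t s - t s') \<le> L * norm (s - s')" by (rule adapted_fieldsE[OF assms(1)]) blast
  show ?thesis
  proof (rule adapted_fieldsI)
    show "(\<lambda>x. r *\<^sub>R \<eta> x) \<in> borel_measurable borel" using 1(1) by measurable
    show "norm (r *\<^sub>R \<eta> x) \<le> \<bar>r\<bar> * b" for x by (simp add: 1 mult_left_mono)
    show "fst (r *\<^sub>R \<eta> x) = (\<lambda>s. r *\<^sub>R t s) (fst x)" for x by (simp add: 1)
    show "norm ((\<lambda>s. r *\<^sub>R t s) s - (\<lambda>s. r *\<^sub>R t s) s') \<le> (\<bar>r\<bar> * L) * norm (s - s')" for s s'
      using mult_left_mono[OF 1(4)[of s s'], of "\<bar>r\<bar>"] by (simp add: scaleR_diff_right[symmetric] mult.assoc)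
  qed
qed

context constrained
begin

section \<open>Linear response of fields and its error after restoring the constraint\<close>

lemma integrable_multiplier_blk:
  assumes G: "integrable \<mu> (multiplier D)" and [measurable]: "U \<in> borel_measurable \<mu>" and b: "AE x in \<mu>. norm (U x) \<le> b"
  shows "integrable \<mu> (\<lambda>x. multiplier D x *v blk_app (dx \<psi> x) (U x))"
    "integrable \<mu> (\<lambda>x. norm (multiplier D x) * norm (blk_app (dx \<psi> x) (U x)))"
proof -
  have "AE x in \<mu>. norm (blk_app (dx \<psi> x) (U x)) \<le> L1 * b"
    using b by (rule eventually_mono) (rule order_trans[OF L1(2)], use L1(1) in \<open>simp add: mult_left_mono\<close>)
  note * = integrable_bilinear_bounded[OF bounded_bilinear_matrix_vector_mult G _ this]
  show "integrable \<mu> (\<lambda>x. multiplier D x *v blk_app (dx \<psi> x) (U x))"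
    "integrable \<mu> (\<lambda>x. norm (multiplier D x) * norm (blk_app (dx \<psi> x) (U x)))"
    by (rule *; measurable)+
qed

lemma lin_response_add:
  assumes D: "integrable \<mu> (dx D)" "integrable \<mu> (multiplier D)"
    and [measurable]: "U \<in> borel_measurable \<mu>" "V \<in> borel_measurable \<mu>"
    and b: "AE x in \<mu>. norm (U x) \<le> b" "AE x in \<mu>. norm (V x) \<le> b'"
  shows "lin_response D (\<lambda>x. U x + V x) = lin_response D U + lin_response D V"
  using integrable_blk_app_bounded[OF D(1) _ b(1)] integrable_blk_app_bounded[OF D(1) _ b(2)]
    integrable_multiplier_blk(1)[OF D(2) _ b(1)] integrable_multiplier_blk(1)[OF D(2) _ b(2)]
  by (simp add: lin_response_def blk_app.add_right matrix_vector_right_distrib)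

lemma lin_response_scaleR: "lin_response D (\<lambda>x. r *\<^sub>R U x) = r *\<^sub>R lin_response D U"
  by (simp add: lin_response_def blk_app.scaleR_right matrix_vector_mult_scaleR scaleR_diff_right)

lemma lin_response_sum:
  assumes D: "integrable \<mu> (dx D)" "integrable \<mu> (multiplier D)"
    and V: "\<And>i. V i \<in> borel_measurable \<mu>" "\<And>i. AE x in \<mu>. norm (V i x) \<le> b"
  shows "finite I \<Longrightarrow> lin_response D (\<lambda>x. \<Sum>i\<in>I. a i *\<^sub>R V i x) = (\<Sum>i\<in>I. a i *\<^sub>R lin_response D (V i))"
proof (induction I rule: finite_induct)
  case empty
  then show ?case by (simp add: lin_response_def blk_app.zero_right)
next
  case (insert i I)
  have 1: "AE x in \<mu>. norm (a i *\<^sub>R V i x) \<le> \<bar>a i\<bar> * b"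
    using V(2)[of i] by (rule eventually_mono) (simp add: mult_left_mono)
  have "AE x in \<mu>. \<forall>j\<in>I. norm (V j x) \<le> b" using insert V(2) by (intro AE_finite_allI) auto
  then have 2: "AE x in \<mu>. norm (\<Sum>j\<in>I. a j *\<^sub>R V j x) \<le> (\<Sum>j\<in>I. \<bar>a j\<bar> * b)"
    by (rule eventually_mono) (auto intro!: order_trans[OF norm_sum] sum_mono mult_left_mono)
  have "lin_response D (\<lambda>x. a i *\<^sub>R V i x + (\<Sum>j\<in>I. a j *\<^sub>R V j x))
      = lin_response D (\<lambda>x. a i *\<^sub>R V i x) + lin_response D (\<lambda>x. \<Sum>j\<in>I. a j *\<^sub>R V j x)"
    by (rule lin_response_add[OF D _ _ 1 2]) (use V(1) in measurable)
  then show ?case using insert by (simp add: lin_response_scaleR)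
qed

lemma integral_multiplier_cond_ex:
  assumes G: "integrable \<mu> (multiplier D)" and U [measurable]: "U \<in> borel_measurable \<mu>"
    and b: "AE x in \<mu>. norm (U x) \<le> b"
  shows "(\<integral>x. multiplier D x *v cond_ex \<mu> fst (\<lambda>x. blk_app (dx \<psi> x) (U x)) x \<partial>\<mu>)
    = (\<integral>x. multiplier D x *v blk_app (dx \<psi> x) (U x) \<partial>\<mu>)"
  by (intro integral_bilinear_cond_ex[OF bounded_bilinear_matrix_vector_mult measurable_multiplier_F
      _ integrable_multiplier_blk(2)[OF G U b]]) measurable

text \<open>Since h is \<sigma>(X_1)-measurable, the effect of \<open>lift h\<close> on D is the
  integral of the conditioned cross matrix times h, that is, of the multiplier times
  \<open>gram h\<close>. By \<open>solution_expansion\<close> the latter is minus the conditional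
  effect of U up to a term of order b^2, and the multiplier is integrable. The constant serves all
  U, h and b.\<close>

lemma lin_response_error:
  fixes D :: "'d path \<Rightarrow> real ^ 'k::finite"
  assumes D: "integrable \<mu> (dx D)" "integrable \<mu> (multiplier D)"
  shows "\<exists>K\<ge>0. \<forall>U h b. U \<in> borel_measurable \<mu> \<longrightarrow> h \<in> borel_measurable \<F> \<longrightarrow> 0 \<le> b \<longrightarrow>
    (AE x in \<mu>. norm (U x) \<le> b) \<longrightarrow> (AE x in \<mu>. norm (h x) \<le> K0 * b) \<longrightarrow>
    (AE x in \<mu>. cond_ex \<mu> fst (\<lambda>x. \<psi> (x + (U x + lift h x))) x = 0) \<longrightarrow>
    norm ((\<integral>x. blk_app (dx D x) (U x + lift h x) \<partial>\<mu>) - lin_response D U) \<le> K * b\<^sup>2"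
proof -
  define C where "C = K\<psi> * (1 + K0)\<^sup>2"
  have C: "C \<ge> 0" using K\<psi>_nonneg by (simp add: C_def)
  have BM: "bounded_bilinear ((*v) :: real ^ 'l ^ 'k \<Rightarrow> real ^ 'l \<Rightarrow> real ^ 'k)" by (rule bounded_bilinear_matrix_vector_mult)
  obtain KM where KM: "KM \<ge> 0" "\<And>A v. norm ((A :: real ^ 'l ^ 'k) *v v) \<le> norm A * norm v * KM"
    using bounded_bilinear.nonneg_bounded[OF BM] by blast
  define K where "K = (\<integral>x. norm (multiplier D x) * C * KM \<partial>\<mu>)"
  have "K \<ge> 0" unfolding K_def using C KM by (intro integral_nonneg_AE) auto
  moreover have "norm ((\<integral>x. blk_app (dx D x) (U x + lift h x) \<partial>\<mu>) - lin_response D U) \<le> K * b\<^sup>2"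
    if U [measurable]: "U \<in> borel_measurable \<mu>" and h: "h \<in> borel_measurable \<F>" and b: "0 \<le> b"
      "AE x in \<mu>. norm (U x) \<le> b" and hb: "AE x in \<mu>. norm (h x) \<le> K0 * b"
      and sol: "AE x in \<mu>. cond_ex \<mu> fst (\<lambda>x. \<psi> (x + (U x + lift h x))) x = 0" for U h b
  proof -
    have [measurable]: "h \<in> borel_measurable \<mu>" by (rule F_measurable_M[OF h])
    have [measurable]: "dx D \<in> borel_measurable \<mu>" using D by auto
    have "dx2 D = (\<lambda>x. snd (dx D x))" by (simp add: dx_def)
    then have [measurable]: "dx2 D \<in> borel_measurable \<mu>" by simp
    define E where "E = cond_ex \<mu> fst (\<lambda>x. blk_app (dx \<psi> x) (U x))"
    have [measurable]: "E \<in> borel_measurable \<mu>" unfolding E_def by measurable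
    have lb: "AE x in \<mu>. norm (lift h x) \<le> L1 * (K0 * b)"
      using hb by (rule eventually_mono) (rule order_trans[OF norm_lift_le], use L1(1) in \<open>simp add: mult_left_mono\<close>)
    have i1: "integrable \<mu> (\<lambda>x. blk_app (dx D x) (U x))" by (rule integrable_blk_app_bounded[OF D(1) U b(2)])
    have i2: "integrable \<mu> (\<lambda>x. blk_app (dx D x) (lift h x))" by (rule integrable_blk_app_bounded[OF D(1) _ lb]) measurable
    define cr where "cr = (\<lambda>x. dx2 D x ** transpose (dx2 \<psi> x))"
    have [measurable]: "cr \<in> borel_measurable \<mu>" unfolding cr_def by measurable
    have icr: "integrable \<mu> cr"
    proof (rule Bochner_Integration.integrable_bound)
      show "integrable \<mu> (\<lambda>x. real CARD('k) * L1 * norm (dx D x))" using D by simp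
      show "AE x in \<mu>. norm (cr x) \<le> norm (real CARD('k) * L1 * norm (dx D x))"
        unfolding cr_def using L1(1) by (intro AE_I2 order_trans[OF norm_cross_le]) simp
    qed measurable
    have "integrable \<mu> (\<lambda>x. norm (h x) * norm (cr x))"
      using integrable_bilinear_bounded(2)[OF BM icr _ hb] by (simp add: mult.commute)
    from integral_bilinear_cond_ex[OF bounded_bilinear.flip[OF BM] h _ this]
    have "(\<integral>x. cond_ex \<mu> fst cr x *v h x \<partial>\<mu>) = (\<integral>x. cr x *v h x \<partial>\<mu>)" by simp
    also have "\<dots> = (\<integral>x. blk_app (dx D x) (lift h x) \<partial>\<mu>)"
      by (simp add: cr_def blk_app_def dx_def lift_def matrix_vector_mul_assoc del: transpose_matrix_vector)
    finally have a1: "(\<integral>x. blk_app (dx D x) (lift h x) \<partial>\<mu>) = (\<integral>x. cond_ex \<mu> fst cr x *v h x \<partial>\<mu>)" by simp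
    \<comment> \<open>The inverse inside the multiplier cancels against the Gram matrix.\<close>
    have g: "AE x in \<mu>. cond_ex \<mu> fst cr x *v h x = multiplier D x *v (gram x *v h x)"
      using gram_inverse by (rule eventually_mono)
        (simp add: multiplier_def cr_def matrix_vector_mul_assoc[symmetric] del: transpose_matrix_vector)
    have a2: "(\<integral>x. cond_ex \<mu> fst cr x *v h x \<partial>\<mu>) = (\<integral>x. multiplier D x *v (gram x *v h x) \<partial>\<mu>)"
      using g by (intro integral_cong_AE) measurable
    have j1: "integrable \<mu> (\<lambda>x. multiplier D x *v (gram x *v h x))"
    proof -
      have "integrable \<mu> (\<lambda>x. cond_ex \<mu> fst cr x *v h x)"
        by (rule integrable_bilinear_bounded(1)[OF BM integrable_cond_ex[OF icr] _ hb]) measurable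
      then show ?thesis using g by (subst integrable_cong_AE[where g="\<lambda>x. cond_ex \<mu> fst cr x *v h x"]) (auto elim: eventually_mono)
    qed
    have Eb: "AE x in \<mu>. norm (E x) \<le> real CARD('l) * L1 * b" unfolding E_def by (rule cond_ex_blk_le[OF U b(2)])
    have j2: "integrable \<mu> (\<lambda>x. multiplier D x *v E x)"
      by (rule integrable_bilinear_bounded(1)[OF BM D(2) _ Eb]) measurable
    have "(\<integral>x. blk_app (dx D x) (U x + lift h x) \<partial>\<mu>) - lin_response D U
        = (\<integral>x. blk_app (dx D x) (lift h x) \<partial>\<mu>) + (\<integral>x. multiplier D x *v blk_app (dx \<psi> x) (U x) \<partial>\<mu>)"
      using i1 i2 by (simp add: lin_response_def blk_app.add_right)
    also have "\<dots> = (\<integral>x. multiplier D x *v (gram x *v h x) \<partial>\<mu>) + (\<integral>x. multiplier D x *v E x \<partial>\<mu>)"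
      unfolding a1 a2 E_def integral_multiplier_cond_ex[OF D(2) U b(2)] ..
    also have "\<dots> = (\<integral>x. multiplier D x *v (gram x *v h x + E x) \<partial>\<mu>)"
      using j1 j2 by (simp add: matrix_vector_right_distrib)
    finally have "norm ((\<integral>x. blk_app (dx D x) (U x + lift h x) \<partial>\<mu>) - lin_response D U)
        \<le> (\<integral>x. norm (multiplier D x *v (gram x *v h x + E x)) \<partial>\<mu>)" by simp
    also have "\<dots> \<le> (\<integral>x. (norm (multiplier D x) * C * KM) * b\<^sup>2 \<partial>\<mu>)"
    proof (rule integral_mono_AE)
      show "integrable \<mu> (\<lambda>x. norm (multiplier D x *v (gram x *v h x + E x)))"
        using j1 j2 by (simp add: matrix_vector_right_distrib)
      show "integrable \<mu> (\<lambda>x. (norm (multiplier D x) * C * KM) * b\<^sup>2)" using D(2) by simp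
      show "AE x in \<mu>. norm (multiplier D x *v (gram x *v h x + E x)) \<le> (norm (multiplier D x) * C * KM) * b\<^sup>2"
        using solution_expansion[OF U h b(2) hb b(1) sol]
      proof (rule eventually_mono)
        fix x assume "norm (gram x *v h x + cond_ex \<mu> fst (\<lambda>x. blk_app (dx \<psi> x) (U x)) x) \<le> K\<psi> * (1 + K0)\<^sup>2 * b\<^sup>2"
        then have x: "norm (gram x *v h x + E x) \<le> C * b\<^sup>2" by (simp add: E_def C_def)
        have "norm (multiplier D x *v (gram x *v h x + E x)) \<le> norm (multiplier D x) * norm (gram x *v h x + E x) * KM" by (rule KM)
        also have "\<dots> \<le> norm (multiplier D x) * (C * b\<^sup>2) * KM" using x KM(1) by (intro mult_right_mono mult_left_mono) auto
        finally show "norm (multiplier D x *v (gram x *v h x + E x)) \<le> (norm (multiplier D x) * C * KM) * b\<^sup>2"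
          by (simp add: mult_ac)
      qed
    qed
    also have "\<dots> = K * b\<^sup>2" by (simp add: K_def)
    finally show ?thesis .
  qed
  ultimately show ?thesis by blast
qed

lemma norm_dx_psi_le: "norm (dx1 \<psi> x) \<le> real CARD('l) * L1" "norm (dx2 \<psi> x) \<le> real CARD('l) * L1"
proof -
  have row: "norm (dx1 \<psi> x $ i) \<le> L1" "norm (dx2 \<psi> x $ i) \<le> L1" for i
  proof -
    have e: "(dx1 \<psi> x $ i, dx2 \<psi> x $ i) = blk_tapp (dx \<psi> x) (axis i 1)"
      by (simp add: blk_tapp_def dx_def vec_eq_iff matrix_vector_mul_component inner_axis del: transpose_matrix_vector)
        (simp add: transpose_def)
    have "norm (blk_tapp (dx \<psi> x) (axis i 1)) \<le> L1 * norm (axis i 1 :: real ^ 'l)" by (rule norm_blk_tapp_le[OF L1(2,1)])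
    then show "norm (dx1 \<psi> x $ i) \<le> L1" "norm (dx2 \<psi> x $ i) \<le> L1"
      using norm_fst_prod_le[of "blk_tapp (dx \<psi> x) (axis i 1)"] norm_snd_prod_le[of "blk_tapp (dx \<psi> x) (axis i 1)"]
      unfolding e[symmetric] by simp_all
  qed
  have "(\<Sum>i\<in>UNIV. norm (dx1 \<psi> x $ i)) \<le> (\<Sum>i::'l\<in>UNIV. L1)" "(\<Sum>i\<in>UNIV. norm (dx2 \<psi> x $ i)) \<le> (\<Sum>i::'l\<in>UNIV. L1)"
    by (rule sum_mono, rule row)+
  then show "norm (dx1 \<psi> x) \<le> real CARD('l) * L1" "norm (dx2 \<psi> x) \<le> real CARD('l) * L1"
    using norm_vec_le_sum[of "dx1 \<psi> x"] norm_vec_le_sum[of "dx2 \<psi> x"] by simp_all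
qed

lemma integrable_dx_psi: "integrable \<mu> (dx \<psi>)"
proof (rule integrable_of_AE_bound)
  have "norm (dx \<psi> x) \<le> real CARD('l) * L1 + real CARD('l) * L1" for x
    using norm_Pair_le[of "dx1 \<psi> x" "dx2 \<psi> x"] norm_dx_psi_le[of x] unfolding dx_def by linarith
  then show "AE x in \<mu>. norm (dx \<psi> x) \<le> real CARD('l) * L1 + real CARD('l) * L1" by simp
qed measurable

text \<open>Condition (iv) is a dual formulation: a covector \<open>l\<close> annihilating all responses of adapted fields
  yields, with \<open>g = - G\<^sup>T l\<close>, a vanishing left-hand side in (iv).\<close>

lemma lin_response_onto:
  fixes D :: "'d path \<Rightarrow> real ^ 'k::finite"
  assumes D: "integrable \<mu> (dx D)" "integrable \<mu> (\<lambda>x. norm (dx D x) powr q)" and q: "q \<ge> 1" and c': "c' > 0"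
    and iv: "\<And>lam h. h \<in> Lp q (distr \<mu> borel fst) \<Longrightarrow>
        Lp_norm q \<mu> (\<lambda>x. blk_tapp (dx_ad \<mu> D x) lam + blk_tapp (dx_ad \<mu> \<psi> x) (h (fst x)))
        \<ge> c' * (norm lam + Lp_norm q \<mu> (\<lambda>x. h (fst x)))"
  shows "\<exists>\<eta>\<in>adapted_fields. lin_response D \<eta> = w"
proof -
  have G: "integrable \<mu> (\<lambda>x. norm (multiplier D x) powr q)" "integrable \<mu> (multiplier D)"
    by (rule integrable_multiplier_powr[OF D q])+
  have bd: "\<eta> \<in> borel_measurable \<mu> \<and> (\<exists>b. AE x in \<mu>. norm (\<eta> x) \<le> b)" if "\<eta> \<in> adapted_fields" for \<eta>
    using that unfolding adapted_fields_def measurable_borel_eq by blast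
  define S where "S = lin_response D ` adapted_fields"
  have SI: "lin_response D \<eta> \<in> S" if "\<eta> \<in> adapted_fields" for \<eta> using that unfolding S_def by (rule imageI)
  have "subspace S"
    unfolding subspace_def
  proof (intro conjI ballI allI)
    have "(\<lambda>_. 0) \<in> (adapted_fields :: ('d path \<Rightarrow> 'd path) set)"
      by (rule adapted_fieldsI[where b=0 and L=0 and t="\<lambda>_. 0"]) auto
    from SI[OF this] show "0 \<in> S" by (simp add: lin_response_def blk_app.zero_right)
    fix x assume "x \<in> S"
    then obtain \<eta> where 1: "\<eta> \<in> adapted_fields" "x = lin_response D \<eta>" unfolding S_def by blast
    show "r *\<^sub>R x \<in> S" for r using SI[OF adapted_fields_scaleR[OF 1(1), of r]] by (simp add: lin_response_scaleR 1(2))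
    fix y assume "y \<in> S"
    then obtain \<zeta> where 2: "\<zeta> \<in> adapted_fields" "y = lin_response D \<zeta>" unfolding S_def by blast
    obtain b b' where "AE x in \<mu>. norm (\<eta> x) \<le> b" "AE x in \<mu>. norm (\<zeta> x) \<le> b'" using bd[OF 1(1)] bd[OF 2(1)] by blast
    then have "lin_response D (\<lambda>x. \<eta> x + \<zeta> x) = x + y"
      unfolding 1(2) 2(2) using bd[OF 1(1)] bd[OF 2(1)] by (intro lin_response_add[OF D(1) G(2)]) auto
    then show "x + y \<in> S" using SI[OF adapted_fields_add[OF 1(1) 2(1)]] by simp
  qed
  moreover have "l = 0" if orth: "\<And>s. s \<in> S \<Longrightarrow> l \<bullet> s = 0" for l
  proof -
    define g where "g = (\<lambda>x. - (transpose (multiplier D x) *v l))"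
    have gF [measurable]: "g \<in> borel_measurable \<F>" unfolding g_def by measurable
    have gM [measurable]: "g \<in> borel_measurable \<mu>" by (rule F_measurable_M[OF gF])
    obtain KT where KT: "KT \<ge> 0" "\<And>(v :: real ^ 'k) (A :: real ^ 'l ^ 'k). norm (transpose A *v v) \<le> norm v * norm A * KT"
      using bounded_bilinear.nonneg_bounded[OF bounded_bilinear_transpose_mult] by blast
    have g_le: "norm (g x) \<le> norm l * KT * norm (multiplier D x)" for x
      using KT(2)[of "multiplier D x" l] by (simp add: g_def mult_ac)
    have gi: "integrable \<mu> g"
    proof (rule Bochner_Integration.integrable_bound)
      show "integrable \<mu> (\<lambda>x. norm l * KT * norm (multiplier D x))" using G(2) by simp
      show "AE x in \<mu>. norm (g x) \<le> norm (norm l * KT * norm (multiplier D x))"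
        using KT(1) by (intro AE_I2 order_trans[OF g_le]) simp
    qed measurable
    have gq: "integrable \<mu> (\<lambda>x. norm (g x) powr q)"
    proof (rule Bochner_Integration.integrable_bound)
      show "integrable \<mu> (\<lambda>x. (norm l * KT) powr q * norm (multiplier D x) powr q)" using G(1) by simp
      have "norm (g x) powr q \<le> (norm l * KT * norm (multiplier D x)) powr q" for x
        using q by (intro powr_mono2 g_le) auto
      then show "AE x in \<mu>. norm (norm (g x) powr q) \<le> norm ((norm l * KT) powr q * norm (multiplier D x) powr q)"
        by (intro AE_I2) (simp add: powr_mult)
    qed measurable
    \<comment> \<open>g takes equal values at points with the same first coordinate, so evaluating
      at second coordinate 0 recovers it everywhere, without an exceptional set.\<close>
    define hh where "hh = (\<lambda>s. g (s, 0))"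
    have g_hh: "g x = hh (fst x)" for x
      unfolding hh_def by (rule F_measurable_cong_Y[OF gF]) (auto simp: space_UNIV_of_sets_borel[OF sets_mu])
    have [measurable]: "hh \<in> borel_measurable borel"
      unfolding hh_def using gM unfolding measurable_borel_eq
      by (rule measurable_compose[rotated]) (intro borel_measurable_continuous_onI continuous_intros)
    have hLp: "hh \<in> Lp q (distr \<mu> borel fst)"
      using gq by (simp add: Lp_def integrable_distr_eq g_hh)
    define V where "V = (\<lambda>x. blk_tapp (dx D x) l + blk_tapp (dx \<psi> x) (g x))"
    have [measurable]: "dx D \<in> borel_measurable \<mu>" using D by auto
    have Vi: "integrable \<mu> V"
    proof -
      have "bounded_linear (\<lambda>A :: ('d, 'k) blocks. blk_tapp A l)"
        unfolding linear_conv_bounded_linear[symmetric] blk_tapp_def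
        by (intro linearI) (simp_all add: transpose_def vec_eq_iff matrix_vector_mult_def sum.distrib algebra_simps sum_distrib_left)
      from integrable_bounded_linear[OF this D(1)] have "integrable \<mu> (\<lambda>x. blk_tapp (dx D x) l)" .
      moreover have "integrable \<mu> (\<lambda>x. blk_tapp (dx \<psi> x) (g x))"
      proof (rule Bochner_Integration.integrable_bound)
        show "integrable \<mu> (\<lambda>x. L1 * norm (g x))" using gi by simp
        show "AE x in \<mu>. norm (blk_tapp (dx \<psi> x) (g x)) \<le> norm (L1 * norm (g x))"
          using L1(1) by (intro AE_I2 order_trans[OF norm_blk_tapp_le[OF L1(2)]]) auto
      qed measurable
      ultimately show ?thesis unfolding V_def by simp
    qed
    have V0: "(\<integral>x. V x \<bullet> \<eta> x \<partial>\<mu>) = 0" if \<eta>: "\<eta> \<in> adapted_fields" for \<eta>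
    proof -
      obtain b where \<eta>m: "\<eta> \<in> borel_measurable \<mu>" and b: "AE x in \<mu>. norm (\<eta> x) \<le> b" using bd[OF \<eta>] by blast
      have e: "V x \<bullet> \<eta> x = l \<bullet> (blk_app (dx D x) (\<eta> x) - multiplier D x *v blk_app (dx \<psi> x) (\<eta> x))" for x
      proof -
        have "l \<bullet> (multiplier D x *v y) = - (g x \<bullet> y)" for y
          unfolding g_def by (simp add: inner_minus_left del: transpose_matrix_vector)
            (metis dot_lmul_matrix vector_transpose_matrix transpose_transpose)
        then show ?thesis by (simp add: V_def inner_add_left inner_blk_app[symmetric] inner_diff_right)
      qed
      have i: "integrable \<mu> (\<lambda>x. blk_app (dx D x) (\<eta> x))" "integrable \<mu> (\<lambda>x. multiplier D x *v blk_app (dx \<psi> x) (\<eta> x))"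
        by (rule integrable_blk_app_bounded[OF D(1) \<eta>m b], rule integrable_multiplier_blk(1)[OF G(2) \<eta>m b])
      have "(\<integral>x. V x \<bullet> \<eta> x \<partial>\<mu>) = l \<bullet> lin_response D \<eta>"
        unfolding e lin_response_def using i by simp
      then show ?thesis using orth[OF SI[OF \<eta>]] by simp
    qed
    have [measurable]: "V \<in> borel_measurable \<mu>" using Vi by auto
    \<comment> \<open>Second components of adapted fields are arbitrary bounded functions of x; the
      normalised second component of V is admissible and forces pointwise vanishing.\<close>
    have s0: "AE x in \<mu>. snd (V x) = 0"
    proof -
      define \<eta> where "\<eta> = (\<lambda>x. (0 :: real ^ 'd, snd (V x) /\<^sub>R (1 + norm (snd (V x)))))"
      have n: "0 < 1 + norm (snd (V x))" for x by (simp add: add_pos_nonneg)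
      have "\<eta> \<in> borel_measurable \<mu>" unfolding \<eta>_def by measurable
      then have "\<eta> \<in> adapted_fields"
        unfolding measurable_borel_eq
      proof (rule adapted_fieldsI)
        show "norm (\<eta> x) \<le> 1" for x using n[of x] by (simp add: \<eta>_def norm_prod_def field_simps)
        show "fst (\<eta> x) = (\<lambda>_. 0) (fst x)" for x by (simp add: \<eta>_def)
        show "norm ((\<lambda>_ :: real ^ 'd. 0 :: real ^ 'd) s - (\<lambda>_. 0) s') \<le> 0 * norm (s - s')" for s s' by simp
      qed
      from V0[OF this] have I: "(\<integral>x. V x \<bullet> \<eta> x \<partial>\<mu>) = 0" .
      have e: "V x \<bullet> \<eta> x = (norm (snd (V x)))\<^sup>2 / (1 + norm (snd (V x)))" for x
        unfolding power2_norm_eq_inner by (simp add: \<eta>_def inner_prod_def divide_inverse mult.commute)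
      have "integrable \<mu> (\<lambda>x. (norm (snd (V x)))\<^sup>2 / (1 + norm (snd (V x))))"
      proof (rule Bochner_Integration.integrable_bound)
        show "integrable \<mu> (\<lambda>x. norm (V x))" using Vi by simp
        have "(norm (snd (V x)))\<^sup>2 / (1 + norm (snd (V x))) \<le> norm (snd (V x))" for x
          using n[of x] by (simp add: divide_le_eq power2_eq_square algebra_simps)
        from order_trans[OF this norm_snd_prod_le]
        have "(norm (snd (V x)))\<^sup>2 / (1 + norm (snd (V x))) \<le> norm (V x)" for x .
        then show "AE x in \<mu>. norm ((norm (snd (V x)))\<^sup>2 / (1 + norm (snd (V x)))) \<le> norm (norm (V x))"
          by (intro AE_I2) simp
      qed measurable
      then have "AE x in \<mu>. (norm (snd (V x)))\<^sup>2 / (1 + norm (snd (V x))) = 0"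
        using I unfolding e by (subst (asm) integral_nonneg_eq_0_iff_AE) auto
      then show ?thesis
      proof (rule eventually_mono)
        fix x assume "(norm (snd (V x)))\<^sup>2 / (1 + norm (snd (V x))) = 0"
        then show "snd (V x) = 0" using n[of x] by simp
      qed
    qed
    have fVi: "integrable \<mu> (\<lambda>x. fst (V x))" using Vi by (rule integrable_fst)
    \<comment> \<open>First components may depend on x_1 only, so the orthogonality reaches just the
      conditional expectation here. With the previous step these are precisely the two components of
      the adapted derivative in (iv).\<close>
    have f0: "AE x in \<mu>. cond_ex \<mu> fst (\<lambda>x. fst (V x)) x = 0"
    proof -
      have "AE x in \<mu>. cond_ex \<mu> fst (\<lambda>x. fst (V x)) x $ i = 0" for i
      proof -
        have "AE x in \<mu>. cond_ex \<mu> fst (\<lambda>x. fst (V x) $ i) x = 0"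
        proof (rule cond_ex_eq_0_of_lipschitz_tests)
          show "conditioning \<mu> (fst :: 'd path \<Rightarrow> real ^ 'd)" by unfold_locales
          show "integrable \<mu> (\<lambda>x. fst (V x) $ i)"
            by (rule integrable_bounded_linear[OF bounded_linear_vec_nth fVi])
          fix k :: "real ^ 'd \<Rightarrow> real" and L
          assume k: "\<And>s. 0 \<le> k s \<and> k s \<le> 1" and lip: "\<And>s t. \<bar>k s - k t\<bar> \<le> L * dist s t"
          have "L-lipschitz_on UNIV k" if "0 \<le> L" using that lip by (intro lipschitz_onI) (auto simp: dist_real_def)
          moreover have "L \<ge> 0"
          proof (rule ccontr)
            assume "\<not> 0 \<le> L"
            then have "L * dist (0 :: real ^ 'd) (axis i 1) < 0" by (simp add: mult_neg_pos)
            then show False using lip[of 0 "axis i 1"] by linarith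
          qed
          ultimately have [measurable]: "k \<in> borel_measurable borel"
            by (intro borel_measurable_continuous_onI lipschitz_on_continuous_on) auto
          define \<eta> where "\<eta> = (\<lambda>x :: 'd path. (k (fst x) *\<^sub>R axis i 1 :: real ^ 'd, 0 :: real ^ 'd))"
          have "\<eta> \<in> adapted_fields"
          proof (rule adapted_fieldsI)
            show "\<eta> \<in> borel_measurable borel" unfolding \<eta>_def by measurable
            show "norm (\<eta> x) \<le> 1" for x using k by (simp add: \<eta>_def norm_prod_def abs_of_nonneg)
            show "fst (\<eta> x) = (\<lambda>s. k s *\<^sub>R axis i 1) (fst x)" for x by (simp add: \<eta>_def)
            show "norm ((\<lambda>s. k s *\<^sub>R axis i (1::real)) s - (\<lambda>s. k s *\<^sub>R axis i 1) s') \<le> L * norm (s - s')" for s s'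
              using lip[of s s'] by (simp add: scaleR_diff_left[symmetric] dist_norm)
          qed
          from V0[OF this] show "(\<integral>x. fst (V x) $ i * k (fst x) \<partial>\<mu>) = 0"
            by (simp add: \<eta>_def inner_prod_def inner_axis mult.commute)
        qed
        moreover have "AE x in \<mu>. cond_ex \<mu> fst (\<lambda>x. fst (V x) $ i) x = cond_ex \<mu> fst (\<lambda>x. fst (V x)) x $ i"
          by (rule cond_ex_linear[OF bounded_linear_vec_nth fVi])
        ultimately show ?thesis by eventually_elim simp
      qed
      then have "AE x in \<mu>. \<forall>i\<in>UNIV. cond_ex \<mu> fst (\<lambda>x. fst (V x)) x $ i = 0" by (intro AE_finite_allI) auto
      then show ?thesis by (rule eventually_mono) (simp add: vec_eq_iff)
    qed
    have dD1: "integrable \<mu> (dx1 D)" using integrable_fst[OF D(1)] by (simp add: dx_def)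
    have f1: "AE x in \<mu>. cond_ex \<mu> fst (\<lambda>x. transpose (dx1 D x) *v l) x = transpose (cond_ex \<mu> fst (dx1 D) x) *v l"
      by (rule cond_ex_linear[OF bounded_bilinear.bounded_linear_right[OF bounded_bilinear_transpose_mult] dD1])
    have "integrable \<mu> (\<lambda>x. norm (g x) * norm (dx1 \<psi> x))"
      by (rule integrable_bilinear_bounded(2)[OF bounded_bilinear_transpose_mult gi, where b="real CARD('l) * L1"])
        (use norm_dx_psi_le(1) in \<open>auto\<close>)
    then have f2: "AE x in \<mu>. cond_ex \<mu> fst (\<lambda>x. transpose (dx1 \<psi> x) *v g x) x = transpose (cond_ex \<mu> fst (dx1 \<psi>) x) *v g x"
      by (intro cond_ex_bilinear(1)[OF bounded_bilinear_transpose_mult gF]) measurable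
    have i1: "integrable \<mu> (\<lambda>x. transpose (dx1 D x) *v l)"
      by (rule integrable_bounded_linear[OF bounded_bilinear.bounded_linear_right[OF bounded_bilinear_transpose_mult] dD1])
    have i2: "integrable \<mu> (\<lambda>x. transpose (dx1 \<psi> x) *v g x)"
      by (rule integrable_bilinear_bounded(1)[OF bounded_bilinear_transpose_mult gi, where b="real CARD('l) * L1"])
        (use norm_dx_psi_le(1) in \<open>auto\<close>)
    have fV: "(\<lambda>x. fst (V x)) = (\<lambda>x. transpose (dx1 D x) *v l + transpose (dx1 \<psi> x) *v g x)"
      by (simp add: V_def blk_tapp_def dx_def del: transpose_matrix_vector)
    have f3: "AE x in \<mu>. cond_ex \<mu> fst (\<lambda>x. fst (V x)) x
        = cond_ex \<mu> fst (\<lambda>x. transpose (dx1 D x) *v l) x + cond_ex \<mu> fst (\<lambda>x. transpose (dx1 \<psi> x) *v g x) x"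
      unfolding fV by (rule cond_ex_add[OF i1 i2])
    have z: "AE x in \<mu>. blk_tapp (dx_ad \<mu> D x) l + blk_tapp (dx_ad \<mu> \<psi> x) (g x) = 0"
      using s0 f0 f1 f2 f3
    proof eventually_elim
      case (elim x)
      have "fst (blk_tapp (dx_ad \<mu> D x) l + blk_tapp (dx_ad \<mu> \<psi> x) (g x)) = 0"
        using elim by (simp add: blk_tapp_def dx_ad_def del: transpose_matrix_vector)
      moreover have "snd (blk_tapp (dx_ad \<mu> D x) l + blk_tapp (dx_ad \<mu> \<psi> x) (g x)) = snd (V x)"
        by (simp add: V_def blk_tapp_def dx_ad_def dx_def)
      ultimately show ?case using elim(1) by (simp add: prod_eq_iff)
    qed
    have "Lp_norm q \<mu> (\<lambda>x. blk_tapp (dx_ad \<mu> D x) l + blk_tapp (dx_ad \<mu> \<psi> x) (hh (fst x))) = 0"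
    proof -
      have "(\<integral>x. norm (blk_tapp (dx_ad \<mu> D x) l + blk_tapp (dx_ad \<mu> \<psi> x) (hh (fst x))) powr q \<partial>\<mu>) = 0"
        using z unfolding g_hh by (intro integral_eq_zero_AE) (auto elim: eventually_mono)
      then show ?thesis by (simp add: Lp_norm_def)
    qed
    with iv[OF hLp, of l] have "c' * (norm l + Lp_norm q \<mu> (\<lambda>x. hh (fst x))) \<le> 0" by simp
    then have "norm l + Lp_norm q \<mu> (\<lambda>x. hh (fst x)) \<le> 0" using c' by (simp add: mult_le_0_iff)
    moreover have "Lp_norm q \<mu> (\<lambda>x. hh (fst x)) \<ge> 0" by (simp add: Lp_norm_def)
    ultimately have "norm l \<le> 0" by linarith
    then show "l = 0" by simp
  qed
  ultimately have "S = UNIV" by (rule subspace_eq_UNIV)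
  then have "w \<in> S" by simp
  then show ?thesis unfolding S_def by blast
qed

end

section \<open>Bicausal couplings\<close>

text \<open>If \<open>V'\<^sub>1\<close> is a function of \<open>V\<^sub>1\<close>, it factors out of every conditional expectation given \<open>V\<^sub>1\<close>.\<close>

lemma causal_distr:
  fixes V V' :: "'a \<Rightarrow> 'd::finite path"
  assumes P: "prob_space P" and [measurable]: "V \<in> borel_measurable P" "V' \<in> borel_measurable P"
    "k \<in> borel_measurable borel" and k: "\<And>\<omega>. fst (V' \<omega>) = k (fst (V \<omega>))"
  shows "causal (distr P borel (\<lambda>\<omega>. (V \<omega>, V' \<omega>)))"
  unfolding causal_def
proof (intro allI impI)
  fix f :: "'d path \<Rightarrow> real" and g :: "real ^ 'd \<Rightarrow> real"
  assume [measurable]: "f \<in> borel_measurable borel" "g \<in> borel_measurable borel"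
    and bd: "bounded (range f)" "bounded (range g)"
  define Q where "Q = distr P borel (\<lambda>\<omega>. (V \<omega>, V' \<omega>))"
  have sQ [measurable_cong]: "sets Q = sets borel" by (simp add: Q_def)
  have pQ: "prob_space Q" unfolding Q_def by (rule prob_space.prob_space_distr[OF P]) measurable
  interpret Q: conditioning Q "\<lambda>z :: 'd path \<times> 'd path. fst (fst z)"
    unfolding conditioning_def conditioning_axioms_def using pQ by simp
  define G where "G = (\<lambda>z :: 'd path \<times> 'd path. g (k (fst (fst z))))"
  have GF: "G \<in> borel_measurable Q.\<F>" unfolding G_def by (rule Q.F_measurable_compose) measurable
  have [measurable]: "G \<in> borel_measurable Q" by (rule Q.F_measurable_M[OF GF])
  have AE: "AE z in Q. g (fst (snd z)) = G z"
    unfolding Q_def G_def by (subst AE_distr_iff) (auto simp: k)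
  obtain Bf Bg where B: "\<And>x. norm (f x) \<le> Bf" "\<And>s. norm (g s) \<le> Bg"
    using bd by (auto simp: bounded_iff)
  have "norm (G z * f (fst z)) \<le> Bg * Bf" for z
    unfolding norm_mult G_def by (intro mult_mono B) (auto intro: order_trans[OF norm_ge_zero B(2)])
  then have i1: "integrable Q (\<lambda>z. G z * f (fst z))"
    by (intro Q.integrable_const_bound[where B="Bg * Bf"]) auto
  have i2: "integrable Q G"
    by (intro Q.integrable_const_bound[where B=Bg]) (auto simp: G_def B(2) simp del: real_norm_def)
  have 1: "AE z in Q. real_cond_exp Q Q.\<F> (\<lambda>z. f (fst z) * g (fst (snd z))) z = real_cond_exp Q Q.\<F> (\<lambda>z. G z * f (fst z)) z"
  proof (rule Q.C.real_cond_exp_cong)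
    show "AE z in Q. f (fst z) * g (fst (snd z)) = G z * f (fst z)" using AE by eventually_elim simp
  qed measurable
  have 2: "AE z in Q. real_cond_exp Q Q.\<F> (\<lambda>z. G z * f (fst z)) z = G z * real_cond_exp Q Q.\<F> (\<lambda>z. f (fst z)) z"
    by (rule Q.C.real_cond_exp_mult[OF GF _ i1]) measurable
  have 3: "AE z in Q. real_cond_exp Q Q.\<F> (\<lambda>z. g (fst (snd z))) z = real_cond_exp Q Q.\<F> G z"
    by (rule Q.C.real_cond_exp_cong[OF AE]) measurable
  have 4: "AE z in Q. real_cond_exp Q Q.\<F> G z = G z" by (rule Q.C.real_cond_exp_F_meas[OF i2 GF])
  have "AE z in Q. cond_ex Q (\<lambda>z. fst (fst z)) (\<lambda>z. f (fst z) * g (fst (snd z))) z =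
          cond_ex Q (\<lambda>z. fst (fst z)) (\<lambda>z. f (fst z)) z *
          cond_ex Q (\<lambda>z. fst (fst z)) (\<lambda>z. g (fst (snd z))) z"
    unfolding cond_ex_real using 1 2 3 4 by eventually_elim simp
  then show "AE z in distr P borel (\<lambda>\<omega>. (V \<omega>, V' \<omega>)). cond_ex (distr P borel (\<lambda>\<omega>. (V \<omega>, V' \<omega>))) (\<lambda>z. fst (fst z)) (\<lambda>z. f (fst z) * g (fst (snd z))) z =
          cond_ex (distr P borel (\<lambda>\<omega>. (V \<omega>, V' \<omega>))) (\<lambda>z. fst (fst z)) (\<lambda>z. f (fst z)) z *
          cond_ex (distr P borel (\<lambda>\<omega>. (V \<omega>, V' \<omega>))) (\<lambda>z. fst (fst z)) (\<lambda>z. g (fst (snd z))) z"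
    unfolding Q_def .
qed

text \<open>Causality in both directions holds because each first coordinate is a Borel function of
  the other.\<close>

lemma bicausal_distr:
  fixes V V' :: "'a \<Rightarrow> 'd::finite path"
  assumes P: "prob_space P" and V: "V \<in> borel_measurable P" "V' \<in> borel_measurable P"
    and k: "k \<in> borel_measurable borel" "\<And>\<omega>. fst (V' \<omega>) = k (fst (V \<omega>))"
    and k': "k' \<in> borel_measurable borel" "\<And>\<omega>. fst (V \<omega>) = k' (fst (V' \<omega>))"
  shows "distr P borel (\<lambda>\<omega>. (V \<omega>, V' \<omega>)) \<in> bicausal_couplings (distr P borel V) (distr P borel V')"
proof -
  note [measurable] = V
  have "distr (distr P borel (\<lambda>\<omega>. (V \<omega>, V' \<omega>))) borel (\<lambda>z. (snd z, fst z)) = distr P borel (\<lambda>\<omega>. (V' \<omega>, V \<omega>))"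
    by (subst distr_distr) (auto simp: comp_def)
  then show ?thesis
    unfolding bicausal_couplings_def
    using causal_distr[OF P V k] causal_distr[OF P V(2,1) k'] coupling_distr[OF V] by simp
qed

text \<open>Banach's theorem applied to s \<mapsto> y - t s shows that the map is onto, and it
  expands distances by at least 1/2. A selected preimage is therefore 2-Lipschitz in y, which makes
  the inverse Borel.\<close>

lemma id_plus_contraction_left_inverse:
  fixes t :: "'c::euclidean_space \<Rightarrow> 'c"
  assumes t: "\<And>s s'. norm (t s - t s') \<le> 1/2 * norm (s - s')"
  shows "\<exists>j\<in>borel_measurable borel. \<forall>s. j (s + t s) = s"
proof -
  have ex: "\<exists>s. s + t s = y" for y
  proof -
    have "\<exists>!s\<in>UNIV. y - t s = s"
    proof (rule Banach_fix)
      show "dist (y - t s) (y - t s') \<le> 1/2 * dist s s'" for s s'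
        using t[of s' s] by (simp add: dist_norm norm_minus_commute)
    qed (auto simp: complete_UNIV)
    then obtain s where "y - t s = s" by blast
    then have "s + t s = y" by (metis diff_add_cancel)
    then show ?thesis by blast
  qed
  have exp: "norm (s - s') \<le> 2 * norm ((s + t s) - (s' + t s'))" for s s'
  proof -
    have "s - s' = ((s + t s) - (s' + t s')) - (t s - t s')" by simp
    then have "norm (s - s') \<le> norm ((s + t s) - (s' + t s')) + norm (t s - t s')" by (metis norm_triangle_ineq4)
    then show ?thesis using t[of s s'] by simp
  qed
  define j where "j = (\<lambda>y. SOME s. s + t s = y)"
  have j: "j y + t (j y) = y" for y unfolding j_def by (rule someI_ex) (rule ex)
  have "2-lipschitz_on UNIV j"
    using exp[of "j _" "j _"] by (intro lipschitz_onI) (auto simp: j dist_norm)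
  then have "j \<in> borel_measurable borel"
    by (intro borel_measurable_continuous_onI lipschitz_on_continuous_on) auto
  moreover have "j (s + t s) = s" for s
    using exp[of "j (s + t s)" s] by (simp add: j)
  ultimately show ?thesis by blast
qed

text \<open>The conditional effect of \<Theta> must enter the final bound through its L^p norm, so
  the displacement bound has a constant part \<alpha> and a variable part Z. The factor 4 is 2 from
  splitting the p-th power times 2^(1/p) \<le> 2 from splitting the root.\<close>

lemma transport_cost_distr_le_Lp:
  fixes U V :: "'a \<Rightarrow> 'b::euclidean_space"
  assumes "prob_space P" and [measurable]: "U \<in> borel_measurable P" "V \<in> borel_measurable P"
    and b: "AE \<omega> in P. norm (U \<omega> - V \<omega>) \<le> \<alpha> + Z \<omega>" and \<alpha>: "0 \<le> \<alpha>" and Z: "\<And>\<omega>. 0 \<le> Z \<omega>"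
    and Zp: "integrable P (\<lambda>\<omega>. Z \<omega> powr p)" and p: "p > 1"
  shows "transport_cost p (distr P borel (\<lambda>\<omega>. (U \<omega>, V \<omega>))) \<le> 4 * (\<alpha> + (\<integral>\<omega>. Z \<omega> powr p \<partial>P) powr (1 / p))"
proof -
  interpret prob_space P by fact
  define I where "I = (\<integral>\<omega>. Z \<omega> powr p \<partial>P)"
  have I: "I \<ge> 0" unfolding I_def by (intro integral_nonneg_AE) auto
  have "(\<integral>z. norm (fst z - snd z) powr p \<partial>distr P borel (\<lambda>\<omega>. (U \<omega>, V \<omega>)))
      = (\<integral>\<omega>. norm (U \<omega> - V \<omega>) powr p \<partial>P)"
    by (subst integral_distr) auto
  also have "\<dots> \<le> (\<integral>\<omega>. 2 powr p * (\<alpha> powr p + Z \<omega> powr p) \<partial>P)"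
  proof (rule integral_mono_AE')
    show "integrable P (\<lambda>\<omega>. 2 powr p * (\<alpha> powr p + Z \<omega> powr p))" using Zp by auto
    show "AE \<omega> in P. norm (U \<omega> - V \<omega>) powr p \<le> 2 powr p * (\<alpha> powr p + Z \<omega> powr p)"
      using b
    proof (rule eventually_mono)
      fix \<omega> assume "norm (U \<omega> - V \<omega>) \<le> \<alpha> + Z \<omega>"
      then have "norm (U \<omega> - V \<omega>) powr p \<le> (\<alpha> + Z \<omega>) powr p" using p by (intro powr_mono2) auto
      also have "\<dots> \<le> 2 powr p * (\<alpha> powr p + Z \<omega> powr p)" using \<alpha> Z p by (intro powr_add_le) auto
      finally show "norm (U \<omega> - V \<omega>) powr p \<le> 2 powr p * (\<alpha> powr p + Z \<omega> powr p)" .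
    qed
  qed auto
  also have "\<dots> = 2 powr p * (\<alpha> powr p + I)" using Zp by (simp add: I_def prob_space)
  finally have "transport_cost p (distr P borel (\<lambda>\<omega>. (U \<omega>, V \<omega>))) \<le> (2 powr p * (\<alpha> powr p + I)) powr (1 / p)"
    unfolding transport_cost_def using p by (intro powr_mono2) auto
  also have "\<dots> = 2 * (\<alpha> powr p + I) powr (1 / p)" using p by (simp add: powr_mult powr_powr)
  also have "\<dots> \<le> 2 * (2 powr (1 / p) * ((\<alpha> powr p) powr (1 / p) + I powr (1 / p)))"
    using I p by (intro mult_left_mono powr_add_le) auto
  also have "(\<alpha> powr p) powr (1 / p) = \<alpha>" using \<alpha> p by (simp add: powr_powr)
  also have "2 * (2 powr (1 / p) * (\<alpha> + I powr (1 / p))) \<le> 2 * (2 powr 1 * (\<alpha> + I powr (1 / p)))"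
    using \<alpha> p by (intro mult_left_mono mult_right_mono powr_mono) (auto simp: divide_le_eq)
  finally show ?thesis by (simp add: I_def)
qed

text \<open>On the compact support the derivative is bounded by continuity; off it the function
  vanishes on an open set, so zero is a valid derivative there.\<close>

lemma C1_compact_support_lipschitz:
  fixes t :: "'a::euclidean_space \<Rightarrow> 'b::euclidean_space"
  assumes "C1 t" and K: "compact (closure {s. t s \<noteq> 0})"
  shows "\<exists>L. \<forall>s s'. norm (t s - t s') \<le> L * norm (s - s')"
proof -
  obtain t' :: "'a \<Rightarrow> 'a \<Rightarrow>\<^sub>L 'b" where t': "\<And>s. (t has_derivative blinfun_apply (t' s)) (at s)" "continuous_on UNIV t'"
    using assms(1) unfolding C1_def by blast
  define K where "K = closure {s. t s \<noteq> 0}"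
  have "compact (t' ` K)" unfolding K_def using K by (intro compact_continuous_image continuous_on_subset[OF t'(2)]) auto
  then obtain L where L: "L > 0" "\<And>y. y \<in> t' ` K \<Longrightarrow> norm y \<le> L" using compact_imp_bounded bounded_pos by metis
  define D where "D = (\<lambda>s. if s \<in> K then t' s else 0)"
  have "(t has_derivative blinfun_apply (D s)) (at s within UNIV)" for s
  proof (cases "s \<in> K")
    case False
    have "((\<lambda>_. 0) has_derivative (\<lambda>_. 0)) (at s)" by (rule has_derivative_const)
    then have "(t has_derivative (\<lambda>_. 0)) (at s)"
    proof (rule has_derivative_transform_within_open)
      show "open (- K)" by (simp add: K_def open_Compl)
      show "s \<in> - K" using False by simp
      show "0 = t x" if "x \<in> - K" for x using that closure_subset[of "{s. t s \<noteq> 0}"] by (auto simp: K_def)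
    qed
    then show ?thesis using False by (simp add: D_def zero_blinfun.rep_eq)
  qed (simp add: D_def t')
  moreover have "onorm (blinfun_apply (D s)) \<le> L" for s
  proof -
    have "norm (D s) \<le> L" using L by (auto simp: D_def)
    then show ?thesis by (simp only: norm_blinfun.rep_eq)
  qed
  ultimately have "norm (t s - t s') \<le> L * norm (s - s')" for s s'
    by (intro differentiable_bound[of UNIV t "\<lambda>s. blinfun_apply (D s)" L]) auto
  then show ?thesis by blast
qed

text \<open>The first component, as a function on S, is the section of \<Theta> at x_2 = 0 and
  inherits C1. Its compact support is understood in S, which is where boundedness and the Lipschitz
  constant come from.\<close>

lemma adapted_C1_in_adapted_fields:
  fixes \<Theta> :: "'d::finite path \<Rightarrow> 'd path"
  assumes C1: "C1 \<Theta>" and supp: "compact_supp W_ad \<Theta>" and ad: "adapted \<Theta>"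
  shows "\<Theta> \<in> adapted_fields"
proof -
  obtain t where t: "\<And>x. fst (\<Theta> x) = t (fst x)" using ad by (auto simp: adapted_def simp del: split_paired_All)
  have cont: "continuous_on UNIV \<Theta>" by (rule C1_imp_continuous_on[OF C1])
  have te: "t = (\<lambda>s. fst (\<Theta> (s, 0)))" using t by auto
  have "{s. t s \<noteq> 0} = fst ` {x. fst (\<Theta> x) \<noteq> 0}"
    by (force simp: t image_iff)
  then have K: "compact (closure {s. t s \<noteq> 0})" "compact (closure {x. snd (\<Theta> x) \<noteq> 0})" using supp by simp_all
  have C1t: "C1 t"
  proof -
    obtain f' :: "'d path \<Rightarrow> 'd path \<Rightarrow>\<^sub>L 'd path" where f': "\<And>x. (\<Theta> has_derivative blinfun_apply (f' x)) (at x)" "continuous_on UNIV f'"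
      using C1 unfolding C1_def by blast
    \<comment> \<open>Composition with a fixed embedding and projection keeps the derivative
      continuous in operator norm, as \<open>C1\<close> requires.\<close>
    define in1 :: "(real ^ 'd) \<Rightarrow>\<^sub>L 'd path" where "in1 = Blinfun (\<lambda>h. (h, 0))"
    define out1 :: "'d path \<Rightarrow>\<^sub>L (real ^ 'd)" where "out1 = Blinfun fst"
    have bl: "bounded_linear (\<lambda>h :: real ^ 'd. (h, 0 :: real ^ 'd))"
      by (intro bounded_linear_Pair bounded_linear_ident bounded_linear_zero)
    have in1: "blinfun_apply in1 h = (h, 0)" for h unfolding in1_def by (simp add: bounded_linear_Blinfun_apply bl)
    have out1: "blinfun_apply out1 z = fst z" for z unfolding out1_def by (simp add: bounded_linear_Blinfun_apply bounded_linear_fst)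
    have "(t has_derivative blinfun_apply (out1 o\<^sub>L f' (s, 0) o\<^sub>L in1)) (at s)" for s
    proof -
      have "((\<lambda>s. (s, 0)) has_derivative (\<lambda>h. (h, 0))) (at s)" by (intro has_derivative_Pair has_derivative_ident has_derivative_const)
      from has_derivative_compose[OF this f'(1)]
      have "((\<lambda>s. fst (\<Theta> (s, 0))) has_derivative (\<lambda>h. fst (blinfun_apply (f' (s, 0)) (h, 0)))) (at s)"
        by (rule has_derivative_fst)
      moreover have "blinfun_apply (out1 o\<^sub>L f' (s, 0) o\<^sub>L in1) = (\<lambda>h. fst (blinfun_apply (f' (s, 0)) (h, 0)))"
        by (rule ext) (simp add: in1 out1)
      ultimately show ?thesis unfolding te by simp
    qed
    moreover have "continuous_on UNIV (\<lambda>s. out1 o\<^sub>L f' (s, 0) o\<^sub>L in1)"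
      by (intro continuous_intros continuous_on_compose2[OF f'(2)]) auto
    ultimately show ?thesis unfolding C1_def by (intro exI[of _ "\<lambda>s. out1 o\<^sub>L f' (s, 0) o\<^sub>L in1"]) simp
  qed
  obtain L where L: "\<And>s s'. norm (t s - t s') \<le> L * norm (s - s')" using C1_compact_support_lipschitz[OF C1t K(1)] by blast
  obtain b1 where b1: "\<And>s. norm (t s) \<le> b1" using bounded_of_compact_support[OF C1_imp_continuous_on[OF C1t] K(1)] by blast
  have "continuous_on UNIV (\<lambda>x. snd (\<Theta> x))" using cont by (intro continuous_intros)
  from bounded_of_compact_support[OF this K(2)] obtain b2 where b2: "\<And>x. norm (snd (\<Theta> x)) \<le> b2" by blast
  show ?thesis
  proof (rule adapted_fieldsI[OF _ _ t L])
    show "\<Theta> \<in> borel_measurable borel" using cont by (rule borel_measurable_continuous_onI)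
    show "norm (\<Theta> x) \<le> b1 + b2" for x
    proof -
      have "norm (\<Theta> x) \<le> norm (fst (\<Theta> x)) + norm (snd (\<Theta> x))" using norm_Pair_le[of "fst (\<Theta> x)" "snd (\<Theta> x)"] by simp
      then show ?thesis using b1[of "fst x"] b2[of x] by (simp add: t)
    qed
  qed
qed

text \<open>Growth of order p - 1 fits the conjugate exponent because (p - 1) p' = p, the available
  moment.\<close>

lemma integrable_dx_conj_powr:
  assumes R: "condition_R p g D" and p: "p > 1" and m: "m \<in> prob_moment p"
  shows "integrable m (dx (D m))" "integrable m (\<lambda>x. norm (dx (D m) x) powr conj_exp p)"
proof -
  note m' = prob_momentD[OF m] and [simp] = prob_moment_measurable_eq[OF m]
  interpret prob_space m by fact
  have [measurable]: "dx (D m) \<in> borel_measurable m" using condition_R_dx(1)[OF R p m] by simp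
  show "integrable m (dx (D m))" using integrable_dx[OF R p m'(1) m _ m'(4)] by simp
  obtain C where C: "C \<ge> 0" "\<And>x. norm (dx (D m) x) \<le> C * (1 + norm x powr (p - 1))"
    using condition_R_dx(2)[OF R p m] by blast
  define q where "q = conj_exp p"
  have q: "q > 0" "(p - 1) * q = p" using p by (simp_all add: q_def conj_exp_def)
  show "integrable m (\<lambda>x. norm (dx (D m) x) powr conj_exp p)"
    unfolding q_def[symmetric]
  proof (rule Bochner_Integration.integrable_bound)
    show "integrable m (\<lambda>x. C powr q * (2 powr q * (1 + norm x powr p)))" using m'(4) by auto
    have "norm (dx (D m) x) powr q \<le> C powr q * (2 powr q * (1 + norm x powr p))" for x
    proof -
      have "norm (dx (D m) x) powr q \<le> (C * (1 + norm x powr (p - 1))) powr q" using q C(2) by (intro powr_mono2) auto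
      also have "\<dots> = C powr q * (1 + norm x powr (p - 1)) powr q" by (rule powr_mult)
      also have "\<dots> \<le> C powr q * (2 powr q * (1 powr q + (norm x powr (p - 1)) powr q))"
        using q by (intro mult_left_mono powr_add_le) auto
      also have "(norm x powr (p - 1)) powr q = norm x powr p" by (simp add: powr_powr q)
      finally show ?thesis by simp
    qed
    then show "AE x in m. norm (norm (dx (D m) x) powr q) \<le> norm (C powr q * (2 powr q * (1 + norm x powr p)))"
      by (intro AE_I2) simp
  qed measurable
qed

context constrained
begin

text \<open>A test function is evaluated at the transported first coordinate X_1 + t(X_1), which is
  still a function of X_1. The factor h can therefore be pulled out of the conditional expectation
  given the original X_1, and the constraint annihilates the rest.\<close>

lemma push_in_test_perp:
  fixes T :: "'d path \<Rightarrow> 'd path"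
  assumes p: "p > 1" and \<mu>: "\<mu> \<in> prob_moment p" and T [measurable]: "T \<in> borel_measurable \<mu>"
    and b: "AE x in \<mu>. norm (T x) \<le> b" and t: "\<And>x. fst (T x) = t (fst x)" "continuous_on UNIV t"
    and sol: "AE x in \<mu>. cond_ex \<mu> fst (\<lambda>x. \<psi> (x + T x)) x = 0"
  shows "push \<mu> T \<in> test_perp p \<psi>"
  unfolding test_perp_def
proof (intro CollectI conjI ballI)
  show "push \<mu> T \<in> prob_moment p"
    using T unfolding measurable_borel_eq by (rule push_in_prob_moment[OF \<mu> _ b p])
  fix f assume "f \<in> test_funs \<psi>"
  then obtain h where f: "f = (\<lambda>x. h (fst x) \<bullet> \<psi> x)" and h: "C1_bounded h" by (auto simp: test_funs_def)
  obtain B where B: "\<And>s. norm (h s) \<le> B" using h by (auto simp: C1_bounded_def bounded_iff)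
  have hc: "continuous_on UNIV h"
    using h unfolding C1_bounded_def by (meson continuous_at_imp_continuous_on has_derivative_continuous)
  then have [measurable]: "h \<in> borel_measurable borel" by (rule borel_measurable_continuous_onI)
  define A where "A = (\<lambda>x :: 'd path. h (fst x + t (fst x)))"
  have "continuous_on UNIV (\<lambda>s. h (s + t s))" using t(2) by (intro continuous_on_compose2[OF hc] continuous_intros) auto
  then have AF: "A \<in> borel_measurable \<F>" unfolding A_def by (intro F_measurable_compose borel_measurable_continuous_onI)
  have Am [measurable]: "A \<in> borel_measurable \<mu>" by (rule F_measurable_M[OF AF])
  have AB: "AE x in \<mu>. norm (A x) \<le> B" by (simp add: A_def B)
  have i: "integrable \<mu> (\<lambda>x. norm (A x) * norm (\<psi> (x + T x)))"
    using integrable_bilinear_bounded(2)[OF bounded_bilinear_inner integrable_psi[OF T b] Am AB]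
    by (simp add: mult.commute)
  have "(\<integral>x. f x \<partial>push \<mu> T) = (\<integral>x. f (x + T x) \<partial>\<mu>)"
    unfolding push_def f by (rule integral_distr) measurable
  also have "\<dots> = (\<integral>x. A x \<bullet> \<psi> (x + T x) \<partial>\<mu>)" by (simp add: f A_def t)
  also have "\<dots> = (\<integral>x. A x \<bullet> cond_ex \<mu> fst (\<lambda>x. \<psi> (x + T x)) x \<partial>\<mu>)"
    by (rule integral_bilinear_cond_ex[OF bounded_bilinear_inner AF _ i, symmetric]) measurable
  also have "\<dots> = 0" using sol by (intro integral_eq_zero_AE) (auto elim: eventually_mono)
  finally show "(\<integral>x. f x \<partial>push \<mu> T) = 0" .
qed

text \<open>Sharper than the sup bound K0 b: the contribution of \<Theta> is kept as the pointwise
  size of E_1[(\<partial>\<psi>) \<Theta>], ready to be integrated, while H and the quadratic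
  remainder are estimated in sup norm.\<close>

lemma norm_lift_solution_le:
  assumes U: "U = (\<lambda>x. r *\<^sub>R \<Theta> x + H x)" "r \<ge> 0" and [measurable]: "\<Theta> \<in> borel_measurable \<mu>" "H \<in> borel_measurable \<mu>"
    and \<Theta>b: "AE x in \<mu>. norm (\<Theta> x) \<le> b\<Theta>" and Hb: "AE x in \<mu>. norm (H x) \<le> bH"
    and h: "h \<in> borel_measurable \<F>" "AE x in \<mu>. norm (h x) \<le> K0 * b"
    and Ub: "AE x in \<mu>. norm (U x) \<le> b" "0 \<le> b"
    and sol: "AE x in \<mu>. cond_ex \<mu> fst (\<lambda>x. \<psi> (x + (U x + lift h x))) x = 0"
  shows "AE x in \<mu>. norm (lift h x) \<le> L1 / c * (r * norm (cond_ex \<mu> fst (\<lambda>x. blk_app (dx \<psi> x) (\<Theta> x)) x)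
    + real CARD('l) * L1 * bH + K\<psi> * (1 + K0)\<^sup>2 * b\<^sup>2)"
proof -
  have Um: "U \<in> borel_measurable \<mu>" unfolding U(1) by measurable
  have r\<Theta>: "AE x in \<mu>. norm (r *\<^sub>R \<Theta> x) \<le> r * b\<Theta>"
    using \<Theta>b by (rule eventually_mono) (use U(2) in \<open>simp add: mult_left_mono\<close>)
  have i\<Theta>: "integrable \<mu> (\<lambda>x. blk_app (dx \<psi> x) (\<Theta> x))" by (rule integrable_blk_psi[OF _ \<Theta>b]) measurable
  have ir: "integrable \<mu> (\<lambda>x. r *\<^sub>R blk_app (dx \<psi> x) (\<Theta> x))" using i\<Theta> by simp
  have iH: "integrable \<mu> (\<lambda>x. blk_app (dx \<psi> x) (H x))" by (rule integrable_blk_psi[OF _ Hb]) measurable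
  have eq: "(\<lambda>x. blk_app (dx \<psi> x) (U x)) = (\<lambda>x. r *\<^sub>R blk_app (dx \<psi> x) (\<Theta> x) + blk_app (dx \<psi> x) (H x))"
    by (simp add: U(1) blk_app.add_right blk_app.scaleR_right)
  have 1: "AE x in \<mu>. cond_ex \<mu> fst (\<lambda>x. blk_app (dx \<psi> x) (U x)) x
      = cond_ex \<mu> fst (\<lambda>x. r *\<^sub>R blk_app (dx \<psi> x) (\<Theta> x)) x + cond_ex \<mu> fst (\<lambda>x. blk_app (dx \<psi> x) (H x)) x"
    unfolding eq by (rule cond_ex_add[OF ir iH])
  have 2: "AE x in \<mu>. cond_ex \<mu> fst (\<lambda>x. r *\<^sub>R blk_app (dx \<psi> x) (\<Theta> x)) x = r *\<^sub>R cond_ex \<mu> fst (\<lambda>x. blk_app (dx \<psi> x) (\<Theta> x)) x"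
    by (rule cond_ex_linear[OF bounded_linear_scaleR_right i\<Theta>])
  have 3: "AE x in \<mu>. norm (cond_ex \<mu> fst (\<lambda>x. blk_app (dx \<psi> x) (H x)) x) \<le> real CARD('l) * L1 * bH"
    by (rule cond_ex_blk_le[OF _ Hb]) measurable
  have 4: "AE x in \<mu>. norm (gram x *v h x + cond_ex \<mu> fst (\<lambda>x. blk_app (dx \<psi> x) (U x)) x) \<le> K\<psi> * (1 + K0)\<^sup>2 * b\<^sup>2"
    by (rule solution_expansion[OF Um h(1) Ub(1) h(2) Ub(2) sol])
  show ?thesis
    using 1 2 3 4 gram_coercive
  proof eventually_elim
    case (elim x)
    define Z where "Z = cond_ex \<mu> fst (\<lambda>x. blk_app (dx \<psi> x) (\<Theta> x)) x"
    define Y where "Y = cond_ex \<mu> fst (\<lambda>x. blk_app (dx \<psi> x) (H x)) x"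
    define R where "R = r * norm Z + real CARD('l) * L1 * bH + K\<psi> * (1 + K0)\<^sup>2 * b\<^sup>2"
    have e: "cond_ex \<mu> fst (\<lambda>x. blk_app (dx \<psi> x) (U x)) x = r *\<^sub>R Z + Y" using elim by (simp add: Z_def Y_def)
    have "c * norm (h x) \<le> norm (gram x *v h x)" using elim(5) by blast
    also have "\<dots> \<le> norm (gram x *v h x + (r *\<^sub>R Z + Y)) + norm (r *\<^sub>R Z + Y)"
      using norm_triangle_ineq4[of "gram x *v h x + (r *\<^sub>R Z + Y)" "r *\<^sub>R Z + Y"] by simp
    also have "norm (r *\<^sub>R Z + Y) \<le> norm (r *\<^sub>R Z) + norm Y" by (rule norm_triangle_ineq)
    finally have "c * norm (h x) \<le> R" using elim(3,4) U(2) unfolding e by (simp add: R_def Y_def)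
    then have "norm (h x) \<le> R / c" using c_pos by (simp add: pos_le_divide_eq mult.commute)
    then have "norm (lift h x) \<le> L1 * (R / c)" using norm_lift_le[of h x] L1(1) by (meson mult_left_mono order_trans)
    then show ?case by (simp add: R_def Z_def)
  qed
qed

end

section \<open>The adapted case\<close>

context constrained
begin

text \<open>The field has two layers: U = r \<Theta> + \<Sum> a_i \<eta>_i, and the lift that
  restores the constraint for this U. Taking v to be the linear response of \<Theta>, corrected by
  the multiplier, makes the combined field respond by r v + a up to a quadratic error.\<close>

lemma Limsup_ad_wasserstein_le:
  fixes \<phi> :: "'d path measure \<Rightarrow> real ^ 'k::finite"
  assumes p: "p > 1" and \<mu>: "\<mu> \<in> prob_moment p" and R: "condition_R p \<phi> D" and \<phi>0: "\<phi> \<mu> = 0"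
    and c': "c' > 0"
    and iv: "\<And>lam h. h \<in> Lp (conj_exp p) (distr \<mu> borel fst) \<Longrightarrow>
        Lp_norm (conj_exp p) \<mu> (\<lambda>x. blk_tapp (dx_ad \<mu> (D \<mu>) x) lam + blk_tapp (dx_ad \<mu> \<psi> x) (h (fst x)))
        \<ge> c' * (norm lam + Lp_norm (conj_exp p) \<mu> (\<lambda>x. h (fst x)))"
    and \<Theta>: "\<Theta> \<in> adapted_fields"
  shows "\<exists>C>0. Limsup (at_right 0)
      (\<lambda>r. ereal (1 / r) * tdist_set W_ad p (push \<mu> (\<lambda>x. r *\<^sub>R \<Theta> x)) (zero_set p \<phi> \<inter> test_perp p \<psi>))
    \<le> ereal (C * (norm (\<integral>x. blk_app (dx (D \<mu>) x) (\<Theta> x) \<partial>\<mu>)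
        + Lp_norm p \<mu> (cond_ex \<mu> fst (\<lambda>x. blk_app (dx \<psi> x) (\<Theta> x)))))"
proof -
  define q where "q = conj_exp p"
  have q: "q \<ge> 1" using p by (simp add: q_def conj_exp_def)
  have Dq: "integrable \<mu> (dx (D \<mu>))" "integrable \<mu> (\<lambda>x. norm (dx (D \<mu>) x) powr q)"
    unfolding q_def by (rule integrable_dx_conj_powr[OF R p \<mu>])+
  have G: "integrable \<mu> (multiplier (D \<mu>))" by (rule integrable_multiplier_powr(2)[OF Dq q])
  have "\<forall>i. \<exists>\<eta>. \<eta> \<in> adapted_fields \<and> lin_response (D \<mu>) \<eta> = axis i (1 :: real)"
    using lin_response_onto[OF Dq q c' iv[folded q_def]] by blast
  from choice[OF this] obtain \<eta> where \<eta>: "\<forall>i. \<eta> i \<in> adapted_fields \<and> lin_response (D \<mu>) (\<eta> i) = axis i (1 :: real)"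
    by (rule exE)
  have "\<forall>i. \<exists>b t L. \<eta> i \<in> borel_measurable borel \<and> (\<forall>x. norm (\<eta> i x) \<le> b) \<and> (\<forall>x. fst (\<eta> i x) = t (fst x)) \<and>
      (\<forall>s s'. norm (t s - t s') \<le> L * norm (s - s'))"
    using \<eta> unfolding adapted_fields_def by blast
  then obtain b' t' L' where \<eta>': "\<forall>i. \<eta> i \<in> borel_measurable borel \<and> (\<forall>x. norm (\<eta> i x) \<le> b' i) \<and> (\<forall>x. fst (\<eta> i x) = t' i (fst x)) \<and>
      (\<forall>s s'. norm (t' i s - t' i s') \<le> L' i * norm (s - s'))"
    unfolding choice_iff by blast
  then have \<eta>m: "\<eta> i \<in> borel_measurable borel" and \<eta>b: "norm (\<eta> i x) \<le> b' i" and \<eta>t: "fst (\<eta> i x) = t' i (fst x)"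
    and \<eta>L: "norm (t' i s - t' i s') \<le> L' i * norm (s - s')" for i x s s' by blast+
  obtain b\<Theta> t\<Theta> L\<Theta> where \<Theta>': "\<Theta> \<in> borel_measurable borel" "\<And>x. norm (\<Theta> x) \<le> b\<Theta>" "\<And>x. fst (\<Theta> x) = t\<Theta> (fst x)"
    "\<And>s s'. norm (t\<Theta> s - t\<Theta> s') \<le> L\<Theta> * norm (s - s')" by (rule adapted_fieldsE[OF \<Theta>]) blast
  define N where "N = real CARD('k)"
  define b1 where "b1 = Max (range b')"
  define l1 where "l1 = Max (range L')"
  have M: "b' i \<le> b1" "L' i \<le> l1" for i unfolding b1_def l1_def by (rule Max_ge; simp)+
  have \<eta>b1: "norm (\<eta> i x) \<le> b1" for i x by (rule order_trans[OF \<eta>b M(1)])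
  have \<eta>l1: "norm (t' i s - t' i s') \<le> l1 * norm (s - s')" for i s s'
    by (rule order_trans[OF \<eta>L mult_right_mono[OF M(2)]]) simp
  \<comment> \<open>One constant for the sup bounds and the Lipschitz constants of \<Theta> and of
    all linear combinations of the \<eta>_i.\<close>
  define K1 where "K1 = 1 + \<bar>b\<Theta>\<bar> + \<bar>L\<Theta>\<bar> + \<bar>N * b1\<bar> + \<bar>N * l1\<bar>"
  have K1: "K1 \<ge> 1" "\<bar>b\<Theta>\<bar> \<le> K1" "\<bar>L\<Theta>\<bar> \<le> K1" "\<bar>N * b1\<bar> \<le> K1" "\<bar>N * l1\<bar> \<le> K1" by (simp_all add: K1_def)
  define H where "H = (\<lambda>(a :: real ^ 'k) x. \<Sum>i\<in>UNIV. a $ i *\<^sub>R \<eta> i x)"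
  define U where "U = (\<lambda>r a x. r *\<^sub>R \<Theta> x + H a x)"
  define \<tau> where "\<tau> = (\<lambda>r (a :: real ^ 'k) s. r *\<^sub>R t\<Theta> s + (\<Sum>i\<in>UNIV. a $ i *\<^sub>R t' i s))"
  note [measurable] = \<eta>m \<Theta>'(1)
  have Hm [measurable]: "H a \<in> borel_measurable \<mu>" for a unfolding H_def measurable_borel_eq by measurable
  have \<Theta>m [measurable]: "\<Theta> \<in> borel_measurable \<mu>" unfolding measurable_borel_eq by measurable
  have Um [measurable]: "U r a \<in> borel_measurable \<mu>" for r a unfolding U_def by measurable
  have Hb: "norm (H a x) \<le> K1 * norm a" for a x
    unfolding H_def by (rule order_trans[OF norm_sum_scaleR_le[OF \<eta>b1] mult_right_mono]) (use K1(4) in \<open>auto simp: N_def\<close>)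
  have \<Theta>b: "norm (r *\<^sub>R \<Theta> x) \<le> K1 * r" if "r > 0" for r x
    using that order_trans[OF \<Theta>'(2), of K1 x] K1(2) by (simp add: mult.commute)
  have Ub: "norm (U r a x) \<le> K1 * (r + norm a)" if "r > 0" for r a x
    using norm_triangle_mono[OF \<Theta>b[OF that] Hb] by (simp add: U_def algebra_simps)
  have Ud: "U r a x - U r a' x = H (a - a') x" for r a a' x
    by (simp add: U_def H_def sum_subtractf[symmetric] scaleR_diff_left)
  have U\<tau>: "fst (U r a x) = \<tau> r a (fst x)" for r a x
    by (simp add: U_def H_def \<tau>_def \<Theta>'(3) \<eta>t fst_sum)
  have \<tau>L: "norm (\<tau> r a s - \<tau> r a s') \<le> K1 * (r + norm a) * norm (s - s')" if r: "r > 0" for r a s s'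
  proof -
    have e: "\<tau> r a s - \<tau> r a s' = r *\<^sub>R (t\<Theta> s - t\<Theta> s') + (\<Sum>i\<in>UNIV. a $ i *\<^sub>R (t' i s - t' i s'))"
      by (simp add: \<tau>_def sum_subtractf scaleR_diff_right)
    have "norm (t\<Theta> s - t\<Theta> s') \<le> K1 * norm (s - s')"
      by (rule order_trans[OF \<Theta>'(4) mult_right_mono]) (use K1(3) in auto)
    then have 1: "norm (r *\<^sub>R (t\<Theta> s - t\<Theta> s')) \<le> r * (K1 * norm (s - s'))" using r by (simp add: mult_left_mono)
    have "norm (\<Sum>i\<in>UNIV. a $ i *\<^sub>R (t' i s - t' i s')) \<le> real CARD('k) * (l1 * norm (s - s')) * norm a"
      by (rule norm_sum_scaleR_le) (rule \<eta>l1)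
    also have "\<dots> = (N * l1) * (norm (s - s') * norm a)" by (simp add: N_def mult_ac)
    also have "\<dots> \<le> K1 * (norm (s - s') * norm a)" using K1(5) by (intro mult_right_mono) auto
    finally have "norm (\<tau> r a s - \<tau> r a s') \<le> r * (K1 * norm (s - s')) + K1 * (norm (s - s') * norm a)"
      unfolding e by (rule norm_triangle_mono[OF 1])
    also have "\<dots> = K1 * (r + norm a) * norm (s - s')" by (simp add: algebra_simps)
    finally show ?thesis .
  qed
  have \<tau>0: "\<tau> r 0 = (\<lambda>s. r *\<^sub>R t\<Theta> s)" for r by (simp add: \<tau>_def)
  \<comment> \<open>1/(4 K1) makes the Lipschitz constant K1 (r + |a|) of the first component at
    most 1/2, as needed to invert it. The last term secures the smallness required for solving the
    constraint with the largest bound \<open>bb\<close>; its + 1 covers K\<psi> = 0.\<close>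
  define \<delta>0 where "\<delta>0 = min 1 (min (1 / (4 * K1)) (c / (4 * K1 * (K\<psi> * (1 + K0) + 1))))"
  have KK: "0 \<le> K\<psi> * (1 + K0)" using K\<psi>_nonneg K0_pos by simp
  have \<delta>0: "\<delta>0 > 0" using K1(1) KK c_pos by (simp add: \<delta>0_def add_nonneg_pos)
  define bb where "bb = K1 * (2 * \<delta>0)"
  have bb: "bb \<ge> 0" "bb \<le> 1/2" "K\<psi> * (bb + K0 * bb) \<le> c / 2"
  proof -
    show "bb \<ge> 0" using K1(1) \<delta>0 by (simp add: bb_def)
    have "\<delta>0 \<le> 1 / (4 * K1)" by (simp add: \<delta>0_def)
    then show "bb \<le> 1/2" using K1(1) by (simp add: bb_def field_simps)
    have "\<delta>0 \<le> c / (4 * K1 * (K\<psi> * (1 + K0) + 1))" by (simp add: \<delta>0_def)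
    moreover have "0 < 4 * K1 * (K\<psi> * (1 + K0) + 1)" using K1(1) KK by (intro mult_pos_pos) auto
    ultimately have "\<delta>0 * (4 * K1 * (K\<psi> * (1 + K0) + 1)) \<le> c" by (simp add: pos_le_divide_eq)
    moreover have "K\<psi> * (bb + K0 * bb) = 2 * (K1 * \<delta>0) * (K\<psi> * (1 + K0))" by (simp add: bb_def algebra_simps)
    moreover have "0 \<le> K1 * \<delta>0" using K1(1) \<delta>0 by simp
    ultimately show "K\<psi> * (bb + K0 * bb) \<le> c / 2" by (simp add: algebra_simps)
  qed
  define \<beta> where "\<beta> = (\<lambda>r (a :: real ^ 'k). K1 * (r + norm a))"
  have \<beta>: "0 \<le> \<beta> r a" "\<beta> r a \<le> bb" if "0 < r" "r \<le> \<delta>0" "norm a \<le> \<delta>0" for r a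
    using that K1(1) by (auto simp: \<beta>_def bb_def)
  have small: "K\<psi> * (x + K0 * x) \<le> c / 2" if "0 \<le> x" "x \<le> bb" for x
  proof -
    have "K\<psi> * (x + K0 * x) \<le> K\<psi> * (bb + K0 * bb)" using that K\<psi>_nonneg K0_pos by (intro mult_left_mono add_mono) auto
    then show ?thesis using bb(3) by simp
  qed
  define sol where "sol = (\<lambda>r a h. h \<in> borel_measurable \<F> \<and> (AE x in \<mu>. norm (h x) \<le> K0 * \<beta> r a) \<and>
    (AE x in \<mu>. cond_ex \<mu> fst (\<lambda>x. \<psi> (x + (U r a x + lift h x))) x = 0))"
  \<comment> \<open>Chosen separately for each (r, a); the regularity in a comes afterwards from
    \<open>solution_lipschitz\<close>.\<close>
  define h where "h = (\<lambda>r a. SOME h. sol r a h)"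
  have UAE: "AE x in \<mu>. norm (U r a x) \<le> \<beta> r a" if "0 < r" for r a using Ub[OF that] by (simp add: \<beta>_def)
  have sol: "sol r a (h r a)" if r: "0 < r" "r \<le> \<delta>0" "norm a \<le> \<delta>0" for r a
  proof -
    have "\<exists>h. sol r a h"
      using solution_exists[OF Um UAE[OF r(1)] \<beta>(1)[OF r] small[OF \<beta>[OF r]]] unfolding sol_def by blast
    then show ?thesis unfolding h_def by (rule someI_ex)
  qed
  have hF: "h r a \<in> borel_measurable \<F>" and hb: "AE x in \<mu>. norm (h r a x) \<le> K0 * \<beta> r a"
    and hs: "AE x in \<mu>. cond_ex \<mu> fst (\<lambda>x. \<psi> (x + (U r a x + lift (h r a) x))) x = 0"
    if "0 < r" "r \<le> \<delta>0" "norm a \<le> \<delta>0" for r a using sol[OF that] unfolding sol_def by blast+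
  define T where "T = (\<lambda>r a x. U r a x + lift (h r a) x)"
  have Tm: "T r a \<in> borel_measurable \<mu>" if "0 < r" "r \<le> \<delta>0" "norm a \<le> \<delta>0" for r a
    unfolding T_def using F_measurable_M[OF hF[OF that]] by measurable
  have T\<tau>: "fst (T r a x) = \<tau> r a (fst x)" for r a x by (simp add: T_def U\<tau> lift_def)
  define KT where "KT = K1 * (1 + L1 * K0)"
  have KT: "KT \<ge> 0" using K1(1) L1(1) K0_pos by (simp add: KT_def)
  have Tb: "AE x in \<mu>. norm (T r a x) \<le> KT * (r + norm a)" if r: "0 < r" "r \<le> \<delta>0" "norm a \<le> \<delta>0" for r a
    using hb[OF r]
  proof (rule eventually_mono)
    fix x assume "norm (h r a x) \<le> K0 * \<beta> r a"
    then have "norm (lift (h r a) x) \<le> L1 * (K0 * \<beta> r a)"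
      using norm_lift_le[of "h r a" x] L1(1) by (meson mult_left_mono order_trans)
    from norm_triangle_mono[OF Ub[OF r(1), of a x] this]
    show "norm (T r a x) \<le> KT * (r + norm a)" by (simp add: T_def \<beta>_def KT_def algebra_simps)
  qed
  have Td: "AE x in \<mu>. norm (T r a x - T r a' x) \<le> KT * norm (a - a')"
    if r: "0 < r" "r \<le> \<delta>0" and a: "norm a \<le> \<delta>0" "norm a' \<le> \<delta>0" for r a a'
  proof -
    \<comment> \<open>Bounds common to both parameters, so that the two solutions lie in one region
      of stability.\<close>
    have Uo: "AE x in \<mu>. norm (U r a'' x) \<le> bb" and ho: "AE x in \<mu>. norm (h r a'' x) \<le> K0 * bb" if "norm a'' \<le> \<delta>0" for a''
    proof -
      show "AE x in \<mu>. norm (U r a'' x) \<le> bb"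
        using UAE[OF r(1)] by (rule eventually_mono) (rule order_trans[OF _ \<beta>(2)[OF r that]])
      have "K0 * \<beta> r a'' \<le> K0 * bb" using \<beta>(2)[OF r that] K0_pos by simp
      with hb[OF r that] show "AE x in \<mu>. norm (h r a'' x) \<le> K0 * bb" by (auto elim: eventually_mono)
    qed
    have UU: "AE x in \<mu>. norm (U r a x - U r a' x) \<le> K1 * norm (a - a')" unfolding Ud using Hb by simp
    have "AE x in \<mu>. norm (h r a x - h r a' x) \<le> K0 * (K1 * norm (a - a'))"
      by (rule solution_lipschitz[OF Um Um hF[OF r a(1)] hF[OF r a(2)] Uo[OF a(1)] Uo[OF a(2)] ho[OF a(1)] ho[OF a(2)] UU bb(1) _ _
          _ hs[OF r a(1)] hs[OF r a(2)]])
        (use bb K0_pos K1(1) in auto)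
    then show ?thesis
    proof (rule eventually_mono)
      fix x assume "norm (h r a x - h r a' x) \<le> K0 * (K1 * norm (a - a'))"
      then have 1: "norm (lift (h r a) x - lift (h r a') x) \<le> L1 * (K0 * (K1 * norm (a - a')))"
        unfolding lift_diff using norm_lift_le[of "\<lambda>x. h r a x - h r a' x" x] L1(1) by (meson mult_left_mono order_trans)
      have e: "T r a x - T r a' x = H (a - a') x + (lift (h r a) x - lift (h r a') x)"
        using Ud[of r a x a'] by (simp add: T_def)
      have "norm (T r a x - T r a' x) \<le> K1 * norm (a - a') + L1 * (K0 * (K1 * norm (a - a')))"
        unfolding e by (rule norm_triangle_mono[OF Hb 1])
      also have "\<dots> = KT * norm (a - a')" by (simp add: KT_def algebra_simps)
      finally show "norm (T r a x - T r a' x) \<le> KT * norm (a - a')" .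
    qed
  qed
  define v where "v = lin_response (D \<mu>) \<Theta>"
  have \<Theta>AE: "AE x in \<mu>. norm (\<Theta> x) \<le> b\<Theta>" using \<Theta>'(2) by simp
  have linU: "lin_response (D \<mu>) (U r a) = r *\<^sub>R v + a" for r a
  proof -
    have "lin_response (D \<mu>) (H a) = (\<Sum>i\<in>UNIV. a $ i *\<^sub>R lin_response (D \<mu>) (\<eta> i))"
      unfolding H_def by (rule lin_response_sum[OF Dq(1) G, where b=b1]) (use \<eta>b1 in \<open>auto simp: measurable_borel_eq\<close>)
    also have "\<dots> = a" using \<eta> basis_expansion[of a] by (simp add: scalar_mult_eq_scaleR)
    finally have H: "lin_response (D \<mu>) (H a) = a" .
    have r: "AE x in \<mu>. norm (r *\<^sub>R \<Theta> x) \<le> \<bar>r\<bar> * b\<Theta>" using \<Theta>'(2) by (simp add: mult_left_mono)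
    have a: "AE x in \<mu>. norm (H a x) \<le> K1 * norm a" using Hb by simp
    have "lin_response (D \<mu>) (U r a) = lin_response (D \<mu>) (\<lambda>x. r *\<^sub>R \<Theta> x) + lin_response (D \<mu>) (H a)"
      unfolding U_def by (rule lin_response_add[OF Dq(1) G _ _ r a]) measurable
    then show ?thesis by (simp add: H v_def lin_response_scaleR)
  qed
  obtain KE where KE: "KE \<ge> 0" "\<And>U h b. U \<in> borel_measurable \<mu> \<Longrightarrow> h \<in> borel_measurable \<F> \<Longrightarrow> 0 \<le> b \<Longrightarrow>
    (AE x in \<mu>. norm (U x) \<le> b) \<Longrightarrow> (AE x in \<mu>. norm (h x) \<le> K0 * b) \<Longrightarrow>
    (AE x in \<mu>. cond_ex \<mu> fst (\<lambda>x. \<psi> (x + (U x + lift h x))) x = 0) \<Longrightarrow>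
    norm ((\<integral>x. blk_app (dx (D \<mu>) x) (U x + lift h x) \<partial>\<mu>) - lin_response (D \<mu>) U) \<le> KE * b\<^sup>2"
    using lin_response_error[OF Dq(1) G] by blast
  \<comment> \<open>A quadratic error in r + |a| is o(r + |a|). It is used for the linear response
    and again for the transport distance.\<close>
  have quad: "\<exists>\<delta>>0. \<delta> \<le> \<delta>0 \<and> (\<forall>r a. 0 < r \<longrightarrow> r \<le> \<delta> \<longrightarrow> norm (a :: real ^ 'k) \<le> \<delta> \<longrightarrow> A * (\<beta> r a)\<^sup>2 \<le> e * (r + norm a))"
    if "0 \<le> A" "0 < e" for A e
  proof -
    define \<delta> where "\<delta> = min \<delta>0 (e / (2 * (A * K1\<^sup>2 + 1)))"
    have AK: "0 \<le> A * K1\<^sup>2" using that by simp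
    have \<delta>: "\<delta> > 0" using that \<delta>0 AK by (simp add: \<delta>_def add_nonneg_pos)
    have "A * (\<beta> r a)\<^sup>2 \<le> e * (r + norm a)" if r: "0 < r" "r \<le> \<delta>" "norm a \<le> \<delta>" for r a
    proof -
      have "r + norm a \<le> 2 * (e / (2 * (A * K1\<^sup>2 + 1)))" using r by (simp add: \<delta>_def)
      then have "r + norm a \<le> e / (A * K1\<^sup>2 + 1)" using AK by (simp add: field_simps)
      then have "(r + norm a) * (A * K1\<^sup>2 + 1) \<le> e" using AK by (simp add: pos_le_divide_eq)
      moreover have "0 \<le> r + norm a" using r by simp
      ultimately have "(r + norm a) * (A * K1\<^sup>2) \<le> e" by (simp add: algebra_simps)
      then have "(r + norm a) * (A * K1\<^sup>2) * (r + norm a) \<le> e * (r + norm a)" using r by (intro mult_right_mono) auto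
      then show ?thesis by (simp add: \<beta>_def power2_eq_square mult_ac)
    qed
    then show ?thesis using \<delta> by (intro exI[of _ \<delta>]) (auto simp: \<delta>_def)
  qed
  have \<tau>c: "continuous_on UNIV (\<tau> r a)" if "r > 0" for r a
  proof -
    have "(K1 * (r + norm a))-lipschitz_on UNIV (\<tau> r a)"
      using \<tau>L[OF that] K1(1) that by (intro lipschitz_onI) (auto simp: dist_norm)
    then show ?thesis by (rule lipschitz_on_continuous_on)
  qed
  have half: "norm (\<tau> r a s - \<tau> r a s') \<le> 1/2 * norm (s - s')" if r: "0 < r" "r \<le> \<delta>0" "norm a \<le> \<delta>0" for r a s s'
    by (rule order_trans[OF \<tau>L[OF r(1)] mult_right_mono])
      (use \<beta>(2)[OF r] bb(2) in \<open>auto simp: \<beta>_def\<close>)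
  define Z where "Z = (\<lambda>x. norm (cond_ex \<mu> fst (\<lambda>x. blk_app (dx \<psi> x) (\<Theta> x)) x))"
  define ZN where "ZN = Lp_norm p \<mu> (cond_ex \<mu> fst (\<lambda>x. blk_app (dx \<psi> x) (\<Theta> x)))"
  have ZN0: "ZN \<ge> 0" by (simp add: ZN_def Lp_norm_def)
  have [measurable]: "Z \<in> borel_measurable \<mu>" unfolding Z_def by measurable
  have Zb: "AE x in \<mu>. norm (Z x) \<le> real CARD('l) * L1 * b\<Theta>"
    using cond_ex_blk_le[OF \<Theta>m \<Theta>AE] by (simp add: Z_def)
  have Zp: "integrable \<mu> (\<lambda>x. Z x powr p)"
    using integrable_powr_of_AE_bound[OF _ Zb, of p] p by (simp add: Z_def)
  define LC where "LC = L1 / c"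
  have LC: "LC \<ge> 0" using L1(1) c_pos by (simp add: LC_def)
  define Q where "Q = LC * (K\<psi> * (1 + K0)\<^sup>2)"
  have Q: "Q \<ge> 0" using LC K\<psi>_nonneg by (simp add: Q_def)
  define KD where "KD = K1 + LC * (real CARD('l) * L1 * K1)"
  have KD: "KD \<ge> 0" using LC L1(1) K1(1) by (simp add: KD_def)
  have dist0: "tdist W_ad p (push \<mu> (\<lambda>x. r *\<^sub>R \<Theta> x)) (push \<mu> (T r a)) \<le> 4 * (KD * norm a + Q * (\<beta> r a)\<^sup>2 + r * LC * ZN)"
    if r: "0 < r" "r \<le> \<delta>0" "norm a \<le> \<delta>0" for r a
  proof -
    have ra0: "norm (0 :: real ^ 'k) \<le> \<delta>0" using \<delta>0 by simp
    \<comment> \<open>To express one transported first coordinate through the other, recover x_1 by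
      the left inverse and apply the other map. Both directions are needed; a = 0 describes the
      first coordinate moved by r \<Theta> alone.\<close>
    obtain j where j: "j \<in> borel_measurable borel" "\<forall>s. j (s + \<tau> r 0 s) = s"
      using id_plus_contraction_left_inverse[OF half[OF r(1,2) ra0]] by blast
    obtain j' where j': "j' \<in> borel_measurable borel" "\<forall>s. j' (s + \<tau> r a s) = s"
      using id_plus_contraction_left_inverse[OF half[OF r]] by blast
    have [measurable]: "\<tau> r a \<in> borel_measurable borel" for a using \<tau>c[OF r(1)] by (rule borel_measurable_continuous_onI)
    note [measurable] = j(1) j'(1) Tm[OF r]
    define F where "F = (\<lambda>x. x + r *\<^sub>R \<Theta> x)"
    define F' where "F' = (\<lambda>x. x + T r a x)"
    have m: "F \<in> borel_measurable \<mu>" "F' \<in> borel_measurable \<mu>" unfolding F_def F'_def by measurable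
    have f1: "fst (F x) = fst x + \<tau> r 0 (fst x)" for x by (simp add: F_def \<tau>0 \<Theta>'(3))
    have f2: "fst (F' x) = fst x + \<tau> r a (fst x)" for x by (simp add: F'_def T\<tau>)
    have "distr \<mu> borel (\<lambda>x. (F x, F' x)) \<in> bicausal_couplings (distr \<mu> borel F) (distr \<mu> borel F')"
    proof (rule bicausal_distr[OF prob_space_axioms m])
      show "(\<lambda>s. j s + \<tau> r a (j s)) \<in> borel_measurable borel" by measurable
      show "fst (F' x) = j (fst (F x)) + \<tau> r a (j (fst (F x)))" for x unfolding f1 f2 using j(2) by simp
      show "(\<lambda>s. j' s + \<tau> r 0 (j' s)) \<in> borel_measurable borel" by measurable
      show "fst (F x) = j' (fst (F' x)) + \<tau> r 0 (j' (fst (F' x)))" for x unfolding f1 f2 using j'(2) by simp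
    qed
    from ad_wasserstein_le[OF this, of p]
    have "ad_wasserstein p (push \<mu> (\<lambda>x. r *\<^sub>R \<Theta> x)) (push \<mu> (T r a)) \<le> transport_cost p (distr \<mu> borel (\<lambda>x. (F x, F' x)))"
      by (simp add: push_def F_def F'_def)
    also have "\<dots> \<le> 4 * ((KD * norm a + Q * (\<beta> r a)\<^sup>2) + (\<integral>x. (r * LC * Z x) powr p \<partial>\<mu>) powr (1 / p))"
    proof (rule transport_cost_distr_le_Lp[OF prob_space_axioms m _ _ _ _ p])
      have HAE: "AE x in \<mu>. norm (H a x) \<le> K1 * norm a" using Hb by simp
      have "AE x in \<mu>. norm (lift (h r a) x) \<le> L1 / c * (r * norm (cond_ex \<mu> fst (\<lambda>x. blk_app (dx \<psi> x) (\<Theta> x)) x)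
          + real CARD('l) * L1 * (K1 * norm a) + K\<psi> * (1 + K0)\<^sup>2 * (\<beta> r a)\<^sup>2)"
        by (rule norm_lift_solution_le[OF _ _ \<Theta>m Hm \<Theta>AE HAE hF[OF r] hb[OF r] UAE[OF r(1)] \<beta>(1)[OF r] hs[OF r]])
          (use r in \<open>simp_all add: U_def\<close>)
      then show "AE x in \<mu>. norm (F x - F' x) \<le> (KD * norm a + Q * (\<beta> r a)\<^sup>2) + r * LC * Z x"
      proof (rule eventually_mono)
        fix x assume l: "norm (lift (h r a) x) \<le> L1 / c * (r * norm (cond_ex \<mu> fst (\<lambda>x. blk_app (dx \<psi> x) (\<Theta> x)) x)
          + real CARD('l) * L1 * (K1 * norm a) + K\<psi> * (1 + K0)\<^sup>2 * (\<beta> r a)\<^sup>2)"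
        have "F x - F' x = - (H a x + lift (h r a) x)" by (simp add: F_def F'_def T_def U_def)
        then have "norm (F x - F' x) = norm (H a x + lift (h r a) x)" by (simp only: norm_minus_cancel)
        also have "\<dots> \<le> K1 * norm a + L1 / c * (r * norm (cond_ex \<mu> fst (\<lambda>x. blk_app (dx \<psi> x) (\<Theta> x)) x)
          + real CARD('l) * L1 * (K1 * norm a) + K\<psi> * (1 + K0)\<^sup>2 * (\<beta> r a)\<^sup>2)"
          by (rule norm_triangle_mono[OF Hb l])
        also have "\<dots> = (KD * norm a + Q * (\<beta> r a)\<^sup>2) + r * LC * Z x"
          unfolding LC_def[symmetric] Z_def[symmetric] by (simp add: KD_def Q_def Z_def algebra_simps)
        finally show "norm (F x - F' x) \<le> (KD * norm a + Q * (\<beta> r a)\<^sup>2) + r * LC * Z x" .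
      qed
      show "0 \<le> KD * norm a + Q * (\<beta> r a)\<^sup>2" using KD Q by simp
      show "0 \<le> r * LC * Z x" for x using r LC by (simp add: Z_def)
      show "integrable \<mu> (\<lambda>x. (r * LC * Z x) powr p)" using Zp by (simp add: powr_mult)
    qed
    also have "(\<integral>x. (r * LC * Z x) powr p \<partial>\<mu>) powr (1 / p) = r * LC * ZN"
    proof -
      have "(\<integral>x. (r * LC * Z x) powr p \<partial>\<mu>) = (r * LC) powr p * (\<integral>x. Z x powr p \<partial>\<mu>)"
        by (simp only: powr_mult[of "r * LC"] Bochner_Integration.integral_mult_right_zero)
      then have "(\<integral>x. (r * LC * Z x) powr p \<partial>\<mu>) powr (1 / p) = ((r * LC) powr p) powr (1 / p) * (\<integral>x. Z x powr p \<partial>\<mu>) powr (1 / p)"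
        by (simp only: powr_mult)
      moreover have "((r * LC) powr p) powr (1 / p) = r * LC" using p r LC by (simp add: powr_powr)
      ultimately show ?thesis by (simp add: ZN_def Lp_norm_def Z_def)
    qed
    finally show ?thesis by simp
  qed
  \<comment> \<open>The general estimate uses a single constant: KT for size and Lipschitz
    dependence of T, 4 KD for the part of the distance that is linear in a.\<close>
  define K where "K = KT + 4 * KD + 1"
  have K: "K > 0" using KT KD by (simp add: K_def)
  define B where "B = 4 * LC * ZN"
  have LS: "Limsup (at_right 0)
      (\<lambda>r. ereal (1 / r) * tdist_set W_ad p (push \<mu> (\<lambda>x. r *\<^sub>R \<Theta> x)) (zero_set p \<phi> \<inter> test_perp p \<psi>))
    \<le> ereal (K * norm v + B)"
  proof (rule Limsup_tdist_set_le_of_family[where T=T, OF p \<mu> R \<phi>0 K \<delta>0])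
    fix r :: real and a a' :: "real ^ 'k" assume r: "0 < r" "r \<le> \<delta>0" "norm a \<le> \<delta>0"
    show "T r a \<in> borel_measurable borel" using Tm[OF r] by (simp add: measurable_borel_eq)
    have KTK: "KT * z \<le> K * z" if "0 \<le> z" for z using that KD by (intro mult_right_mono) (auto simp: K_def)
    show "AE x in \<mu>. norm (T r a x) \<le> K * (r + norm a)"
      using Tb[OF r] by (rule eventually_mono) (rule order_trans[OF _ KTK], use r in auto)
    show "AE x in \<mu>. norm (T r a x - T r a' x) \<le> K * norm (a - a')" if "norm a' \<le> \<delta>0"
      using Td[OF r that] by (rule eventually_mono) (rule order_trans[OF _ KTK], auto)
    show "push \<mu> (T r a) \<in> test_perp p \<psi>"
    proof (rule push_in_test_perp[OF p \<mu> Tm[OF r] Tb[OF r] T\<tau> \<tau>c[OF r(1)]])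
      show "AE x in \<mu>. cond_ex \<mu> fst (\<lambda>x. \<psi> (x + T r a x)) x = 0" using hs[OF r] by (simp add: T_def)
    qed
  next
    fix e :: real assume e: "e > 0"
    obtain \<delta> where \<delta>: "\<delta> > 0" "\<delta> \<le> \<delta>0" "\<And>r a. 0 < r \<Longrightarrow> r \<le> \<delta> \<Longrightarrow> norm (a :: real ^ 'k) \<le> \<delta> \<Longrightarrow> KE * (\<beta> r a)\<^sup>2 \<le> e * (r + norm a)"
      using quad[OF KE(1) e] by blast
    show "\<exists>\<delta>>0. \<forall>r a. 0 < r \<longrightarrow> r \<le> \<delta> \<longrightarrow> norm a \<le> \<delta> \<longrightarrow>
      norm ((\<integral>x. blk_app (dx (D \<mu>) x) (T r a x) \<partial>\<mu>) - (r *\<^sub>R v + a)) \<le> e * (r + norm a)"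
    proof (intro exI[of _ \<delta>] conjI allI impI \<delta>(1))
      fix r and a :: "real ^ 'k" assume r: "0 < r" "r \<le> \<delta>" "norm a \<le> \<delta>"
      then have r': "0 < r" "r \<le> \<delta>0" "norm a \<le> \<delta>0" using \<delta>(2) by auto
      have "norm ((\<integral>x. blk_app (dx (D \<mu>) x) (U r a x + lift (h r a) x) \<partial>\<mu>) - lin_response (D \<mu>) (U r a)) \<le> KE * (\<beta> r a)\<^sup>2"
        by (rule KE(2)[OF Um hF[OF r'] \<beta>(1)[OF r'] UAE[OF r'(1)] hb[OF r'] hs[OF r']])
      also have "\<dots> \<le> e * (r + norm a)" by (rule \<delta>(3)[OF r])
      finally show "norm ((\<integral>x. blk_app (dx (D \<mu>) x) (T r a x) \<partial>\<mu>) - (r *\<^sub>R v + a)) \<le> e * (r + norm a)"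
        by (simp only: linU T_def)
    qed
    have "4 * Q \<ge> 0" using Q by simp
    from quad[OF this e] obtain \<delta>' where \<delta>': "\<delta>' > 0" "\<delta>' \<le> \<delta>0"
      "\<And>r a. 0 < r \<Longrightarrow> r \<le> \<delta>' \<Longrightarrow> norm (a :: real ^ 'k) \<le> \<delta>' \<Longrightarrow> 4 * Q * (\<beta> r a)\<^sup>2 \<le> e * (r + norm a)" by blast
    show "\<exists>\<delta>>0. \<forall>r a. 0 < r \<longrightarrow> r \<le> \<delta> \<longrightarrow> norm a \<le> \<delta> \<longrightarrow>
      tdist W_ad p (push \<mu> (\<lambda>x. r *\<^sub>R \<Theta> x)) (push \<mu> (T r a)) \<le> K * norm a + r * B + e * (r + norm a)"
    proof (intro exI[of _ \<delta>'] conjI allI impI \<delta>'(1))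
      fix r and a :: "real ^ 'k" assume r: "0 < r" "r \<le> \<delta>'" "norm a \<le> \<delta>'"
      then have r': "0 < r" "r \<le> \<delta>0" "norm a \<le> \<delta>0" using \<delta>'(2) by auto
      have "tdist W_ad p (push \<mu> (\<lambda>x. r *\<^sub>R \<Theta> x)) (push \<mu> (T r a)) \<le> 4 * (KD * norm a + Q * (\<beta> r a)\<^sup>2 + r * LC * ZN)"
        by (rule dist0[OF r'])
      also have "\<dots> = 4 * KD * norm a + r * B + 4 * Q * (\<beta> r a)\<^sup>2" by (simp add: B_def algebra_simps)
      also have "\<dots> \<le> K * norm a + r * B + e * (r + norm a)"
        using \<delta>'(3)[OF r] KT by (intro add_mono[OF add_mono[OF mult_right_mono order_refl]]) (auto simp: K_def)
      finally show "tdist W_ad p (push \<mu> (\<lambda>x. r *\<^sub>R \<Theta> x)) (push \<mu> (T r a)) \<le> K * norm a + r * B + e * (r + norm a)" .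
    qed
  qed
  define A1 where "A1 = norm (\<integral>x. blk_app (dx (D \<mu>) x) (\<Theta> x) \<partial>\<mu>)"
  define N2 where "N2 = norm (\<integral>x. multiplier (D \<mu>) x *v blk_app (dx \<psi> x) (\<Theta> x) \<partial>\<mu>)"
  \<comment> \<open>\<Theta> is fixed, so the multiplier term can be bounded by a quotient. The case
    ZN = 0 is genuine: there the multiplier term must vanish as well, which holds because it depends
    on \<Theta> only through E_1[(\<partial>\<psi>) \<Theta>].\<close>
  define C2 where "C2 = (if ZN = 0 then 0 else N2 / ZN)"
  have N2: "N2 \<le> C2 * ZN" and C2: "C2 \<ge> 0"
  proof -
    have "N2 = 0" if "ZN = 0"
    proof -
      have "(\<integral>x. Z x powr p \<partial>\<mu>) = 0" using that by (simp add: ZN_def Lp_norm_def Z_def)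
      then have "AE x in \<mu>. Z x powr p = 0" using Zp by (subst (asm) integral_nonneg_eq_0_iff_AE) auto
      then have "AE x in \<mu>. multiplier (D \<mu>) x *v cond_ex \<mu> fst (\<lambda>x. blk_app (dx \<psi> x) (\<Theta> x)) x = 0"
        by (rule eventually_mono) (simp add: Z_def)
      then have "(\<integral>x. multiplier (D \<mu>) x *v cond_ex \<mu> fst (\<lambda>x. blk_app (dx \<psi> x) (\<Theta> x)) x \<partial>\<mu>) = 0"
        by (rule integral_eq_zero_AE)
      then show ?thesis unfolding N2_def integral_multiplier_cond_ex[OF G \<Theta>m \<Theta>AE] by simp
    qed
    then show "N2 \<le> C2 * ZN" by (simp add: C2_def)
    show "C2 \<ge> 0" using ZN0 by (simp add: C2_def N2_def)
  qed
  have "norm v \<le> A1 + N2" unfolding v_def lin_response_def A1_def N2_def by (rule norm_triangle_ineq4)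
  then have "norm v \<le> A1 + C2 * ZN" using N2 by linarith
  then have "K * norm v \<le> K * (A1 + C2 * ZN)" using K by (intro mult_left_mono) auto
  then have "K * norm v + B \<le> K * A1 + (K * C2 + 4 * LC) * ZN" by (simp add: B_def algebra_simps)
  \<comment> \<open>Enlarge both coefficients to a common positive one.\<close>
  also have "\<dots> \<le> (K + K * C2 + 4 * LC) * A1 + (K + K * C2 + 4 * LC) * ZN"
    using K C2 LC ZN0 by (intro add_mono mult_right_mono) (auto simp: A1_def)
  finally have le: "K * norm v + B \<le> (K + K * C2 + 4 * LC) * (A1 + ZN)" by (simp add: algebra_simps)
  have "K + K * C2 + 4 * LC > 0" using K C2 LC by (simp add: add_pos_nonneg)
  moreover have "ereal (K * norm v + B) \<le> ereal ((K + K * C2 + 4 * LC) * (A1 + ZN))" using le by simp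
  ultimately show ?thesis using order_trans[OF LS] unfolding A1_def ZN_def by blast
qed

end

theorem proposition3p3:
  fixes p :: real
    and d :: metric_kind
    and \<mu> :: "('d::finite) path measure"
    and \<phi> :: "'d path measure \<Rightarrow> real ^ ('k::finite)"
    and D\<phi> :: "'d path measure \<Rightarrow> 'd path \<Rightarrow> real ^ 'k"
    and \<psi> :: "'d path \<Rightarrow> real ^ ('l::finite)"
    and \<Theta> :: "'d path \<Rightarrow> 'd path"
  assumes "p > 1"
    and "\<mu> \<in> prob_moment p"
    and "condition_R p \<phi> D\<phi>"
    and "\<phi> \<mu> = 0"
    and "cond_A d p \<mu> (D\<phi> \<mu>) \<psi>"
    and "C1 \<Theta>"
    and "compact_supp d \<Theta>"
    and "\<Theta> \<in> Lp_kind d p \<mu>"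
  shows "\<exists>C>0.
    Limsup (at_right 0)
      (\<lambda>r. ereal (1 / r) *
        tdist_set d p (push \<mu> (\<lambda>x. r *\<^sub>R \<Theta> x)) (zero_set p \<phi> \<inter> test_perp p \<psi>))
    \<le> ereal (C *
        (norm (\<integral>x. blk_app (dx_kind d \<mu> (D\<phi> \<mu>) x) (\<Theta> x) \<partial>\<mu>)
         + Lp_norm p \<mu> (cond_ex \<mu> fst (\<lambda>x. blk_app (dx_kind d \<mu> \<psi> x) (\<Theta> x)))))"
proof (cases d)
  case W
  have cont: "continuous_on UNIV \<Theta>" by (rule C1_imp_continuous_on[OF assms(6)])
  then have m: "\<Theta> \<in> borel_measurable borel" by (rule borel_measurable_continuous_onI)
  obtain t where t: "\<And>x. norm (\<Theta> x) \<le> t"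
    using bounded_of_compact_support[OF cont] assms(7) W by auto
  have A: "cond_A_W p \<mu> (D\<phi> \<mu>) \<psi>" using assms(5) W by simp
  define Z where "Z = Lp_norm p \<mu> (cond_ex \<mu> fst (\<lambda>x. blk_app (dx_kind d \<mu> \<psi> x) (\<Theta> x)))"
  have Z: "Z \<ge> 0" by (simp add: Z_def Lp_norm_def)
  define A1 where "A1 = norm (\<integral>x. blk_app (dx (D\<phi> \<mu>) x) (\<Theta> x) \<partial>\<mu>)"
  obtain C where C: "C > 0" "Limsup (at_right 0)
      (\<lambda>r. ereal (1 / r) * tdist_set W p (push \<mu> (\<lambda>x. r *\<^sub>R \<Theta> x)) (zero_set p \<phi> \<inter> test_perp p \<psi>))
    \<le> ereal (C * A1)"
    using Limsup_wasserstein_le[OF assms(1-4) A m t] unfolding A1_def by blast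
  \<comment> \<open>The conditional term is nonnegative; adding it brings the bound into the form
    common to both distances.\<close>
  have "ereal (C * A1) \<le> ereal (C * (A1 + Z))" using C(1) Z by simp
  with C have "\<exists>C>0. Limsup (at_right 0)
      (\<lambda>r. ereal (1 / r) * tdist_set W p (push \<mu> (\<lambda>x. r *\<^sub>R \<Theta> x)) (zero_set p \<phi> \<inter> test_perp p \<psi>))
    \<le> ereal (C * (A1 + Z))" using order_trans by blast
  then show ?thesis unfolding Z_def A1_def W by simp
next
  case W_ad
  note \<mu> = assms(2) and \<mu>' = prob_momentD[OF assms(2)] and p = assms(1)
  interpret prob_space \<mu> by (rule \<mu>'(1))
  have A: "cond_A_W_ad p \<mu> (D\<phi> \<mu>) \<psi>" using assms(5) W_ad by simp
  have C2: "C2_bounded_derivs \<psi>" and c\<psi>: "AE x in \<mu>. cond_ex \<mu> fst \<psi> x = 0" using A by (auto simp: cond_A_W_ad_def)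
  obtain c where c: "c > 0" "AE x in \<mu>. mat_ge (cond_ex \<mu> fst (\<lambda>y. dx2 \<psi> y ** transpose (dx2 \<psi> y)) x) (mat c)"
    using A by (auto simp: cond_A_W_ad_def)
  obtain c' where c': "c' > 0" "\<And>lam h. h \<in> Lp (conj_exp p) (distr \<mu> borel fst) \<Longrightarrow>
        Lp_norm (conj_exp p) \<mu> (\<lambda>x. blk_tapp (dx_ad \<mu> (D\<phi> \<mu>) x) lam + blk_tapp (dx_ad \<mu> \<psi> x) (h (fst x)))
        \<ge> c' * (norm lam + Lp_norm (conj_exp p) \<mu> (\<lambda>x. h (fst x)))"
    using A unfolding cond_A_W_ad_def by blast
  obtain L1 where L1: "L1 \<ge> 0" "\<And>x v. norm (blk_app (dx \<psi> x) v) \<le> L1 * norm v"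
    using C2_bounded_derivs_estimates(2)[OF C2] by blast
  obtain L2 where L2: "L2 \<ge> 0" "\<And>x v w. norm (\<psi> (x + v) - \<psi> (x + w) - blk_app (dx \<psi> x) (v - w)) \<le> L2 * (norm v + norm w) * norm (v - w)"
    using C2_bounded_derivs_estimates(3)[OF C2] by blast
  have inorm: "integrable \<mu> norm"
  proof (rule poly_growth_integrable[OF \<mu>, where C=1])
    show "norm (norm x) \<le> 1 * (1 + norm x powr p)" for x :: "'d path"
      using powr_le_one_plus_powr[of "norm x" 1 p] p by simp
  qed auto
  have coer: "AE x in \<mu>. \<forall>v. c * (v \<bullet> v) \<le> v \<bullet> (cond_ex \<mu> fst (\<lambda>y. dx2 \<psi> y ** transpose (dx2 \<psi> y)) x *v v)"
    using c(2)
  proof (rule eventually_mono)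
    fix x assume ge: "mat_ge (cond_ex \<mu> fst (\<lambda>y. dx2 \<psi> y ** transpose (dx2 \<psi> y)) x) (mat c)"
    \<comment> \<open>Conditional expectations are taken entrywise and the integrand is symmetric,
      so the Gram matrix is symmetric at every point; this is what turns the eigenvalue bound into
      coercivity.\<close>
    have comp: "cond_ex \<mu> fst f x $ i $ j = real_cond_exp \<mu> (vimage_algebra (space \<mu>) fst borel) (\<lambda>y. f y $ i $ j) x"
      for f :: "'d path \<Rightarrow> real ^ 'l ^ 'l" and i j
    proof -
      have "axis i (axis j 1) \<in> (Basis :: (real ^ 'l ^ 'l) set)" by (auto simp: Basis_vec_def)
      from cond_ex_inner[OF this, of \<mu> fst f x] show ?thesis by (simp add: inner_axis)
    qed
    have "transpose (cond_ex \<mu> fst (\<lambda>y. dx2 \<psi> y ** transpose (dx2 \<psi> y)) x) = cond_ex \<mu> fst (\<lambda>y. dx2 \<psi> y ** transpose (dx2 \<psi> y)) x"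
      unfolding vec_eq_iff transpose_def[of "cond_ex \<mu> fst _ x"]
      by (simp add: comp) (simp add: matrix_matrix_mult_def transpose_def mult.commute)
    then show "\<forall>v. c * (v \<bullet> v) \<le> v \<bullet> (cond_ex \<mu> fst (\<lambda>y. dx2 \<psi> y ** transpose (dx2 \<psi> y)) x *v v)"
      using mat_ge_coercive[OF _ ge] by blast
  qed
  interpret constrained \<mu> \<psi> L1 L2 c
    by unfold_locales (use \<mu>'(2) inorm C2_bounded_derivs_estimates(1)[OF C2] L1 L2 c\<psi> c(1) coer in auto)
  have ad: "adapted \<Theta>" using assms(8) W_ad by simp
  have \<Theta>: "\<Theta> \<in> adapted_fields" using assms(6,7) ad W_ad by (intro adapted_C1_in_adapted_fields) auto
  obtain b t L where t: "\<Theta> \<in> borel_measurable borel" "\<And>x. norm (\<Theta> x) \<le> b" "\<And>x. fst (\<Theta> x) = t (fst x)"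
    by (rule adapted_fieldsE[OF \<Theta>]) blast
  have cond: "conditioning \<mu> (fst :: 'd path \<Rightarrow> _)" by unfold_locales
  \<comment> \<open>The estimate was proved with ordinary derivatives; adaptedness of \<Theta>
    translates both of its terms.\<close>
  have e1: "(\<integral>x. blk_app (dx_ad \<mu> (D\<phi> \<mu>) x) (\<Theta> x) \<partial>\<mu>) = (\<integral>x. blk_app (dx (D\<phi> \<mu>) x) (\<Theta> x) \<partial>\<mu>)"
    by (rule cond_ex_blk_dx_ad(2)[OF cond \<mu>'(2) integrable_dx_conj_powr(1)[OF assms(3) p \<mu>] t])
  have "AE x in \<mu>. cond_ex \<mu> fst (\<lambda>x. blk_app (dx_ad \<mu> \<psi> x) (\<Theta> x)) x = cond_ex \<mu> fst (\<lambda>x. blk_app (dx \<psi> x) (\<Theta> x)) x"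
    by (rule cond_ex_blk_dx_ad(1)[OF cond \<mu>'(2) integrable_dx_psi t])
  then have e2: "Lp_norm p \<mu> (cond_ex \<mu> fst (\<lambda>x. blk_app (dx_ad \<mu> \<psi> x) (\<Theta> x)))
      = Lp_norm p \<mu> (cond_ex \<mu> fst (\<lambda>x. blk_app (dx \<psi> x) (\<Theta> x)))"
    unfolding Lp_norm_def
    by (intro arg_cong[where f="\<lambda>z. z powr (1 / p)"] integral_cong_AE) (auto elim: eventually_mono)
  show ?thesis
    using Limsup_ad_wasserstein_le[OF p \<mu> assms(3,4) c' \<Theta>] unfolding W_ad by (simp add: e1 e2)
qed

end
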